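(* Let $f$ and $g$ be the identity (a student of ability $a$ in a job of quality $q$ contributes $aq$), and let the aggregate distribution of student abilities be uniform on $[0,1]$. Then the connected equilibrium $Q_{eq}$ of the strategic grading game satisfies $$\frac{\int_0^1 q\,Q_T^{-1}(q)\,d\mu(q)}{\int_0^1 q\,Q_{eq}^{-1}(q)\,d\mu(q)}\le 1.36,$$ i.e. the price of anarchy of the strategic grading game is at most $1.36$.
   Context: Students form a continuum of unit mass; aggregate true abilities uniform on $[0,1]$. Jobs form a continuum of unit mass with qualities in $[0,1]$ distributed with continuous CDF $\mu$ with positive density $\mu'$. The truthful mapping $Q_T$ is the nondecreasing assortative map (students with ability at most $a$ are exactly those assigned jobs of quality at most $Q_T(a)$); it is assumed to switch between convex and concave pieces only finitely many times. There are finitely many school types, each a continuum of infinitesimal schools with public ability distributions. A transcript structure of a school is a (possibly stochastic) map giving each student a label ("expected ability") $\hat a\in[0,1]$ such that the average true ability of the school's students with label $\hat a$ equals $\hat a$. A profile of transcript structures yields an aggregate label distribution $G$; students are then assigned to jobs assortatively by label, and the desirability mapping $Q(\hat a)$ is the expected quality of the job given to a student with label $\hat a$. A profile is an equilibrium if for each school type $i$, with label distribution $G_i$, and every alternative transcript structure with label distribution $\hat G_i$, $\int_0^1 Q\,dG_i\ge\int_0^1 Q\,d\hat G_i$ with $Q$ held fixed. An equilibrium with lowest and highest labels $\hat a_L,\hat a_H$ is connected if every $\hat a\in(\hat a_L,\hat a_H)$ has a neighborhood all of whose labels are produced by some school. The connected equilibrium is unique (Ostrovsky–Schwarz) and its desirability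 mapping is denoted $Q_{eq}$; $Q_{eq}^{-1}(q)$ is the label of the student receiving job $q$. *)

theory Defs
  imports "HOL-Analysis.Analysis" "HOL-Probability.Probability"
begin

(* Job-quality CDF mu on [0,1] (strictly increasing, continuous).
   Truthful mapping Q_T = mu^{-1}: students with ability <= a get jobs of quality <= Q_T a,
   i.e. mu (Q_T a) = a (aggregate abilities uniform on [0,1]). *)
definition QT :: "(real \<Rightarrow> real) \<Rightarrow> real \<Rightarrow> real" where
  "QT mu a = (THE q. q \<in> {0..1} \<and> mu q = a)"

definition finitely_many_switches :: "(real \<Rightarrow> real) \<Rightarrow> bool" where
  "finitely_many_switches h \<longleftrightarrow>
     (\<exists>(k::nat) (t::nat \<Rightarrow> real). t 0 = 0 \<and> t k = 1 \<and> (\<forall>j<k. t j < t (Suc j)) \<and>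
        (\<forall>j<k. convex_on {t j..t (Suc j)} h \<or> concave_on {t j..t (Suc j)} h))"

(* A transcript structure of a school with ability distribution F, given as the joint
   distribution J of (true ability, label): ability marginal F, labels in [0,1], and for
   every Borel set B of labels the average true ability of students with label in B
   equals the average label, i.e. E[ability | label] = label. *)
definition is_transcript :: "real measure \<Rightarrow> (real \<times> real) measure \<Rightarrow> bool" where
  "is_transcript F J \<longleftrightarrow>
     prob_space J \<and> sets J = sets borel \<and> distr J borel fst = F \<and>
     (AE p in J. snd p \<in> {0..1}) \<and>
     (\<forall>B \<in> sets borel.
        (\<integral>p. indicator B (snd p) * fst p \<partial>J) = (\<integral>p. indicator B (snd p) * snd p \<partial>J))"

(* aggregate label distribution G (CDF) and its left limit G(l-) for a profile J of
   transcript structures of school types i < n with masses w i *)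
definition agg_cdf :: "nat \<Rightarrow> (nat \<Rightarrow> real) \<Rightarrow> (nat \<Rightarrow> (real \<times> real) measure) \<Rightarrow> real \<Rightarrow> real" where
  "agg_cdf n w J l = (\<Sum>i<n. w i * measure (J i) {p. snd p \<le> l})"

definition agg_cdf_lt :: "nat \<Rightarrow> (nat \<Rightarrow> real) \<Rightarrow> (nat \<Rightarrow> (real \<times> real) measure) \<Rightarrow> real \<Rightarrow> real" where
  "agg_cdf_lt n w J l = (\<Sum>i<n. w i * measure (J i) {p. snd p < l})"

(* desirability Q(l): expected quality of the job of a student with label l under
   assortative matching by label (ties broken uniformly at random) *)
definition desirability ::
  "(real \<Rightarrow> real) \<Rightarrow> nat \<Rightarrow> (nat \<Rightarrow> real) \<Rightarrow> (nat \<Rightarrow> (real \<times> real) measure) \<Rightarrow> real \<Rightarrow> real" where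
  "desirability mu n w J l =
     (let G = agg_cdf n w J l; Gm = agg_cdf_lt n w J l in
      if Gm < G then integral {Gm..G} (QT mu) / (G - Gm) else QT mu G)"

definition is_equilibrium ::
  "(real \<Rightarrow> real) \<Rightarrow> nat \<Rightarrow> (nat \<Rightarrow> real) \<Rightarrow> (nat \<Rightarrow> real measure) \<Rightarrow> (nat \<Rightarrow> (real \<times> real) measure) \<Rightarrow> bool" where
  "is_equilibrium mu n w F J \<longleftrightarrow>
     (\<forall>i<n. is_transcript (F i) (J i)) \<and>
     (\<forall>i<n. \<forall>J'. is_transcript (F i) J' \<longrightarrow>
        (\<integral>p. desirability mu n w J (snd p) \<partial>J') \<le> (\<integral>p. desirability mu n w J (snd p) \<partial>(J i)))"

definition produced :: "nat \<Rightarrow> (nat \<Rightarrow> real) \<Rightarrow> (nat \<Rightarrow> (real \<times> real) measure) \<Rightarrow> real \<Rightarrow> bool" where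
  "produced n w J l \<longleftrightarrow>
     (\<forall>e>0. (\<Sum>i<n. w i * measure (J i) {p. l - e < snd p \<and> snd p < l + e}) > 0)"

definition is_connected_equilibrium ::
  "(real \<Rightarrow> real) \<Rightarrow> nat \<Rightarrow> (nat \<Rightarrow> real) \<Rightarrow> (nat \<Rightarrow> real measure) \<Rightarrow> (nat \<Rightarrow> (real \<times> real) measure) \<Rightarrow> bool" where
  "is_connected_equilibrium mu n w F J \<longleftrightarrow>
     is_equilibrium mu n w F J \<and>
     (let aL = Inf {l. produced n w J l}; aH = Sup {l. produced n w J l} in
      \<forall>a. aL < a \<and> a < aH \<longrightarrow> (\<exists>e>0. \<forall>l. a - e < l \<and> l < a + e \<longrightarrow> produced n w J l))"

(* Q_eq^{-1}(q): label of the student receiving job q = quantile of G at mu q *)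
definition eq_label_of_job ::
  "(real \<Rightarrow> real) \<Rightarrow> nat \<Rightarrow> (nat \<Rightarrow> real) \<Rightarrow> (nat \<Rightarrow> (real \<times> real) measure) \<Rightarrow> real \<Rightarrow> real" where
  "eq_label_of_job mu n w J q = Inf {x \<in> {0..1}. mu q \<le> agg_cdf n w J x}"

end

theory Submission
  imports Defs
begin

text \<open>
  At an equilibrium no label carries an atom: otherwise the desirability \<open>Q\<close> jumps there, and a school
  using the label gains by moving a little of its mass just beyond the jump. Hence the rank \<open>G l\<close> of the
  students is uniform, \<open>Q = QT mu \<circ> G\<close> is the distribution function of a law \<open>D\<close> on \<open>[0,1]\<close>, and the two
  integrals are the means of \<open>Q l * G l\<close> and of \<open>Q l * l\<close> over the labels \<open>l\<close>.

  Write \<open>Q l\<close> as the \<open>D\<close>-measure of the \<open>t \<le> l\<close>. For each \<open>t\<close>, uniformity of \<open>G l\<close> bounds the mean of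
  \<open>G l\<close> on \<open>l \<ge> t\<close> by \<open>(1 - v)\<^sup>2 / 2\<close> plus \<open>v\<close> times the mass of the labels above \<open>t\<close>, and the certificate
  bounds \<open>(1 - v)\<^sup>2 / 2\<close> by \<open>rho\<close> times the mean of the (uniform) abilities above \<open>t\<close> plus \<open>s\<close> times \<open>1/2 - t\<close>.
  It remains to compare abilities with labels, school by school: in a small cell of labels with mean \<open>m\<close>,
  lift the students of ability above \<open>m\<close> towards their ability, but not beyond a knot \<open>k\<close>. That this
  deviation does not pay is an inequality between expectations of \<open>Q\<close>, and a nonnegative combination of these
  inequalities over five knots gives the comparison.\<close>

section \<open>Integration\<close>

text \<open>For fixed joint laws of ability and label, the bound and all deviation inequalities are
  linear in \<open>Q\<close>, hence in \<open>D\<close>; so a dual solution of a linear program can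
  prove the bound without determining the equilibrium. The obstacle is that a deviation constrains
  only the integral over all thresholds \<open>t\<close>. For a single \<open>t\<close> its gain is
  therefore kept as a term: with these terms added, \<open>layer_ineq\<close> holds for each
  \<open>t\<close> separately, and only after integration over \<open>D\<close> does optimality of
  the school bound their total. A student of ability \<open>a\<close> is lifted with probability
  \<open>a\<close> because the uniform law of abilities enters through the tail means of
  \<open>a\<close> over \<open>a \<ge> t\<close>, and the gains must carry the same weight. The
  multiplier \<open>s\<close> prices the fact that labels have the mean 1/2 of the abilities.
  Deviations pool a cell at its mean, whereas the integrals contain the desirabilities of the labels
  themselves; as the exclusion of atoms makes \<open>Q\<close> continuous, the difference vanishes
  with the mesh. That exclusion rests on the same deviation, with a knot just above the
  label.\<close>

lemma bounded_fubini:
  fixes f :: "'a \<Rightarrow> 'b \<Rightarrow> real"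
  assumes "prob_space M" "prob_space N" and m: "case_prod f \<in> borel_measurable (M \<Otimes>\<^sub>M N)"
    and x: "AE x in M. x \<in> S" and y: "AE y in N. y \<in> T"
    and b: "\<And>x y. x \<in> S \<Longrightarrow> y \<in> T \<Longrightarrow> \<bar>f x y\<bar> \<le> K"
  shows "(\<integral>y. \<integral>x. f x y \<partial>M \<partial>N) = (\<integral>x. \<integral>y. f x y \<partial>N \<partial>M)"
    and "integrable N (\<lambda>y. \<integral>x. f x y \<partial>M)" and "integrable M (\<lambda>x. \<integral>y. f x y \<partial>N)"
proof -
  interpret M: prob_space M by fact
  interpret N: prob_space N by fact
  interpret MN: pair_prob_space M N ..
  have d1: "distr (M \<Otimes>\<^sub>M N) M fst = M"
    by (rule N.distr_pair_fst)
  have d2: "distr (M \<Otimes>\<^sub>M N) N snd = N"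
    by (rule measure_eqI) (auto simp: emeasure_distr N.emeasure_pair_measure_Times vimage_snd space_pair_measure
         Times_Int_Times Int_absorb1 M.emeasure_space_1 dest: sets.sets_into_space)
  have 1: "AE z in M \<Otimes>\<^sub>M N. fst z \<in> S"
    by (rule AE_distrD[OF measurable_fst]) (simp only: d1 x)
  have 2: "AE z in M \<Otimes>\<^sub>M N. snd z \<in> T"
    by (rule AE_distrD[OF measurable_snd]) (simp only: d2 y)
  have i: "integrable (M \<Otimes>\<^sub>M N) (case_prod f)"
  proof (rule MN.integrable_const_bound[where B=K])
    show "AE x in M \<Otimes>\<^sub>M N. norm (case x of (x, xa) \<Rightarrow> f x xa) \<le> K"
      using 1 2 by eventually_elim (auto intro: b)
  qed (rule m)
  show "(\<integral>y. \<integral>x. f x y \<partial>M \<partial>N) = (\<integral>x. \<integral>y. f x y \<partial>N \<partial>M)" by (rule MN.Fubini_integral[OF i])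
  show "integrable N (\<lambda>y. \<integral>x. f x y \<partial>M)" by (rule MN.integrable_snd[OF i])
  show "integrable M (\<lambda>x. \<integral>y. f x y \<partial>N)" by (rule MN.integrable_fst[OF i])
qed

lemma finite_mixture:
  fixes M :: "nat \<Rightarrow> 'a :: second_countable_topology measure" and w :: "nat \<Rightarrow> real"
  assumes w: "\<And>i. i < n \<Longrightarrow> 0 \<le> w i" "(\<Sum>i<n. w i) = 1"
    and M: "\<And>i. i < n \<Longrightarrow> prob_space (M i) \<and> sets (M i) = sets borel"
  obtains N where "prob_space N" "sets N = sets borel"
    "\<And>f B. f \<in> borel_measurable borel \<Longrightarrow> (\<And>x. \<bar>f x\<bar> \<le> B) \<Longrightarrow> (\<integral>x. f x \<partial>N) = (\<Sum>i<n. w i * (\<integral>x. f x \<partial>M i))"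
    "\<And>P. (\<And>i. i < n \<Longrightarrow> AE x in M i. P x) \<Longrightarrow> {x. P x} \<in> sets borel \<Longrightarrow> AE x in N. P x"
proof -
  define p where "p = embed_pmf (\<lambda>i. if i < n then w i else 0)"
  have pmf: "pmf p i = (if i < n then w i else 0)" for i
    unfolding p_def
  proof (rule pmf_embed_pmf)
    have "(\<integral>\<^sup>+ i. ennreal (if i < n then w i else 0) \<partial>count_space UNIV) = (\<integral>\<^sup>+ i. ennreal (w i) * indicator {..<n} i \<partial>count_space UNIV)"
      by (intro nn_integral_cong) (auto simp: indicator_def)
    also have "\<dots> = (\<Sum>i<n. ennreal (w i))"
      by (simp add: nn_integral_count_space_indicator[symmetric] nn_integral_count_space_finite)
    also have "\<dots> = 1" using w by (subst sum_ennreal) auto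
    finally show "(\<integral>\<^sup>+ i. ennreal (if i < n then w i else 0) \<partial>count_space UNIV) = 1" .
  qed (use w in \<open>auto split: if_splits\<close>)
  have sp: "set_pmf p \<subseteq> {..<n}" by (auto simp: set_pmf_iff pmf split: if_splits)
  \<comment> \<open>The point mass for indices from \<open>n\<close> on only makes every
    \<open>K i\<close> a probability measure, so that \<open>K\<close> is a kernel on all of
    \<open>nat\<close>.\<close>
  define K where "K = (\<lambda>i. if i < n then M i else return borel undefined)"
  have K1: "prob_space (K i)" "sets (K i) = sets borel" for i
    using M by (auto simp: K_def intro: prob_space_return)
  have K: "K \<in> measurable (measure_pmf p) (subprob_algebra borel)"
    using K1 by (auto simp: space_subprob_algebra intro!: prob_space_imp_subprob_space)
  define N where "N = measure_pmf p \<bind> K"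
  have sN: "sets N = sets borel" unfolding N_def by (rule sets_bind) (use K1 in auto)
  have AEN: "(AE x in N. P x) \<longleftrightarrow> (AE i in measure_pmf p. AE x in K i. P x)" if "{x. P x} \<in> sets borel" for P
    unfolding N_def by (rule AE_bind[OF K]) (use that in \<open>simp add: pred_def\<close>)
  have pN: "prob_space N" unfolding N_def
    by (rule prob_space.prob_space_bind[OF prob_space_measure_pmf _ K]) (use K1 in auto)
  have 1: "(\<integral>x. f x \<partial>N) = (\<Sum>i<n. w i * (\<integral>x. f x \<partial>M i))"
    if "f \<in> borel_measurable borel" "\<And>x. \<bar>f x\<bar> \<le> B" for f B
  proof -
    have "(\<integral>x. f x \<partial>N) = (\<integral>i. (\<integral>x. f x \<partial>K i) \<partial>measure_pmf p)" unfolding N_def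
      by (rule integral_bind[OF that(1) _ K, where B=B and B'=1])
         (use that(2) K1 in \<open>auto simp: prob_space.emeasure_space_1 intro: measure_pmf.finite_measure_axioms\<close>)
    also have "\<dots> = (\<Sum>i<n. pmf p i *\<^sub>R (\<integral>x. f x \<partial>K i))"
      by (rule integral_measure_pmf) (use sp in auto)
    also have "\<dots> = (\<Sum>i<n. w i * (\<integral>x. f x \<partial>M i))" by (intro sum.cong) (auto simp: pmf K_def)
    finally show ?thesis .
  qed
  have 2: "AE x in N. P x" if "\<And>i. i < n \<Longrightarrow> AE x in M i. P x" "{x. P x} \<in> sets borel" for P
    unfolding AEN[OF that(2)] AE_measure_pmf_iff
  proof
    fix i assume "i \<in> set_pmf p"
    then have "i < n" using sp by auto
    then show "AE x in K i. P x" using that(1)[of i] unfolding K_def by simp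
  qed
  show thesis by (rule that[OF pN sN 1 2])
qed

section \<open>The uniform law on the unit interval\<close>

definition unif01 :: "real measure" where "unif01 = uniform_measure lborel {0..1}"

lemma real_distribution_unif01: "real_distribution unif01"
  unfolding unif01_def by (intro real_distribution.intro real_distribution_axioms.intro prob_space_uniform_measure) auto

interpretation U: real_distribution unif01 by (rule real_distribution_unif01)

lemma unif01_range: "AE u in unif01. u \<in> {0..1}"
  unfolding unif01_def by (subst AE_uniform_measure) auto

lemma cdf_unif01: "cdf unif01 x = (if x < 0 then 0 else if x \<le> 1 then x else 1)"
proof -
  have "{0..1} \<inter> {..x} = (if x < 0 then {} else if x \<le> 1 then {0..x} else {0..1})" by auto
  then show ?thesis
    by (simp add: unif01_def cdf_def measure_def emeasure_uniform_measure divide_ennreal_def)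
qed

lemma real_distribution_eq_unif01:
  assumes "real_distribution M" "AE x in M. x \<in> {0..1}" "\<And>x. x \<in> {0..1} \<Longrightarrow> measure M {..x} = x"
  shows "M = unif01"
proof (rule cdf_unique[OF assms(1) real_distribution_unif01], rule ext)
  fix x
  interpret M: real_distribution M by fact
  show "cdf M x = cdf unif01 x"
  proof -
    consider "x < 0" | "0 \<le> x" "x \<le> 1" | "1 < x" by linarith
    then show ?thesis
    proof cases
      case 1
      have "measure M {..x} = measure M {}"
        by (rule M.finite_measure_eq_AE) (use assms(2) 1 in \<open>auto elim!: eventually_mono\<close>)
      then have "cdf M x = 0" by (simp add: cdf_def)
      then show ?thesis using 1 by (simp add: cdf_unif01)
    next
      case 2
      then have "cdf M x = x" using assms(3) by (simp add: cdf_def)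
      then show ?thesis using 2 by (simp add: cdf_unif01)
    next
      case 3
      have "AE y in M. y \<in> {..x}" using assms(2) by eventually_elim (use 3 in auto)
      then have "measure M {..x} = 1" by (subst M.prob_eq_1) auto
      then have "cdf M x = 1" by (simp add: cdf_def)
      then show ?thesis using 3 by (simp add: cdf_unif01)
    qed
  qed
qed

lemma integral_unif01:
  fixes f :: "real \<Rightarrow> real"
  assumes "f \<in> borel_measurable borel"
  shows "(\<integral>u. f u \<partial>unif01) = (LINT u:{0..1}|lborel. f u)"
proof -
  have eq: "unif01 = density lborel (\<lambda>u. ennreal (indicator {0..1} u))"
    unfolding unif01_def uniform_measure_def by (simp add: divide_ennreal_def ennreal_indicator)
  show ?thesis unfolding eq set_lebesgue_integral_def using assms by (intro integral_density) auto
qed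

lemma unif01_tail_mean:
  assumes "0 \<le> t" "t \<le> 1" shows "(\<integral>u. (if t \<le> u then u else 0) \<partial>unif01) = (1 - t\<^sup>2) / 2"
proof -
  have "(\<integral>u. (if t \<le> u then u else 0) \<partial>unif01) = (LINT u:{0..1}|lborel. (if t \<le> u then u else 0))"
    by (rule integral_unif01) measurable
  also have "\<dots> = (\<integral>u. u * indicator {t..1} u \<partial>lborel)"
    unfolding set_lebesgue_integral_def using assms by (intro Bochner_Integration.integral_cong) (auto simp: indicator_def)
  also have "\<dots> = (1\<^sup>2 / 2 - t\<^sup>2 / 2)"
    by (rule integral_FTC_Icc_real) (use assms in \<open>auto intro!: derivative_eq_intros continuous_intros\<close>)
  finally show ?thesis by (simp add: field_simps)
qed

lemma unif01_mean: "(\<integral>u. u \<partial>unif01) = 1 / 2"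
proof -
  have "(\<integral>u. u \<partial>unif01) = (\<integral>u. (if 0 \<le> u then u else 0) \<partial>unif01)"
    by (rule integral_cong_AE) (use unif01_range in \<open>auto elim!: eventually_mono\<close>)
  then show ?thesis using unif01_tail_mean[of 0] by simp
qed

text \<open>Equality for nonnegative \<open>v\<close>. For negative \<open>v\<close> the mean is
  \<open>1 / 2 - v\<close>, which falls short by half the square of \<open>v\<close>; such cuts do
  occur, since \<open>cert_v\<close> is negative near 0.\<close>

lemma unif01_excess_le:
  assumes "v \<le> 1" shows "(\<integral>u. max 0 (u - v) \<partial>unif01) \<le> (1 - v)\<^sup>2 / 2"
proof (cases "0 \<le> v")
  case True
  have "(\<integral>u. max 0 (u - v) \<partial>unif01) = (LINT u:{0..1}|lborel. max 0 (u - v))"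
    by (rule integral_unif01) measurable
  also have "\<dots> = (\<integral>u. (u - v) * indicator {v..1} u \<partial>lborel)"
    unfolding set_lebesgue_integral_def using True by (intro Bochner_Integration.integral_cong) (auto simp: indicator_def)
  also have "\<dots> = ((1 - v)\<^sup>2 / 2 - (v - v)\<^sup>2 / 2)"
    by (rule integral_FTC_Icc_real) (use assms in \<open>auto intro!: derivative_eq_intros continuous_intros\<close>)
  finally show ?thesis by simp
next
  case False
  have i: "integrable unif01 (\<lambda>u. u)"
    by (rule U.integrable_const_bound[where B=1]) (auto intro!: eventually_mono[OF unif01_range])
  have "(\<integral>u. max 0 (u - v) \<partial>unif01) = (\<integral>u. u - v \<partial>unif01)"
    by (rule integral_cong_AE) (use unif01_range False in \<open>auto elim!: eventually_mono\<close>)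
  also have "\<dots> = 1 / 2 - v" 
    using i U.prob_space by (simp add: unif01_mean)
  also have "\<dots> \<le> (1 - v)\<^sup>2 / 2" by (simp add: power2_eq_square algebra_simps)
  finally show ?thesis .
qed

lemma real_distribution_measure_eq:
  assumes "real_distribution M" "A \<in> sets borel" "B \<in> sets borel" "AE x in M. (x \<in> A) = (x \<in> B)"
  shows "measure M A = measure M B"
proof -
  interpret real_distribution M by fact
  show ?thesis by (rule finite_measure_eq_AE) (use assms in auto)
qed

section \<open>Deviations of one school\<close>

lemma borel_measurable_fst_real [measurable]: "fst \<in> borel_measurable (borel :: (real \<times> real) measure)"
  and borel_measurable_snd_real [measurable]: "snd \<in> borel_measurable (borel :: (real \<times> real) measure)"
  by (intro borel_measurable_continuous_onI continuous_intros)+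

lemma measure_uniform_lessThan:
  assumes "0 \<le> x" "x \<le> (1::real)"
  shows "measure (uniform_measure lborel {0..<1}) {..<x} = x"
proof -
  have "{0..<1} \<inter> {..<x} = {0..<x}" using assms by auto
  then show ?thesis using assms by (simp add: measure_def emeasure_uniform_measure divide_ennreal_def)
qed

text \<open>The new labels are realized on the product of \<open>J\<close> with an independent
  uniform draw, which selects one of \<open>X1\<close>, \<open>X2\<close>, \<open>X0\<close> with
  probabilities \<open>q1\<close>, \<open>q2\<close> and the rest. The draw leaves abilities alone,
  so only calibration has to be supplied, and \<open>cal\<close> asks for it in averaged
  form.\<close>

lemma transcript_randomize:
  fixes J :: "(real \<times> real) measure" and q1 q2 X0 X1 X2 :: "real \<times> real \<Rightarrow> real"
  assumes T: "is_transcript F J" and A: "AE p in J. fst p \<in> {0..1}"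
    and q[measurable]: "q1 \<in> borel_measurable borel" "q2 \<in> borel_measurable borel"
    and q0: "\<And>p. 0 \<le> q1 p" "\<And>p. 0 \<le> q2 p" "\<And>p. q1 p + q2 p \<le> 1"
    and X[measurable]: "X0 \<in> borel_measurable borel" "X1 \<in> borel_measurable borel" "X2 \<in> borel_measurable borel"
    and rng: "AE p in J. X0 p \<in> {0..1} \<and> X1 p \<in> {0..1} \<and> X2 p \<in> {0..1}"
    and cal: "\<And>S. S \<in> sets borel \<Longrightarrow>
      (\<integral>p. q1 p * (indicator S (X1 p) * (fst p - X1 p)) + q2 p * (indicator S (X2 p) * (fst p - X2 p))
         + (1 - q1 p - q2 p) * (indicator S (X0 p) * (fst p - X0 p)) \<partial>J) = 0"
  obtains J' where "is_transcript F J'"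
    and "\<And>h B. h \<in> borel_measurable borel \<Longrightarrow> (\<And>x::real. \<bar>h x\<bar> \<le> B) \<Longrightarrow>
      (\<integral>p. h (snd p) \<partial>J') = (\<integral>p. q1 p * h (X1 p) + q2 p * h (X2 p) + (1 - q1 p - q2 p) * h (X0 p) \<partial>J)"
proof -
  interpret J: prob_space J using T by (simp add: is_transcript_def)
  have sJ[measurable_cong]: "sets J = sets borel" using T by (simp add: is_transcript_def)
  define U :: "real measure" where "U = uniform_measure lborel {0..<1}"
  interpret U: prob_space U unfolding U_def by (rule prob_space_uniform_measure) auto
  have sU[measurable_cong]: "sets U = sets borel" by (simp add: U_def)
  interpret JU: pair_prob_space J U ..
  define X where "X = (\<lambda>z. if snd z < q1 (fst z) then X1 (fst z)
     else if snd z < q1 (fst z) + q2 (fst z) then X2 (fst z) else X0 (fst z))"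
  have X_m[measurable]: "X \<in> borel_measurable (J \<Otimes>\<^sub>M U)" unfolding X_def by measurable
  have fJ[measurable]: "fst \<in> borel_measurable J"
    by (subst measurable_cong_sets[OF sJ refl]) (intro borel_measurable_continuous_onI continuous_intros)
  have fst_m[measurable]: "(\<lambda>z. fst (fst z)) \<in> borel_measurable (J \<Otimes>\<^sub>M U)"
    by (rule measurable_compose[OF measurable_fst fJ])
  define J' where "J' = distr (J \<Otimes>\<^sub>M U) borel (\<lambda>z. (fst (fst z), X z))"
  have Jm[measurable]: "(\<lambda>z. (fst (fst z), X z)) \<in> measurable (J \<Otimes>\<^sub>M U) borel"
    unfolding borel_prod[symmetric] by measurable
  have dfst: "distr (J \<Otimes>\<^sub>M U) J fst = J"
    by (rule U.distr_pair_fst)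
  have AEfst: "AE z in J \<Otimes>\<^sub>M U. P (fst z)" if "AE p in J. P p" for P
    by (rule AE_distrD[OF measurable_fst]) (simp only: dfst that)
  have key: "(\<integral>z. g (fst (fst z)) (X z) \<partial>(J \<Otimes>\<^sub>M U))
      = (\<integral>p. q1 p * g (fst p) (X1 p) + q2 p * g (fst p) (X2 p) + (1 - q1 p - q2 p) * g (fst p) (X0 p) \<partial>J)"
    if g[measurable]: "case_prod g \<in> borel_measurable (borel \<Otimes>\<^sub>M borel)"
      and gb: "AE p in J. \<bar>g (fst p) (X1 p)\<bar> \<le> B \<and> \<bar>g (fst p) (X2 p)\<bar> \<le> B \<and> \<bar>g (fst p) (X0 p)\<bar> \<le> B"
    for g :: "real \<Rightarrow> real \<Rightarrow> real" and B
  proof -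
    have I: "integrable (J \<Otimes>\<^sub>M U) (\<lambda>z. g (fst (fst z)) (X z))"
      by (rule JU.integrable_const_bound[where B=B])
         (rule eventually_mono[OF AEfst[OF gb]], simp add: X_def, measurable)
    have inner: "(\<integral>r. g (fst p) (X (p, r)) \<partial>U)
       = q1 p * g (fst p) (X1 p) + q2 p * g (fst p) (X2 p) + (1 - q1 p - q2 p) * g (fst p) (X0 p)" for p
    proof -
      have m1: "measure U {..<q1 p} = q1 p" "measure U {..<q1 p + q2 p} = q1 p + q2 p"
        unfolding U_def using q0[of p] by (intro measure_uniform_lessThan; linarith)+
      have m2: "measure U {q1 p..<q1 p + q2 p} = q2 p"
      proof -
        have *: "{q1 p..<q1 p + q2 p} = {..<q1 p + q2 p} - {..<q1 p}" by auto
        show ?thesis unfolding * using q0[of p] by (subst U.finite_measure_Diff) (auto simp: sU m1)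
      qed
      have m3: "measure U {q1 p + q2 p..} = 1 - (q1 p + q2 p)"
      proof -
        have "{q1 p + q2 p..} = space U - {..<q1 p + q2 p}" by (auto simp: U_def)
        then show ?thesis using m1 U.prob_compl[of "{..<q1 p + q2 p}"] by simp
      qed
      have "(\<integral>r. g (fst p) (X (p, r)) \<partial>U) = (\<integral>r. g (fst p) (X1 p) * indicator {..<q1 p} r
           + g (fst p) (X2 p) * indicator {q1 p..<q1 p + q2 p} r
           + g (fst p) (X0 p) * indicator {q1 p + q2 p..} r \<partial>U)"
        by (rule Bochner_Integration.integral_cong) (use q0[of p] in \<open>auto simp: X_def indicator_def\<close>)
      also have "\<dots> = g (fst p) (X1 p) * q1 p + g (fst p) (X2 p) * q2 p + g (fst p) (X0 p) * (1 - (q1 p + q2 p))"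
        by (subst Bochner_Integration.integral_add Bochner_Integration.integral_mult_right_zero | 
            simp add: m1 m2 m3 U.emeasure_eq_measure)+
      finally show ?thesis by (simp add: algebra_simps)
    qed
    have "(\<integral>z. g (fst (fst z)) (X z) \<partial>(J \<Otimes>\<^sub>M U)) = (\<integral>p. (\<integral>r. g (fst p) (X (p, r)) \<partial>U) \<partial>J)"
      using JU.integral_fst'[OF I] by simp
    then show "(\<integral>z. g (fst (fst z)) (X z) \<partial>(J \<Otimes>\<^sub>M U))
      = (\<integral>p. q1 p * g (fst p) (X1 p) + q2 p * g (fst p) (X2 p) + (1 - q1 p - q2 p) * g (fst p) (X0 p) \<partial>J)"
      by (simp add: inner)
  qed
  have AEall: "AE z in J \<Otimes>\<^sub>M U. fst (fst z) \<in> {0..1} \<and> X z \<in> {0..1}"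
    using AEfst[OF A] AEfst[OF rng] by eventually_elim (auto simp: X_def)
  have T': "is_transcript F J'"
    unfolding is_transcript_def
  proof (intro conjI ballI)
    show "prob_space J'" unfolding J'_def by (rule JU.prob_space_distr) simp
    show "sets J' = sets borel" by (simp add: J'_def)
    have "distr J' borel fst = distr (J \<Otimes>\<^sub>M U) borel (fst \<circ> fst)"
      unfolding J'_def by (subst distr_distr) (auto simp: comp_def)
    also have "\<dots> = distr (distr (J \<Otimes>\<^sub>M U) J fst) borel fst"
      by (subst distr_distr) (auto simp: comp_def)
    also have "\<dots> = F" using T by (simp add: dfst is_transcript_def)
    finally show "distr J' borel fst = F" .
    show "AE p in J'. snd p \<in> {0..1}"
      unfolding J'_def using AEall by (subst AE_distr_iff) (auto elim: eventually_mono)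
    fix S :: "real set" assume S[measurable]: "S \<in> sets borel"
    have e: "AE p in J. \<bar>indicator S (X1 p) * (fst p - X1 p)\<bar> \<le> (1::real) \<and>
        \<bar>indicator S (X2 p) * (fst p - X2 p)\<bar> \<le> (1::real) \<and> \<bar>indicator S (X0 p) * (fst p - X0 p)\<bar> \<le> (1::real)"
      using A rng by eventually_elim (auto simp: indicator_def)
    have "(\<integral>p. indicator S (snd p) * (fst p - snd p) \<partial>J')
        = (\<integral>z. indicator S (X z) * (fst (fst z) - X z) \<partial>(J \<Otimes>\<^sub>M U))"
      unfolding J'_def by (subst integral_distr) auto
    also have "\<dots> = 0" 
      by (subst key[of "\<lambda>a x. indicator S x * (a - x)", OF _ e]) (auto simp: cal[OF S])
    finally have z: "(\<integral>p. indicator S (snd p) * (fst p - snd p) \<partial>J') = 0" .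
    have i1: "integrable J' (\<lambda>p. indicator S (snd p) * fst p)" "integrable J' (\<lambda>p. indicator S (snd p) * snd p)"
      unfolding J'_def
      by (auto intro!: integrable_distr_eq[THEN iffD2] JU.integrable_const_bound[where B=1]
           intro: eventually_mono[OF AEall] simp: indicator_def)
    show "(\<integral>p. indicator S (snd p) * fst p \<partial>J') = (\<integral>p. indicator S (snd p) * snd p \<partial>J')"
      using z i1 by (simp add: right_diff_distrib)
  qed
  have H: "(\<integral>p. h (snd p) \<partial>J') = (\<integral>p. q1 p * h (X1 p) + q2 p * h (X2 p) + (1 - q1 p - q2 p) * h (X0 p) \<partial>J)"
    if [measurable]: "h \<in> borel_measurable borel" and "\<And>x::real. \<bar>h x\<bar> \<le> B" for h B
  proof -
    have "(\<integral>p. h (snd p) \<partial>J') = (\<integral>z. h (X z) \<partial>(J \<Otimes>\<^sub>M U))"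
      unfolding J'_def by (subst integral_distr) auto
    also have "\<dots> = (\<integral>p. q1 p * h (X1 p) + q2 p * h (X2 p) + (1 - q1 p - q2 p) * h (X0 p) \<partial>J)"
      by (rule key[of "\<lambda>a x. h x" B]) (use that in auto)
    finally show ?thesis .
  qed
  show thesis by (rule that[OF T' H])
qed

section \<open>One school facing a fixed desirability: the lifting deviation and label atoms\<close>

locale school =
  fixes F :: "real measure" and J :: "(real \<times> real) measure" and Q :: "real \<Rightarrow> real"
  assumes transcript: "is_transcript F J"
    and ability_range: "AE p in J. fst p \<in> {0..1}"
    and Q_measurable [measurable]: "Q \<in> borel_measurable borel"
    and Q_range: "0 \<le> Q x" "Q x \<le> 1"
    and optimal: "is_transcript F J' \<Longrightarrow> (\<integral>p. Q (snd p) \<partial>J') \<le> (\<integral>p. Q (snd p) \<partial>J)"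
begin

sublocale prob_space J using transcript by (simp add: is_transcript_def)

lemma sets_J [measurable_cong]: "sets J = sets borel"
  using transcript by (simp add: is_transcript_def)

lemma label_range: "AE p in J. snd p \<in> {0..1}"
  using transcript by (simp add: is_transcript_def)

text \<open>Abilities and labels lie in the unit interval only almost surely, hence the bound almost
  everywhere. The class is closed under the operations used below, so integrability can be read off
  the shape of an integrand.\<close>

definition bdd :: "(real \<times> real \<Rightarrow> real) \<Rightarrow> bool" where
  "bdd f \<longleftrightarrow> f \<in> borel_measurable borel \<and> (\<exists>C. AE p in J. \<bar>f p\<bar> \<le> C)"

lemma bdd_integrable: assumes "bdd f" shows "integrable J f"
proof -
  obtain C where "AE p in J. \<bar>f p\<bar> \<le> C" "f \<in> borel_measurable borel" using assms by (auto simp: bdd_def)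
  then show ?thesis by (intro integrable_const_bound[where B=C]) (auto simp: measurable_cong_sets[OF sets_J refl])
qed

lemma bdd_const: "bdd (\<lambda>p. c)" by (auto simp: bdd_def intro: exI[of _ "\<bar>c\<bar>"])

lemma bdd_fst: "bdd fst" 
  unfolding bdd_def using ability_range by (auto intro!: exI[of _ 1] elim: eventually_mono)

lemma bdd_snd: "bdd snd" 
  unfolding bdd_def using label_range by (auto intro!: exI[of _ 1] elim: eventually_mono)

lemma bdd_bounded: "f \<in> borel_measurable borel \<Longrightarrow> (\<And>p. \<bar>f p\<bar> \<le> C) \<Longrightarrow> bdd f"
  unfolding bdd_def by (intro conjI exI[of _ C] AE_I2)

lemma bdd_mult: assumes "bdd f" "bdd g" shows "bdd (\<lambda>p. f p * g p)"
proof -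
  obtain C D where CD: "AE p in J. \<bar>f p\<bar> \<le> C" "AE p in J. \<bar>g p\<bar> \<le> D"
    and [measurable]: "f \<in> borel_measurable borel" "g \<in> borel_measurable borel"
    using assms by (auto simp: bdd_def)
  from CD have "AE p in J. \<bar>f p * g p\<bar> \<le> C * D"
    by eventually_elim (auto simp: abs_mult intro!: mult_mono)
  then show ?thesis by (auto simp: bdd_def)
qed

lemma bdd_add: assumes "bdd f" "bdd g" shows "bdd (\<lambda>p. f p + g p)"
proof -
  obtain C D where CD: "AE p in J. \<bar>f p\<bar> \<le> C" "AE p in J. \<bar>g p\<bar> \<le> D"
    and [measurable]: "f \<in> borel_measurable borel" "g \<in> borel_measurable borel"
    using assms by (auto simp: bdd_def)
  from CD have "AE p in J. \<bar>f p + g p\<bar> \<le> C + D" by eventually_elim auto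
  then show ?thesis by (auto simp: bdd_def)
qed

lemma bdd_diff: assumes "bdd f" "bdd g" shows "bdd (\<lambda>p. f p - g p)"
  using bdd_add[OF assms(1) bdd_mult[OF bdd_const assms(2)], of "-1"] by simp

lemma bdd_min: assumes "bdd f" "bdd g" shows "bdd (\<lambda>p. min (f p) (g p))"
proof -
  obtain C D where CD: "AE p in J. \<bar>f p\<bar> \<le> C" "AE p in J. \<bar>g p\<bar> \<le> D"
    and [measurable]: "f \<in> borel_measurable borel" "g \<in> borel_measurable borel"
    using assms by (auto simp: bdd_def)
  from CD have "AE p in J. \<bar>min (f p) (g p)\<bar> \<le> max C D" by eventually_elim auto
  then show ?thesis by (auto simp: bdd_def)
qed

lemma bdd_indicator_snd: "S \<in> sets borel \<Longrightarrow> bdd (\<lambda>p. indicator S (snd p))"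
  by (rule bdd_bounded[of _ 1]) (auto simp: indicator_def)

lemma bdd_indicator_fst: "S \<in> sets borel \<Longrightarrow> bdd (\<lambda>p. indicator S (fst p))"
  by (rule bdd_bounded[of _ 1]) (auto simp: indicator_def)

lemma bdd_Q: "f \<in> borel_measurable borel \<Longrightarrow> bdd (\<lambda>p. Q (f p))"
  using Q_range by (intro bdd_bounded[of _ 1]) (auto simp: abs_le_iff intro: order_trans[of _ 0])

lemmas bdd_intros = bdd_const bdd_fst bdd_snd bdd_mult bdd_add bdd_diff bdd_min bdd_indicator_snd bdd_indicator_fst bdd_Q

lemma calibrated:
  assumes "S \<in> sets borel"
  shows "(\<integral>p. indicator S (snd p) * (fst p - snd p) \<partial>J) = 0"
proof -
  have "(\<integral>p. indicator S (snd p) * fst p \<partial>J) = (\<integral>p. indicator S (snd p) * snd p \<partial>J)"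
    using transcript assms by (simp add: is_transcript_def)
  moreover have "integrable J (\<lambda>p. indicator S (snd p) * fst p)" "integrable J (\<lambda>p. indicator S (snd p) * snd p)"
    using assms by (auto intro!: bdd_integrable bdd_intros)
  ultimately show ?thesis by (simp add: right_diff_distrib)
qed

text \<open>
  The deviation concerns the labels in \<open>B\<close>, where the mean ability is \<open>m\<close>. A student of ability \<open>a > m\<close> is
  moved with probability \<open>a\<close> (scaled by \<open>u\<close> if \<open>a > k\<close>), to the label \<open>min a k\<close>. Students of ability
  below \<open>m\<close> are revealed with probability \<open>gam\<close>, and moved to \<open>k\<close> with probability \<open>th\<close>; these are
  chosen so that the label \<open>k\<close> and the remainder, pooled at \<open>m\<close>, are calibrated.\<close>

lemma lift_deviation:
  fixes B :: "real set" and m k :: real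
  defines "b \<equiv> \<lambda>p :: real \<times> real. indicator B (snd p) :: real"
  defines "mu \<equiv> \<integral>p. b p * (indicator {m<..} (fst p) * (fst p - m)) \<partial>J"
  defines "gam \<equiv> (\<integral>p. b p * (indicator {m<..} (fst p) * (fst p * (min (fst p) k - m))) \<partial>J) / mu"
  assumes B: "B \<in> sets borel" and m: "0 \<le> m" "m < k" "k \<le> 1"
    and bal: "(\<integral>p. b p * (fst p - m) \<partial>J) = 0" and mu: "mu > 0"
  shows "(\<integral>p. b p * (indicator {m<..} (fst p) * (fst p * (Q (min (fst p) k) - Q m))) \<partial>J)
     - gam * (\<integral>p. b p * (indicator {..<m} (fst p) * (Q m - Q (fst p))) \<partial>J)
     \<le> (\<integral>p. b p * (Q (snd p) - Q m) \<partial>J)"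
proof -
  note [measurable] = B
  have bm[measurable]: "b \<in> borel_measurable borel" unfolding b_def by measurable
  have b01: "b p = 0 \<or> b p = 1" for p by (auto simp: b_def indicator_def)
  have bb: "bdd b" unfolding b_def by (rule bdd_indicator_snd[OF B])
  define H1 where "H1 = (\<lambda>p. b p * indicator {m<..k} (fst p))"
  define H2 where "H2 = (\<lambda>p. b p * indicator {k<..} (fst p))"
  define Lo where "Lo = (\<lambda>p. b p * indicator {..<m} (fst p))"
  have bH: "bdd H1" "bdd H2" "bdd Lo"
    unfolding H1_def H2_def Lo_def by (auto intro!: bdd_mult bb bdd_indicator_fst)
  note I = bdd_integrable and bi = bdd_intros bb bH
  let ?E = "\<lambda>f. \<integral>p. f p \<partial>J"
  define al where "al = ?E (\<lambda>p. H2 p * (fst p * (fst p - k)))"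
  define X where "X = ?E (\<lambda>p. H2 p * fst p)"
  define M1 where "M1 = ?E (\<lambda>p. H1 p * (fst p * (fst p - m)))"
  define pl where "pl = ?E Lo"
  define La where "La = ?E (\<lambda>p. Lo p * (m - fst p))"
  have Hnn: "0 \<le> H1 p" "0 \<le> H2 p" "0 \<le> Lo p" for p
    by (auto simp: H1_def H2_def Lo_def b_def)
  \<comment> \<open>As \<open>m\<close> is the mean ability of the cell, the deficit below
    \<open>m\<close> equals the surplus \<open>mu\<close> above it.\<close>
  have La: "La = mu"
  proof -
    have "?E (\<lambda>p. b p * (fst p - m)) = ?E (\<lambda>p. b p * (indicator {m<..} (fst p) * (fst p - m)) - Lo p * (m - fst p))"
      by (rule Bochner_Integration.integral_cong) (auto simp: Lo_def indicator_def algebra_simps)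
    also have "\<dots> = mu - La" unfolding mu_def La_def
      by (intro Bochner_Integration.integral_diff I bi) auto
    finally show ?thesis using bal by simp
  qed
  have pl0: "0 \<le> pl" unfolding pl_def using Hnn by (intro integral_nonneg_AE) auto
  have Kb: "?E (\<lambda>p. Lo p * (k - fst p)) = (k - m) * pl + mu"
  proof -
    have "?E (\<lambda>p. Lo p * (k - fst p)) = ?E (\<lambda>p. (k - m) * Lo p + Lo p * (m - fst p))"
      by (rule Bochner_Integration.integral_cong) (auto simp: algebra_simps)
    also have "\<dots> = (k - m) * pl + La" unfolding pl_def La_def
      by (subst Bochner_Integration.integral_add) (auto intro!: I bi)
    finally show ?thesis by (simp add: La)
  qed
  define K where "K = (k - m) * pl + mu"
  have K: "K > 0" using m pl0 mu by (simp add: K_def add_nonneg_pos)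
  have H2a: "?E (\<lambda>p. H2 p * (fst p * (fst p - m))) = al + X * (k - m)"
  proof -
    have "?E (\<lambda>p. H2 p * (fst p * (fst p - m))) = ?E (\<lambda>p. H2 p * (fst p * (fst p - k)) + (H2 p * fst p) * (k - m))"
      by (rule Bochner_Integration.integral_cong) (auto simp: algebra_simps)
    also have "\<dots> = al + X * (k - m)" unfolding al_def X_def
      by (subst Bochner_Integration.integral_add) (auto intro!: I bi)
    finally show ?thesis .
  qed
  have al0: "0 \<le> al" unfolding al_def using m
    by (intro integral_nonneg_AE) (auto simp: H2_def b_def indicator_def intro!: AE_I2)
  have X0: "0 \<le> X" unfolding X_def using m
    by (intro integral_nonneg_AE) (auto simp: H2_def b_def indicator_def intro!: AE_I2)
  have gmu: "gam * mu = M1 + X * (k - m)"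
  proof -
    have "gam * mu = ?E (\<lambda>p. b p * (indicator {m<..} (fst p) * (fst p * (min (fst p) k - m))))"
      using mu by (simp add: gam_def)
    also have "\<dots> = ?E (\<lambda>p. H1 p * (fst p * (fst p - m)) + (H2 p * fst p) * (k - m))"
      using m by (intro Bochner_Integration.integral_cong) (auto simp: H1_def H2_def indicator_def min_def)
    also have "\<dots> = M1 + X * (k - m)" unfolding M1_def X_def
      by (subst Bochner_Integration.integral_add) (auto intro!: I bi)
    finally show ?thesis .
  qed
  have M10: "0 \<le> M1" unfolding M1_def using m
    by (intro integral_nonneg_AE) (auto simp: H1_def b_def indicator_def intro!: AE_I2)
  have gam0: "0 \<le> gam"
  proof -
    have "0 \<le> gam * mu" unfolding gmu using M10 X0 m by (intro add_nonneg_nonneg mult_nonneg_nonneg) auto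
    then show ?thesis using mu by (simp add: zero_le_mult_iff)
  qed
  \<comment> \<open>\<open>u\<close> and \<open>th\<close> solve two equations:
    \<open>th * K = u * al\<close> calibrates the label \<open>k\<close>, and
    \<open>u * X + th * pl = X\<close> keeps the mass at \<open>k\<close> equal to \<open>X\<close>.
    By the second one the gain at \<open>k\<close> is \<open>X * (Q k - Q m)\<close>, free of
    \<open>u\<close> and \<open>th\<close>. If \<open>X = 0\<close>, both are 0, also when the
    denominator vanishes.\<close>
  define u where "u = X * K / (X * K + al * pl)"
  define th where "th = u * al / K"
  have u0: "0 \<le> u" unfolding u_def using X0 K al0 pl0 by (intro divide_nonneg_nonneg add_nonneg_nonneg mult_nonneg_nonneg) auto
  have u1: "u \<le> 1"
  proof (cases "X * K + al * pl = 0")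
    case False
    moreover have "0 \<le> X * K" "0 \<le> al * pl" using X0 K al0 pl0 by auto
    ultimately show ?thesis by (simp add: u_def divide_le_eq_1)
  qed (simp add: u_def)
  have th0: "0 \<le> th" using u0 al0 K by (simp add: th_def)
  have thK: "th * K = u * al" using K by (simp add: th_def)
  have uX: "u * X + th * pl = X"
  proof (cases "X = 0")
    case False
    then have "X * K + al * pl > 0" using X0 K al0 pl0 by (intro add_pos_nonneg mult_pos_pos mult_nonneg_nonneg) auto
    then have "u * (X * K + al * pl) = X * K" by (simp add: u_def)
    moreover have "(u * X + th * pl) * K = u * (X * K) + pl * (th * K)" by (simp add: algebra_simps)
    ultimately have "(u * X + th * pl) * K = X * K" unfolding thK by (simp add: algebra_simps)
    then show ?thesis using K by simp
  qed (simp add: u_def th_def)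
  \<comment> \<open>Calibration of the remainder at \<open>m\<close>: the lifted students take away
    as much surplus over \<open>m\<close> as the fraction \<open>gam + th\<close> of the students
    below \<open>m\<close> takes away deficit.\<close>
  have bal2: "M1 + u * (al + X * (k - m)) = (gam + th) * mu"
  proof -
    have "(gam + th) * mu = M1 + (u * X + th * pl) * (k - m) + th * mu" unfolding uX by (simp add: gmu algebra_simps)
    also have "\<dots> = M1 + u * X * (k - m) + th * K" by (simp add: K_def algebra_simps)
    finally show ?thesis unfolding thK by (simp add: algebra_simps)
  qed
  \<comment> \<open>Since abilities and \<open>u\<close> are at most 1, the surplus taken away is at
    most the whole surplus \<open>mu\<close>; hence \<open>gam + th\<close> can serve as a
    probability.\<close>
  have "(gam + th) * mu \<le> 1 * mu"
  proof -
    have "M1 + u * (al + X * (k - m)) = ?E (\<lambda>p. H1 p * (fst p * (fst p - m)) + u * (H2 p * (fst p * (fst p - m))))"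
      unfolding M1_def H2a[symmetric] by (subst Bochner_Integration.integral_add) (auto intro!: I bi)
    also have "\<dots> \<le> mu" unfolding mu_def
    proof (intro integral_mono_AE I bi)
      show "AE p in J. H1 p * (fst p * (fst p - m)) + u * (H2 p * (fst p * (fst p - m)))
         \<le> b p * (indicator {m<..} (fst p) * (fst p - m))"
        using ability_range
      proof eventually_elim
        case (elim p)
        have "fst p * (fst p - m) \<le> 1 * (fst p - m)" if "fst p > m"
          using elim that by (intro mult_right_mono) auto
        moreover have "u * (fst p * (fst p - m)) \<le> 1 * (1 * (fst p - m))" if "fst p > m"
          using elim that u0 u1 m by (intro mult_mono) auto
        ultimately show ?case using b01[of p] m by (auto simp: H1_def H2_def indicator_def)
      qed
    qed auto
    finally show ?thesis by (simp add: bal2)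
  qed
  then have gt1: "gam + th \<le> 1" using mu by simp
  define q1 where "q1 = (\<lambda>p. H1 p * fst p + gam * Lo p)"
  \<comment> \<open>\<open>transcript_randomize\<close> wants probabilities at every point, not just
    almost everywhere, hence \<open>min 1\<close>. In \<open>q1\<close> the factor \<open>H1\<close>
    already confines the ability to at most \<open>k\<close>.\<close>
  define q2 where "q2 = (\<lambda>p. u * (H2 p * min 1 (fst p)) + th * Lo p)"
  have [measurable]: "H1 \<in> borel_measurable borel" "H2 \<in> borel_measurable borel" "Lo \<in> borel_measurable borel"
    using bH by (auto simp: bdd_def)
  have q1m[measurable]: "q1 \<in> borel_measurable borel" and q2m[measurable]: "q2 \<in> borel_measurable borel"
    unfolding q1_def q2_def by measurable
  have q1nn: "0 \<le> q1 p" for p using m gam0 Hnn[of p] b01[of p]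
    by (auto simp: q1_def H1_def Lo_def indicator_def)
  have q2nn: "0 \<le> q2 p" for p using m th0 u0 b01[of p]
    by (auto simp: q2_def H2_def Lo_def indicator_def min_def)
  have q12: "q1 p + q2 p \<le> 1" for p
  proof -
    have "u * min 1 (fst p) \<le> 1 * 1" if "k < fst p" using u0 u1 m that by (intro mult_mono) auto
    then show ?thesis using m gt1 b01[of p]
      by (auto simp: q1_def q2_def H1_def H2_def Lo_def indicator_def)
  qed
  define X0 where "X0 = (\<lambda>p :: real \<times> real. if snd p \<in> B then m else snd p)"
  have [measurable]: "X0 \<in> borel_measurable borel" unfolding X0_def by measurable
  have rng: "AE p in J. X0 p \<in> {0..1} \<and> fst p \<in> {0..1} \<and> k \<in> {0..1}"
    using ability_range label_range by eventually_elim (use m in \<open>auto simp: X0_def\<close>)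
  have cal: "(\<integral>p. q1 p * (indicator S (fst p) * (fst p - fst p)) + q2 p * (indicator S k * (fst p - k))
         + (1 - q1 p - q2 p) * (indicator S (X0 p) * (fst p - X0 p)) \<partial>J) = 0"
    if S[measurable]: "S \<in> sets borel" for S
  proof -
    \<comment> \<open>A revealed student contributes 0 to the calibration error, so inside the cell
      only the membership of \<open>k\<close> and \<open>m\<close> in \<open>S\<close> matters;
      labels outside \<open>B\<close> are untouched.\<close>
    define c1 c2 :: real where "c1 = indicator S k" and "c2 = indicator S m"
    have "(\<integral>p. q1 p * (indicator S (fst p) * (fst p - fst p)) + q2 p * (indicator S k * (fst p - k))
         + (1 - q1 p - q2 p) * (indicator S (X0 p) * (fst p - X0 p)) \<partial>J)
      = (\<integral>p. (c1 * (u * (H2 p * (fst p * (fst p - k))) - th * (Lo p * (k - fst p)))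
         + c2 * (b p * (fst p - m) - H1 p * (fst p * (fst p - m)) - u * (H2 p * (fst p * (fst p - m)))
             + (gam + th) * (Lo p * (m - fst p))))
         + indicator (S - B) (snd p) * (fst p - snd p) \<partial>J)"
    proof (rule integral_cong_AE)
      show "AE p in J. q1 p * (indicator S (fst p) * (fst p - fst p)) + q2 p * (indicator S k * (fst p - k))
         + (1 - q1 p - q2 p) * (indicator S (X0 p) * (fst p - X0 p))
        = (c1 * (u * (H2 p * (fst p * (fst p - k))) - th * (Lo p * (k - fst p)))
         + c2 * (b p * (fst p - m) - H1 p * (fst p * (fst p - m)) - u * (H2 p * (fst p * (fst p - m)))
             + (gam + th) * (Lo p * (m - fst p))))
         + indicator (S - B) (snd p) * (fst p - snd p)"
        using ability_range
      proof eventually_elim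
        case (elim p)
        then have "min 1 (fst p) = fst p" by simp
        then show ?case using m
          by (cases "snd p \<in> B"; cases "fst p < m"; cases "fst p \<le> m"; cases "fst p \<le> k")
             (auto simp: q1_def q2_def H1_def H2_def Lo_def b_def X0_def c1_def c2_def algebra_simps indicator_def)
      qed
    qed auto
    also have "\<dots> = (c1 * (u * al - th * ?E (\<lambda>p. Lo p * (k - fst p)))
         + c2 * (?E (\<lambda>p. b p * (fst p - m)) - M1 - u * ?E (\<lambda>p. H2 p * (fst p * (fst p - m))) + (gam + th) * La))
         + ?E (\<lambda>p. indicator (S - B) (snd p) * (fst p - snd p))"
    proof -
      have i: "integrable J (\<lambda>p. H2 p * (fst p * (fst p - k)))" "integrable J (\<lambda>p. Lo p * (k - fst p))"
        "integrable J (\<lambda>p. b p * (fst p - m))" "integrable J (\<lambda>p. H1 p * (fst p * (fst p - m)))"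
        "integrable J (\<lambda>p. H2 p * (fst p * (fst p - m)))" "integrable J (\<lambda>p. Lo p * (m - fst p))"
        "integrable J (\<lambda>p. indicator (S - B) (snd p) * (fst p - snd p))"
        by (auto intro!: I bi)
      show ?thesis unfolding al_def M1_def La_def
        by (simp only: Bochner_Integration.integral_add Bochner_Integration.integral_diff integral_mult_right_zero
             Bochner_Integration.integrable_add Bochner_Integration.integrable_diff integrable_mult_right i)
    qed
    also have "\<dots> = 0"
    proof -
      have "u * al - th * ?E (\<lambda>p. Lo p * (k - fst p)) = 0" unfolding Kb using thK by (simp add: K_def)
      moreover have "?E (\<lambda>p. b p * (fst p - m)) - M1 - u * ?E (\<lambda>p. H2 p * (fst p * (fst p - m))) + (gam + th) * La = 0"
        unfolding H2a La using bal bal2 by simp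
      moreover have "?E (\<lambda>p. indicator (S - B) (snd p) * (fst p - snd p)) = 0"
        by (rule calibrated) simp
      ultimately show ?thesis by simp
    qed
    finally show ?thesis .
  qed
  obtain J' where J': "is_transcript F J'" and J'h: "\<And>h B. h \<in> borel_measurable borel \<Longrightarrow> (\<And>x::real. \<bar>h x\<bar> \<le> B) \<Longrightarrow>
      (\<integral>p. h (snd p) \<partial>J') = (\<integral>p. q1 p * h (fst p) + q2 p * h k + (1 - q1 p - q2 p) * h (X0 p) \<partial>J)"
    by (rule transcript_randomize[OF transcript ability_range q1m q2m q1nn q2nn q12 _ _ _ rng cal]) auto
  have "\<bar>Q x\<bar> \<le> 1" for x using Q_range[of x] by simp
  from J'h[OF Q_measurable this]
  have "(\<integral>p. q1 p * Q (fst p) + q2 p * Q k + (1 - q1 p - q2 p) * Q (X0 p) \<partial>J) \<le> ?E (\<lambda>p. Q (snd p))"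
    using optimal[OF J'] by simp
  also have "(\<integral>p. q1 p * Q (fst p) + q2 p * Q k + (1 - q1 p - q2 p) * Q (X0 p) \<partial>J)
    = (\<integral>p. Q (snd p) + (H1 p * (fst p * (Q (fst p) - Q m)) + (u * (Q k - Q m)) * (H2 p * fst p)
        + (th * (Q k - Q m)) * Lo p - gam * (Lo p * (Q m - Q (fst p))) - b p * (Q (snd p) - Q m)) \<partial>J)"
  proof (rule integral_cong_AE)
    show "AE p in J. q1 p * Q (fst p) + q2 p * Q k + (1 - q1 p - q2 p) * Q (X0 p)
      = Q (snd p) + (H1 p * (fst p * (Q (fst p) - Q m)) + (u * (Q k - Q m)) * (H2 p * fst p)
        + (th * (Q k - Q m)) * Lo p - gam * (Lo p * (Q m - Q (fst p))) - b p * (Q (snd p) - Q m))"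
      using ability_range
    proof eventually_elim
      case (elim p)
      then have "min 1 (fst p) = fst p" by simp
      then show ?case using m
        by (cases "snd p \<in> B"; cases "fst p < m"; cases "fst p \<le> m"; cases "fst p \<le> k")
           (auto simp: q1_def q2_def H1_def H2_def Lo_def b_def X0_def algebra_simps indicator_def)
    qed
  qed auto
  also have "\<dots> = ?E (\<lambda>p. Q (snd p)) + (?E (\<lambda>p. H1 p * (fst p * (Q (fst p) - Q m))) + (u * (Q k - Q m)) * X
        + (th * (Q k - Q m)) * pl - gam * ?E (\<lambda>p. Lo p * (Q m - Q (fst p))) - ?E (\<lambda>p. b p * (Q (snd p) - Q m)))"
  proof -
    have i: "integrable J (\<lambda>p. Q (snd p))" "integrable J (\<lambda>p. H1 p * (fst p * (Q (fst p) - Q m)))"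
      "integrable J (\<lambda>p. H2 p * fst p)" "integrable J Lo" "integrable J (\<lambda>p. Lo p * (Q m - Q (fst p)))"
      "integrable J (\<lambda>p. b p * (Q (snd p) - Q m))"
      by (auto intro!: I bi)
    show ?thesis unfolding X_def pl_def
      by (simp only: Bochner_Integration.integral_add Bochner_Integration.integral_diff integral_mult_right_zero
             Bochner_Integration.integrable_add Bochner_Integration.integrable_diff integrable_mult_right i)
  qed
  finally have main: "?E (\<lambda>p. H1 p * (fst p * (Q (fst p) - Q m))) + (u * X + th * pl) * (Q k - Q m)
     - gam * ?E (\<lambda>p. Lo p * (Q m - Q (fst p))) \<le> ?E (\<lambda>p. b p * (Q (snd p) - Q m))"
    by (simp add: algebra_simps)
  have "(\<integral>p. b p * (indicator {m<..} (fst p) * (fst p * (Q (min (fst p) k) - Q m))) \<partial>J)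
     = ?E (\<lambda>p. H1 p * (fst p * (Q (fst p) - Q m)) + (H2 p * fst p) * (Q k - Q m))"
    using m by (intro Bochner_Integration.integral_cong) (auto simp: H1_def H2_def indicator_def min_def)
  also have "\<dots> = ?E (\<lambda>p. H1 p * (fst p * (Q (fst p) - Q m))) + X * (Q k - Q m)"
    unfolding X_def by (subst Bochner_Integration.integral_add) (auto intro!: I bi)
  finally have e1: "(\<integral>p. b p * (indicator {m<..} (fst p) * (fst p * (Q (min (fst p) k) - Q m))) \<partial>J)
     = ?E (\<lambda>p. H1 p * (fst p * (Q (fst p) - Q m))) + X * (Q k - Q m)" .
  have e2: "(\<integral>p. b p * (indicator {..<m} (fst p) * (Q m - Q (fst p))) \<partial>J) = ?E (\<lambda>p. Lo p * (Q m - Q (fst p)))"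
    by (intro Bochner_Integration.integral_cong) (auto simp: Lo_def)
  show ?thesis using main unfolding e1 e2 uX by simp
qed

text \<open>Lifting students from \<open>l\<close> to labels just above it collects at least
  \<open>d\<close> per lifted student, whereas the price, the fraction \<open>gam\<close> of low
  students to be revealed, is of the order of \<open>k - l\<close>.\<close>

lemma no_label_atom:
  assumes F0: "measure F {l} = 0" and d: "0 < d" and jump: "\<And>x. l < x \<Longrightarrow> Q l + d \<le> Q x"
  shows "measure J {p. snd p = l} = 0"
proof (rule ccontr)
  assume nz: "measure J {p. snd p = l} \<noteq> 0"
  have meas: "{p. snd p = l} \<in> sets J" "{p. fst p = l} \<in> sets J"
    using measurable_sets[OF borel_measurable_snd_real, of "{l}"] measurable_sets[OF borel_measurable_fst_real, of "{l}"]
    by (auto simp: sets_J vimage_def)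
  let ?b = "\<lambda>p :: real \<times> real. indicator {l} (snd p) :: real"
  have "\<not> (AE p in J. snd p \<noteq> l)"
  proof
    assume "AE p in J. snd p \<noteq> l"
    then have "AE p in J. p \<notin> {p. snd p = l}" by (simp only: mem_Collect_eq)
    then have "{p. snd p = l} \<in> null_sets J" by (simp only: AE_iff_null_sets[OF meas(1)])
    with nz show False by (metis measure_eq_0_null_sets)
  qed
  moreover have "AE p in J. snd p \<noteq> l" if "l \<notin> {0..1}"
    using label_range by eventually_elim (use that in auto)
  ultimately have "l \<in> {0..1}" by blast
  then have l01: "0 \<le> l" "l \<le> 1" by auto
  have bal: "(\<integral>p. ?b p * (fst p - l) \<partial>J) = 0"
    using calibrated[of "{l}"] by (rule trans[rotated]) (auto intro!: Bochner_Integration.integral_cong simp: indicator_def)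
  define mu where "mu = (\<integral>p. ?b p * (indicator {l<..} (fst p) * (fst p - l)) \<partial>J)"
  have i: "integrable J (\<lambda>p. ?b p * (indicator {l<..} (fst p) * (fst p - l)))"
     "integrable J (\<lambda>p. ?b p * (fst p - l))"
    by (auto intro!: bdd_integrable bdd_intros)
  \<comment> \<open>Without surplus almost every student labelled \<open>l\<close> would have
    ability exactly \<open>l\<close>, which the atomless \<open>F\<close> allows only for a null
    set.\<close>
  have mu0: "mu > 0"
  proof (rule ccontr)
    assume "\<not> 0 < mu"
    moreover have "0 \<le> mu" unfolding mu_def by (intro integral_nonneg_AE) (auto simp: indicator_def)
    ultimately have mu: "mu = 0" by simp
    have "(\<integral>p. ?b p * \<bar>fst p - l\<bar> \<partial>J) = (\<integral>p. 2 * (?b p * (indicator {l<..} (fst p) * (fst p - l))) - ?b p * (fst p - l) \<partial>J)"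
      by (intro Bochner_Integration.integral_cong) (auto simp: indicator_def)
    also have "\<dots> = 2 * mu - 0" unfolding mu_def bal[symmetric]
      by (subst Bochner_Integration.integral_diff) (use i in auto)
    finally have z: "(\<integral>p. ?b p * \<bar>fst p - l\<bar> \<partial>J) = 0" by (simp add: mu)
    have "integrable J (\<lambda>p. ?b p * \<bar>fst p - l\<bar>)"
      using integrable_abs[OF i(2)] by (simp add: abs_mult)
    then have "AE p in J. ?b p * \<bar>fst p - l\<bar> = 0"
      using z by (subst (asm) integral_nonneg_eq_0_iff_AE) auto
    then have "AE p in J. snd p = l \<longrightarrow> fst p = l" by eventually_elim (auto simp: indicator_def)
    then have "measure J {p. snd p = l} \<le> measure J {p. fst p = l}"
      by (intro finite_measure_mono_AE meas) auto
    also have "\<dots> = measure (distr J borel fst) {l}"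
      by (subst measure_distr) (use sets_eq_imp_space_eq[OF sets_J] in \<open>auto simp: vimage_def\<close>)
    also have "\<dots> = 0" using transcript F0 by (simp add: is_transcript_def)
    finally show False using nz measure_nonneg[of J "{p. snd p = l}"] by simp
  qed
  have l1: "l < 1"
  proof (rule ccontr)
    assume "\<not> l < 1"
    have "mu \<le> (\<integral>p. 0 \<partial>J)" unfolding mu_def
    proof (rule integral_mono_AE[OF i(1)])
      show "AE p in J. ?b p * (indicator {l<..} (fst p) * (fst p - l)) \<le> 0"
        using ability_range by eventually_elim (use \<open>\<not> l < 1\<close> in \<open>auto simp: indicator_def\<close>)
    qed simp
    then show False using mu0 by simp
  qed
  \<comment> \<open>The gain is at least \<open>d * mu\<close> and the loss at most
    \<open>gam\<close>, hence at most \<open>(k - l) / mu\<close>; so \<open>k - l\<close> must stay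
    below \<open>d\<close> times the square of \<open>mu\<close>.\<close>
  define k where "k = min 1 (l + d * mu\<^sup>2 / 2)"
  have k: "l < k" "k \<le> 1" "k - l < d * mu\<^sup>2" using l1 d mu0 by (auto simp: k_def min_def)
  define gam where "gam = (\<integral>p. ?b p * (indicator {l<..} (fst p) * (fst p * (min (fst p) k - l))) \<partial>J) / mu"
  have r: "(\<integral>p. ?b p * (Q (snd p) - Q l) \<partial>J) = 0"
    by (intro integral_eq_zero_AE) (auto simp: indicator_def)
  have *: "(\<integral>p. ?b p * (indicator {l<..} (fst p) * (fst p * (Q (min (fst p) k) - Q l))) \<partial>J)
     - gam * (\<integral>p. ?b p * (indicator {..<l} (fst p) * (Q l - Q (fst p))) \<partial>J) \<le> 0"
    using lift_deviation[of "{l}" l k] bal l01 k mu0 by (simp add: gam_def mu_def r)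
  have "d * mu = (\<integral>p. d * (?b p * (indicator {l<..} (fst p) * (fst p - l))) \<partial>J)"
    by (simp add: mu_def)
  also have "\<dots> \<le> (\<integral>p. ?b p * (indicator {l<..} (fst p) * (fst p * (Q (min (fst p) k) - Q l))) \<partial>J)"
  proof (intro integral_mono bdd_integrable bdd_intros)
    fix p :: "real \<times> real"
    have "d * (fst p - l) \<le> (Q (min (fst p) k) - Q l) * fst p" if "l < fst p"
      using jump[of "min (fst p) k"] that k l01 d by (intro mult_mono) auto
    then show "d * (?b p * (indicator {l<..} (fst p) * (fst p - l)))
        \<le> ?b p * (indicator {l<..} (fst p) * (fst p * (Q (min (fst p) k) - Q l)))"
      by (auto simp: indicator_def mult.commute)
  qed auto
  finally have 1: "d * mu \<le> (\<integral>p. ?b p * (indicator {l<..} (fst p) * (fst p * (Q (min (fst p) k) - Q l))) \<partial>J)" .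
  have "(\<integral>p. ?b p * (indicator {l<..} (fst p) * (fst p * (min (fst p) k - l))) \<partial>J) \<le> (\<integral>p. k - l \<partial>J)"
  proof (intro integral_mono_AE bdd_integrable bdd_intros)
    show "AE p in J. ?b p * (indicator {l<..} (fst p) * (fst p * (min (fst p) k - l))) \<le> k - l"
      using ability_range
    proof eventually_elim
      case (elim p)
      have "fst p * (min (fst p) k - l) \<le> 1 * (k - l)" if "l < fst p"
        using elim that k by (intro mult_mono) auto
      then show ?case using k by (auto simp: indicator_def)
    qed
  qed auto
  then have g1: "gam \<le> (k - l) / mu" using mu0 by (simp add: gam_def divide_right_mono prob_space)
  have g0: "0 \<le> gam" unfolding gam_def using mu0 l01 k
    by (intro divide_nonneg_pos integral_nonneg_AE) (auto simp: indicator_def intro!: AE_I2)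
  have "(\<integral>p. ?b p * (indicator {..<l} (fst p) * (Q l - Q (fst p))) \<partial>J) \<le> (\<integral>p. 1 \<partial>J)"
  proof (intro integral_mono bdd_integrable bdd_intros)
    fix p :: "real \<times> real"
    show "?b p * (indicator {..<l} (fst p) * (Q l - Q (fst p))) \<le> 1"
      using Q_range[of l] Q_range[of "fst p"] by (auto simp: indicator_def)
  qed auto
  then have 2: "(\<integral>p. ?b p * (indicator {..<l} (fst p) * (Q l - Q (fst p))) \<partial>J) \<le> 1" by (simp add: prob_space)
  have "d * mu \<le> gam * (\<integral>p. ?b p * (indicator {..<l} (fst p) * (Q l - Q (fst p))) \<partial>J)" using * 1 by simp
  also have "\<dots> \<le> gam * 1" using 2 g0 by (rule mult_left_mono)
  also have "\<dots> \<le> (k - l) / mu" using g1 by simp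
  finally have "d * mu * mu \<le> k - l" using mu0 by (simp add: field_simps)
  then show False using k by (simp add: power2_eq_square)
qed

end

section \<open>Comparing abilities with labels, threshold by threshold\<close>

lemma lift_kernel_ineq:
  fixes y rho m a b :: real and c k :: "'i \<Rightarrow> real"
  assumes c: "\<And>i. i \<in> I \<Longrightarrow> 0 \<le> c i"
    and sum: "(\<Sum>i\<in>I. c i) \<le> rho" and y: "(\<Sum>i\<in>I. c i * (k i - m)) \<le> y"
    and t: "0 \<le> b" "b \<le> m" "m < a" 
  shows "a * (\<Sum>i\<in>I. c i * (min a (k i) - m)) \<le> y * (a - b) + (a - m) * b * rho"
proof -
  define S where "S = (\<Sum>i\<in>I. c i * (min a (k i) - m))"
  have S1: "S \<le> y" unfolding S_def
    by (rule order_trans[OF sum_mono y]) (auto intro!: mult_left_mono c)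
  have "S \<le> (\<Sum>i\<in>I. c i * (a - m))" unfolding S_def
    by (rule sum_mono) (auto intro!: mult_left_mono c)
  also have "\<dots> = (\<Sum>i\<in>I. c i) * (a - m)" by (simp add: sum_distrib_right)
  also have "\<dots> \<le> rho * (a - m)" using sum t by (intro mult_right_mono) auto
  finally have S2: "S \<le> rho * (a - m)" .
  have a0: "0 < a" "0 \<le> m" using t by auto
  \<comment> \<open>The right side is the combination of the two bounds \<open>y\<close> and
    \<open>(a - m) * rho\<close> on \<open>S\<close> with the nonnegative weights
    \<open>a - b\<close> and \<open>b\<close>, which add up to \<open>a\<close>.\<close>
  have "a * S \<le> y * (a - b) + (a - m) * b * rho"
  proof (cases "y \<le> (a - m) * rho")
    case True
    have "y * (a - b) + (a - m) * b * rho - a * S = a * (y - S) + b * ((a - m) * rho - y)"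
      by (simp add: algebra_simps)
    also have "\<dots> \<ge> 0" using True S1 a0 t by (intro add_nonneg_nonneg mult_nonneg_nonneg) auto
    finally show ?thesis by simp
  next
    case False
    have "y * (a - b) + (a - m) * b * rho - a * S
        = a * (rho * (a - m) - S) + (m - b) * (y - (a - m) * rho) + (a - m) * (y - (a - m) * rho)"
      by (simp add: algebra_simps)
    also have "\<dots> \<ge> 0" using False S2 a0 t by (intro add_nonneg_nonneg mult_nonneg_nonneg) auto
    finally show ?thesis by simp
  qed
  then show ?thesis by (simp add: S_def)
qed

text \<open>The dual multipliers: \<open>c m i\<close> weighs the deviation with knot
  \<open>k m i\<close> in a cell of mean \<open>m\<close>, \<open>rho t\<close> prices the tail of
  abilities above \<open>t\<close>, \<open>s t\<close> the equality of mean ability and mean label,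
  and \<open>v t\<close> is the cut in the bound on ranks. \<open>c_cover\<close> serves the
  thresholds above \<open>m\<close>; \<open>c_cost\<close> and \<open>c_sum\<close> serve those up
  to \<open>m\<close>; \<open>slack\<close> keeps the margin there nonnegative, also for the means 0
  and 1.\<close>

locale certified_school = school +
  fixes D :: "real measure" and C :: real and rho s v :: "real \<Rightarrow> real"
    and I :: "'i set" and c k :: "real \<Rightarrow> 'i \<Rightarrow> real"
  assumes D_prob: "prob_space D" and sets_D [measurable_cong]: "sets D = sets borel"
    and D_range: "AE t in D. t \<in> {0..1}"
    and D_cdf: "\<And>x. 0 \<le> x \<Longrightarrow> x \<le> 1 \<Longrightarrow> measure D {..x} = Q x"
    and cert_measurable [measurable]: "rho \<in> borel_measurable borel" "s \<in> borel_measurable borel" "v \<in> borel_measurable borel"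
    and rho: "\<And>t. 0 \<le> rho t" "\<And>t. rho t \<le> 1" and s: "\<And>t. 0 \<le> s t" "\<And>t. s t \<le> 1"
    and v: "\<And>t. 0 \<le> t \<Longrightarrow> t \<le> 1 \<Longrightarrow> \<bar>v t\<bar> \<le> 1"
    and fin: "finite I" and c: "\<And>m i. i \<in> I \<Longrightarrow> 0 \<le> c m i"
    and k: "\<And>m i. \<lbrakk>i \<in> I; 0 < m; m < 1; c m i \<noteq> 0\<rbrakk> \<Longrightarrow> m < k m i \<and> k m i \<le> 1"
    and c_sum: "\<And>m t. \<lbrakk>0 < m; m < 1; t \<le> m\<rbrakk> \<Longrightarrow> (\<Sum>i\<in>I. c m i) \<le> rho t"
    and c_cover: "\<And>m t. \<lbrakk>0 < m; m < t; t \<le> 1\<rbrakk> \<Longrightarrow>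
       (rho t - (\<Sum>i\<in>I. if t \<le> k m i then c m i else 0)) * m \<le> s t * (t - m)"
    and c_cost: "\<And>m t. \<lbrakk>0 < m; m < 1; 0 \<le> t; t \<le> m\<rbrakk> \<Longrightarrow>
       (\<Sum>i\<in>I. c m i * (k m i - m)) \<le> C * m - v t - s t * (m - t) - m * rho t"
    and slack: "\<And>m t. \<lbrakk>0 \<le> t; t \<le> m; m \<le> 1\<rbrakk> \<Longrightarrow> 0 \<le> C * m - v t - s t * (m - t) - m * rho t"
begin

sublocale D: prob_space D by (rule D_prob)
sublocale JD: pair_prob_space J D ..

text \<open>\<open>a * P a\<close> is the \<open>D\<close>-integral over \<open>t\<close> of
  \<open>rho t\<close> times the contribution of ability \<open>a\<close> to the tail from
  \<open>t\<close> on.\<close>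

definition P where "P a = (\<integral>t. rho t * indicator {..a} t \<partial>D)"
text \<open>What is left of the target \<open>C * l\<close>, counted for the thresholds
  \<open>t \<le> l\<close>, after subtracting \<open>s t * (l - t)\<close> for every
  \<open>t\<close> and \<open>v t\<close> for \<open>t \<le> l\<close>.\<close>

definition psi where "psi t l = (if t \<le> l then C * l - v t - s t * (l - t) else s t * (t - l))"
definition Psi where "Psi l = (\<integral>t. psi t l \<partial>D)"

lemma psi_bound:
  assumes "0 \<le> t" "t \<le> 1" "0 \<le> l" "l \<le> 1"
  shows "\<bar>psi t l\<bar> \<le> \<bar>C\<bar> + 2"
proof -
  have "\<bar>C * l\<bar> \<le> \<bar>C\<bar> * 1" unfolding abs_mult using assms by (intro mult_left_mono) auto
  moreover have "\<bar>s t * (l - t)\<bar> \<le> 1 * 1" unfolding abs_mult using assms s[of t] by (intro mult_mono) auto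
  moreover have "\<bar>s t * (t - l)\<bar> \<le> 1 * 1" unfolding abs_mult using assms s[of t] by (intro mult_mono) auto
  ultimately show ?thesis using v[of t] assms unfolding psi_def by (auto split: if_splits)
qed

lemma D_integrable:
  fixes f :: "real \<Rightarrow> real"
  assumes "f \<in> borel_measurable borel" "\<And>t. 0 \<le> t \<Longrightarrow> t \<le> 1 \<Longrightarrow> \<bar>f t\<bar> \<le> K"
  shows "integrable D f"
  by (rule D.integrable_const_bound[where B=K])
     (use assms in \<open>auto intro!: eventually_mono[OF D_range] simp: measurable_cong_sets[OF sets_D refl]\<close>)

lemma psi_measurable [measurable]: "(\<lambda>t. psi t l) \<in> borel_measurable borel"
  unfolding psi_def by measurable

lemma psi_integrable: "0 \<le> l \<Longrightarrow> l \<le> 1 \<Longrightarrow> integrable D (\<lambda>t. psi t l)"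
  by (rule D_integrable[OF psi_measurable psi_bound])

text \<open>Thresholds outside \<open>{l<..l'}\<close> see a Lipschitz function of the label. Those
  inside may see a jump, but their \<open>D\<close>-mass is \<open>Q l' - Q l\<close>.\<close>

lemma Psi_diff:
  assumes "0 \<le> l" "l \<le> l'" "l' \<le> 1"
  shows "\<bar>Psi l' - Psi l\<bar> \<le> (\<bar>C\<bar> + 2) * (l' - l) + (\<bar>C\<bar> + 2) * (Q l' - Q l)"
proof -
  have "\<bar>Psi l' - Psi l\<bar> = \<bar>\<integral>t. psi t l' - psi t l \<partial>D\<bar>"
    unfolding Psi_def using assms by (subst Bochner_Integration.integral_diff) (auto intro!: psi_integrable)
  also have "\<dots> \<le> (\<integral>t. \<bar>psi t l' - psi t l\<bar> \<partial>D)" by (rule integral_abs_bound)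
  also have "\<dots> \<le> (\<integral>t. (\<bar>C\<bar> + 2) * (l' - l) + (\<bar>C\<bar> + 2) * indicator {l<..l'} t \<partial>D)"
  proof (rule integral_mono_AE)
    show "integrable D (\<lambda>t. \<bar>psi t l' - psi t l\<bar>)"
      using assms by (intro integrable_abs Bochner_Integration.integrable_diff psi_integrable) auto
    show "integrable D (\<lambda>t. (\<bar>C\<bar> + 2) * (l' - l) + (\<bar>C\<bar> + 2) * indicator {l<..l'} t)"
      by (intro Bochner_Integration.integrable_add D_integrable[where K="\<bar>C\<bar> + 2"] D.integrable_const) (auto simp: indicator_def)
    show "AE t in D. \<bar>psi t l' - psi t l\<bar> \<le> (\<bar>C\<bar> + 2) * (l' - l) + (\<bar>C\<bar> + 2) * indicator {l<..l'} t"
      using D_range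
    proof eventually_elim
      case (elim t)
      have a: "\<bar>C * (l' - l)\<bar> = \<bar>C\<bar> * (l' - l)" "0 \<le> s t * (l' - l)" "s t * (l' - l) \<le> 1 * (l' - l)"
        unfolding abs_mult using assms s[of t] mult_right_mono[of "s t" 1 "l' - l"] by auto
      have d: "0 \<le> \<bar>C\<bar> * (l' - l)" using assms by simp
      consider "t \<le> l" | "l < t" "t \<le> l'" | "l' < t" by linarith
      then show ?case
      proof cases
        case 1
        then have "psi t l' - psi t l = C * (l' - l) - s t * (l' - l)"
          using assms by (simp add: psi_def algebra_simps)
        moreover have "(\<bar>C\<bar> + 2) * (l' - l) + (\<bar>C\<bar> + 2) * indicator {l<..l'} t = \<bar>C\<bar> * (l' - l) + 2 * (l' - l)"
          using 1 by (simp add: algebra_simps)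
        ultimately show ?thesis using a assms by linarith
      next
        case 2
        have "0 \<le> s t * (t - l)" "s t * (t - l) \<le> 1 * (l' - l)"
          using 2 s[of t] mult_mono[of "s t" 1 "t - l" "l' - l"] by auto
        moreover have "\<bar>C * l'\<bar> \<le> \<bar>C\<bar> * 1" unfolding abs_mult using assms by (intro mult_left_mono) auto
        moreover have "0 \<le> s t * (l' - t)" "s t * (l' - t) \<le> 1 * (l' - l)"
          using 2 s[of t] mult_mono[of "s t" 1 "l' - t" "l' - l"] by auto
        moreover have "psi t l' - psi t l = C * l' - v t - s t * (l' - t) - s t * (t - l)"
          using 2 by (simp add: psi_def)
        moreover have "(\<bar>C\<bar> + 2) * (l' - l) + (\<bar>C\<bar> + 2) * indicator {l<..l'} t = \<bar>C\<bar> * (l' - l) + 2 * (l' - l) + \<bar>C\<bar> + 2"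
          using 2 by (simp add: algebra_simps)
        moreover have "\<bar>v t\<bar> \<le> 1" using v[of t] elim by simp
        ultimately show ?thesis using d by linarith
      next
        case 3
        then have "psi t l' - psi t l = - (s t * (l' - l))" using assms by (simp add: psi_def algebra_simps)
        then show ?thesis using a assms 3 d by (simp add: algebra_simps)
      qed
    qed
  qed
  also have "\<dots> = (\<bar>C\<bar> + 2) * (l' - l) + (\<bar>C\<bar> + 2) * measure D {l<..l'}"
  proof -
    have "integrable D (\<lambda>t. (\<bar>C\<bar> + 2) * indicator {l<..l'} t)"
      by (rule D_integrable[where K="\<bar>C\<bar> + 2"]) (auto simp: indicator_def)
    then show ?thesis by (subst Bochner_Integration.integral_add) (auto simp: D.prob_space)
  qed
  also have "measure D {l<..l'} = Q l' - Q l"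
  proof -
    have *: "{l<..l'} = {..l'} - {..l}" by auto
    show ?thesis unfolding * using assms D_cdf by (subst D.finite_measure_Diff) (auto simp: sets_D)
  qed
  finally show ?thesis .
qed

lemma P_integrable: "integrable D (\<lambda>t. rho t * indicator {..a} t)"
  by (rule D_integrable[where K=1]) (use rho in \<open>auto simp: indicator_def\<close>)

lemma P_measurable [measurable]: "P \<in> borel_measurable borel"
proof (rule borel_measurable_mono)
  show "mono P" unfolding P_def
    by (intro monoI integral_mono P_integrable) (use rho in \<open>auto simp: indicator_def\<close>)
qed

lemma P_range: "0 \<le> P a" "P a \<le> 1"
proof -
  show "0 \<le> P a" unfolding P_def by (intro integral_nonneg_AE) (use rho in \<open>auto simp: indicator_def\<close>)
  have "P a \<le> (\<integral>t. 1 \<partial>D)" unfolding P_def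
    by (intro integral_mono P_integrable) (use rho in \<open>auto simp: indicator_def\<close>)
  then show "P a \<le> 1" by (simp add: D.prob_space)
qed

lemma bdd_P: "f \<in> borel_measurable borel \<Longrightarrow> bdd (\<lambda>p. P (f p))"
  using P_range by (intro bdd_bounded[of _ 1]) (auto simp: abs_le_iff intro: order_trans[of _ 0])

text \<open>The sum is the layer at \<open>t\<close> of the weighted net gains of the deviations, as
  differences of \<open>Q\<close> are \<open>D\<close>-masses of intervals. A threshold above
  \<open>m\<close> is gained by the lifts that reach it; a threshold up to \<open>m\<close> is lost
  by the revealed students below it.\<close>

lemma layer_ineq:
  fixes B :: "real set" and m t :: real
  defines "b \<equiv> \<lambda>p :: real \<times> real. indicator B (snd p) :: real"
  defines "mu \<equiv> \<integral>p. b p * (indicator {m<..} (fst p) * (fst p - m)) \<partial>J"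
  defines "gam \<equiv> \<lambda>i. (\<integral>p. b p * (indicator {m<..} (fst p) * (fst p * (min (fst p) (k m i) - m))) \<partial>J) / mu"
  assumes B: "B \<in> sets borel" and m: "0 < m" "m < 1"
    and bal: "(\<integral>p. b p * (fst p - m) \<partial>J) = 0" and mu: "mu > 0" and t: "0 \<le> t" "t \<le> 1"
  shows "0 \<le> (\<integral>p. b p * psi t m - rho t * (b p * (indicator {t..} (fst p) * fst p))
     + (\<Sum>i\<in>I. c m i * (if m < t then (if t \<le> k m i then b p * (indicator {t..} (fst p) * fst p) else 0)
          else - (gam i * (b p * indicator {..<t} (fst p))))) \<partial>J)"
proof -
  note [measurable] = B
  have bb: "bdd b" unfolding b_def by (rule bdd_indicator_snd[OF B])
  have b0: "0 \<le> b p" for p by (simp add: b_def)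
  note I = bdd_integrable and bi = bdd_intros bb
  let ?E = "\<lambda>f. \<integral>p. f p \<partial>J"
  define pp where "pp = ?E b"
  define e where "e = ?E (\<lambda>p. b p * (indicator {t..} (fst p) * fst p))"
  define q where "q = ?E (\<lambda>p. b p * indicator {..<t} (fst p))"
  define eb where "eb = ?E (\<lambda>p. b p * (indicator {..<t} (fst p) * fst p))"
  define la where "la = ?E (\<lambda>p. b p * indicator {m<..} (fst p))"
  have i: "integrable J b" "integrable J (\<lambda>p. b p * (indicator {t..} (fst p) * fst p))"
    "integrable J (\<lambda>p. b p * indicator {..<t} (fst p))" "integrable J (\<lambda>p. b p * (indicator {..<t} (fst p) * fst p))"
    "integrable J (\<lambda>p. b p * indicator {m<..} (fst p))" "integrable J (\<lambda>p. b p * (fst p - m))"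
    "integrable J (\<lambda>p. b p * (indicator {m<..} (fst p) * (fst p - m)))"
    by (auto intro!: I bi)
  have pp0: "0 \<le> pp" unfolding pp_def using b0 by (intro integral_nonneg_AE) auto
  have sume: "e + eb = pp * m"
  proof -
    have "e + eb = ?E (\<lambda>p. b p * (indicator {t..} (fst p) * fst p) + b p * (indicator {..<t} (fst p) * fst p))"
      unfolding e_def eb_def by (rule Bochner_Integration.integral_add[symmetric, OF i(2,4)])
    also have "\<dots> = ?E (\<lambda>p. b p * (fst p - m) + m * b p)"
      by (intro Bochner_Integration.integral_cong) (auto simp: indicator_def algebra_simps)
    also have "\<dots> = pp * m" using i bal by (simp add: pp_def)
    finally show ?thesis .
  qed
  have eb0: "0 \<le> eb" unfolding eb_def
    by (intro integral_nonneg_AE, rule eventually_mono[OF ability_range]) (use b0 in auto)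
  have q0: "0 \<le> q" unfolding q_def using b0 by (intro integral_nonneg_AE) auto
  have ebt: "eb \<le> q * t"
  proof -
    have "eb \<le> ?E (\<lambda>p. t * (b p * indicator {..<t} (fst p)))" unfolding eb_def
      by (intro integral_mono i integrable_mult_right) (use t in \<open>auto simp: indicator_def b_def\<close>)
    then show ?thesis by (simp add: q_def mult.commute)
  qed
  show ?thesis
  proof (cases "m < t")
    case True
    define S where "S = (\<Sum>j\<in>I. if t \<le> k m j then c m j else 0)"
    have "(\<integral>p. b p * psi t m - rho t * (b p * (indicator {t..} (fst p) * fst p))
     + (\<Sum>j\<in>I. c m j * (if m < t then (if t \<le> k m j then b p * (indicator {t..} (fst p) * fst p) else 0)
          else - (gam j * (b p * indicator {..<t} (fst p))))) \<partial>J)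
      = ?E (\<lambda>p. b p * psi t m - rho t * (b p * (indicator {t..} (fst p) * fst p)) + S * (b p * (indicator {t..} (fst p) * fst p)))"
      using True by (intro Bochner_Integration.integral_cong)
        (auto simp: S_def sum_distrib_right intro!: sum.cong)
    also have "\<dots> = pp * psi t m - rho t * e + S * e"
      using i by (simp add: pp_def e_def)
    also have "\<dots> = pp * (s t * (t - m)) - (rho t - S) * e"
      using True by (simp add: psi_def algebra_simps)
    also have "\<dots> \<ge> 0"
    proof (cases "rho t \<le> S")
      case t2: True
      have "0 \<le> e" using sume ebt unfolding e_def
        by (intro integral_nonneg_AE, intro eventually_mono[OF ability_range]) (use b0 in auto)
      then have "(rho t - S) * e \<le> 0" using t2 by (intro mult_nonpos_nonneg) auto
      moreover have "0 \<le> pp * (s t * (t - m))" using pp0 s[of t] True by auto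
      ultimately show ?thesis by simp
    next
      case False
      \<comment> \<open>The part of \<open>rho t\<close> that no lift covers is charged at the whole
        mean \<open>pp * m\<close>, which bounds the tail mean \<open>e\<close>;
        \<open>c_cover\<close> pays for it by \<open>s t\<close>.\<close>
      have "(rho t - S) * e \<le> (rho t - S) * (pp * m)" using False sume eb0 by (intro mult_left_mono) auto
      also have "\<dots> = pp * ((rho t - S) * m)" by simp
      also have "\<dots> \<le> pp * (s t * (t - m))" using c_cover[OF m(1) True t(2)] pp0
        by (intro mult_left_mono) (auto simp: S_def)
      finally show ?thesis by simp
    qed
    finally show ?thesis .
  next
    case False
    \<comment> \<open>The right side of \<open>c_cost\<close>: the margin that is left when the tail
      from \<open>t\<close> on is charged with the full mean of the cell. What this overcharges,
      \<open>rho t * eb\<close>, is credited later.\<close>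
    define y where "y = C * m - v t - s t * (m - t) - m * rho t"
    define Ga where "Ga = (\<Sum>j\<in>I. c m j * gam j)"
    have tm: "t \<le> m" using False by simp
    have y0: "0 \<le> y" unfolding y_def using slack[of t m] tm t m by simp
    have "(\<integral>p. b p * psi t m - rho t * (b p * (indicator {t..} (fst p) * fst p))
     + (\<Sum>j\<in>I. c m j * (if m < t then (if t \<le> k m j then b p * (indicator {t..} (fst p) * fst p) else 0)
          else - (gam j * (b p * indicator {..<t} (fst p))))) \<partial>J)
      = ?E (\<lambda>p. b p * psi t m - rho t * (b p * (indicator {t..} (fst p) * fst p)) - Ga * (b p * indicator {..<t} (fst p)))"
      using False by (intro Bochner_Integration.integral_cong)
        (auto simp: Ga_def sum_distrib_right sum_negf intro!: sum.cong)
    also have "\<dots> = pp * psi t m - rho t * e - Ga * q"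
      using i by (simp add: pp_def e_def q_def)
    also have "\<dots> = pp * y + rho t * eb - Ga * q"
    proof -
      have "rho t * e = rho t * (pp * m - eb)" using sume by simp
      then show ?thesis using tm by (simp add: psi_def y_def algebra_simps)
    qed
    also have "\<dots> \<ge> 0"
    proof (cases "q = 0")
      case True then show ?thesis using pp0 y0 rho[of t] eb0 by simp
    next
      case qn: False
      then have qp: "q > 0" using q0 by simp
      \<comment> \<open>The mean ability of the students of the cell below \<open>t\<close>; it
        takes the place of \<open>b\<close> in \<open>lift_kernel_ineq\<close>.\<close>
      define z where "z = eb / q"
      have z: "0 \<le> z" "z \<le> t" "q * z = eb" using eb0 qp ebt by (auto simp: z_def divide_le_eq mult.commute)
      have "mu * Ga = ?E (\<lambda>p. \<Sum>j\<in>I. c m j * (b p * (indicator {m<..} (fst p) * (fst p * (min (fst p) (k m j) - m)))))"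
      proof -
        have "integrable J (\<lambda>p. c m j * (b p * (indicator {m<..} (fst p) * (fst p * (min (fst p) (k m j) - m)))))" for j
          by (auto intro!: I bi)
        then have "?E (\<lambda>p. \<Sum>j\<in>I. c m j * (b p * (indicator {m<..} (fst p) * (fst p * (min (fst p) (k m j) - m)))))
          = (\<Sum>j\<in>I. c m j * ?E (\<lambda>p. b p * (indicator {m<..} (fst p) * (fst p * (min (fst p) (k m j) - m)))))"
          by (subst Bochner_Integration.integral_sum) auto
        then show ?thesis using mu by (simp add: Ga_def gam_def sum_distrib_left algebra_simps)
      qed
      \<comment> \<open>The kernel bound with \<open>a - z\<close> split as
        \<open>(a - m) + (m - z)\<close>, so that its integral involves the cell only through
        \<open>mu\<close> and \<open>la\<close>.\<close>
      also have "\<dots> \<le> ?E (\<lambda>p. (y + z * rho t) * (b p * (indicator {m<..} (fst p) * (fst p - m)))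
            + (y * (m - z)) * (b p * indicator {m<..} (fst p)))"
      proof (intro integral_mono)
        show "integrable J (\<lambda>p. \<Sum>j\<in>I. c m j * (b p * (indicator {m<..} (fst p) * (fst p * (min (fst p) (k m j) - m)))))"
          by (auto intro!: I bi Bochner_Integration.integrable_sum)
        show "integrable J (\<lambda>p. (y + z * rho t) * (b p * (indicator {m<..} (fst p) * (fst p - m)))
            + (y * (m - z)) * (b p * indicator {m<..} (fst p)))" by (auto intro!: I bi)
        fix p :: "real \<times> real"
        have "fst p * (\<Sum>j\<in>I. c m j * (min (fst p) (k m j) - m)) \<le> y * (fst p - z) + (fst p - m) * z * rho t"
          if "m < fst p"
          by (rule lift_kernel_ineq) (use c c_sum[OF m tm] c_cost[OF m t(1) tm] z tm that in \<open>auto simp: y_def\<close>)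
        then show "(\<Sum>j\<in>I. c m j * (b p * (indicator {m<..} (fst p) * (fst p * (min (fst p) (k m j) - m)))))
          \<le> (y + z * rho t) * (b p * (indicator {m<..} (fst p) * (fst p - m))) + (y * (m - z)) * (b p * indicator {m<..} (fst p))"
          by (auto simp: indicator_def b_def sum_distrib_left algebra_simps)
      qed
      also have "\<dots> = (y + z * rho t) * mu + y * (m - z) * la" using i by (simp add: mu_def la_def)
      finally have G: "mu * Ga \<le> (y + z * rho t) * mu + y * (m - z) * la" .
      \<comment> \<open>The students below \<open>t \<le> m\<close> carry only a part of the total
        deficit below \<open>m\<close>, and that deficit equals \<open>mu\<close>.\<close>
      have "q * m - eb \<le> mu"
      proof -
        have "q * m - eb = ?E (\<lambda>p. m * (b p * indicator {..<t} (fst p)) - b p * (indicator {..<t} (fst p) * fst p))"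
          using i by (simp add: q_def eb_def)
        also have "\<dots> \<le> ?E (\<lambda>p. b p * (indicator {m<..} (fst p) * (fst p - m)) - b p * (fst p - m))"
          by (intro integral_mono Bochner_Integration.integrable_diff integrable_mult_right i)
             (use tm b0 in \<open>auto simp: indicator_def algebra_simps mult_left_mono b_def\<close>)
        also have "\<dots> = mu" using i bal by (simp add: mu_def)
        finally show ?thesis .
      qed
      moreover have "0 \<le> la" unfolding la_def using b0 by (intro integral_nonneg_AE) auto
      moreover have qla: "q + la \<le> pp"
      proof -
        have "q + la = ?E (\<lambda>p. b p * indicator {..<t} (fst p) + b p * indicator {m<..} (fst p))"
          using i by (simp add: q_def la_def)
        also have "\<dots> \<le> ?E b"
          by (intro integral_mono Bochner_Integration.integrable_add i) (use tm in \<open>auto simp: indicator_def b_def\<close>)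
        finally show ?thesis by (simp add: pp_def)
      qed
      ultimately have le: "y * la * (q * m - eb) \<le> y * la * mu" using y0 by (intro mult_left_mono) auto
      have "mu * (q * Ga) \<le> q * ((y + z * rho t) * mu + y * (m - z) * la)"
        using mult_left_mono[OF G q0] by (simp add: algebra_simps)
      also have "\<dots> = mu * (y * q + (q * z) * rho t) + y * la * (q * m - q * z)"
        by (simp add: algebra_simps)
      also have "\<dots> \<le> mu * (y * q + eb * rho t) + y * la * mu" unfolding z(3) using le by simp
      also have "\<dots> = mu * (y * (q + la) + eb * rho t)" by (simp add: algebra_simps)
      also have "\<dots> \<le> mu * (y * pp + eb * rho t)" using qla y0 mu by (intro mult_left_mono add_right_mono) auto
      finally have "q * Ga \<le> y * pp + eb * rho t" using mu by simp
      then show ?thesis by (simp add: algebra_simps)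
    qed
    finally show ?thesis .
  qed
qed

lemma Psi_measurable [measurable]: "Psi \<in> borel_measurable borel"
  unfolding Psi_def psi_def by measurable

lemma measure_D_interval:
  assumes "0 \<le> x" "x \<le> y" "y \<le> 1" shows "measure D {x<..y} = Q y - Q x"
proof -
  have *: "{x<..y} = {..y} - {..x}" by auto
  show ?thesis unfolding * using assms D_cdf by (subst D.finite_measure_Diff) (auto simp: sets_D)
qed

text \<open>Integrating \<open>layer_ineq\<close> over \<open>D\<close> reassembles the layers into
  the net gains of \<open>lift_deviation\<close>, each of which is at most the error term, and the
  weights \<open>c m i\<close> sum to at most 1.\<close>

lemma cell_ineq:
  fixes B :: "real set" and m :: real
  defines "b \<equiv> \<lambda>p :: real \<times> real. indicator B (snd p) :: real"
  assumes B: "B \<in> sets borel" and m: "0 \<le> m" "m \<le> 1" and bal: "(\<integral>p. b p * (fst p - m) \<partial>J) = 0"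
  shows "(\<integral>p. b p * (fst p * P (fst p)) \<partial>J)
    \<le> (\<integral>p. b p \<partial>J) * Psi m + \<bar>\<integral>p. b p * (Q (snd p) - Q m) \<partial>J\<bar>"
proof -
  note [measurable] = B
  have bm[measurable]: "b \<in> borel_measurable borel" unfolding b_def by measurable
  have bb: "bdd b" unfolding b_def by (rule bdd_indicator_snd[OF B])
  have b0: "0 \<le> b p" "b p \<le> 1" for p by (auto simp: b_def)
  note I = bdd_integrable and bi = bdd_intros bb bdd_P
  let ?E = "\<lambda>f. \<integral>p. f p \<partial>J"
  define mu where "mu = ?E (\<lambda>p. b p * (indicator {m<..} (fst p) * (fst p - m)))"
  have i: "integrable J b" "integrable J (\<lambda>p. b p * (indicator {m<..} (fst p) * (fst p - m)))"
    "integrable J (\<lambda>p. b p * (fst p - m))"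
    by (auto intro!: I bi)
  have mu0: "0 \<le> mu" unfolding mu_def using b0 by (intro integral_nonneg_AE) (auto simp: indicator_def)
  show ?thesis
  proof (cases "mu = 0")
    \<comment> \<open>Almost all students of the cell have ability \<open>m\<close>, so there is
      nobody to lift; \<open>slack\<close> alone gives the inequality for each threshold.\<close>
    case True
    have "?E (\<lambda>p. b p * \<bar>fst p - m\<bar>) = ?E (\<lambda>p. 2 * (b p * (indicator {m<..} (fst p) * (fst p - m))) - b p * (fst p - m))"
      by (intro Bochner_Integration.integral_cong) (auto simp: indicator_def algebra_simps)
    also have "\<dots> = 0" using i bal True by (simp add: mu_def)
    finally have z: "?E (\<lambda>p. b p * \<bar>fst p - m\<bar>) = 0" .
    have "integrable J (\<lambda>p. b p * \<bar>fst p - m\<bar>)"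
      using integrable_abs[OF i(3)] b0 by (simp add: abs_mult)
    then have ae: "AE p in J. b p * \<bar>fst p - m\<bar> = 0"
      using z b0 by (subst (asm) integral_nonneg_eq_0_iff_AE) auto
    have "?E (\<lambda>p. b p * (fst p * P (fst p))) = ?E (\<lambda>p. b p * (m * P m))"
      by (intro integral_cong_AE; (measurable)?) (use ae in \<open>auto elim!: eventually_mono\<close>)
    also have "\<dots> = ?E b * (m * P m)" by simp
    also have "\<dots> \<le> ?E b * Psi m"
    proof (intro mult_left_mono)
      have "m * P m = (\<integral>t. m * (rho t * indicator {..m} t) \<partial>D)" by (simp add: P_def)
      also have "\<dots> \<le> Psi m" unfolding Psi_def
      proof (intro integral_mono_AE integrable_mult_right P_integrable psi_integrable m)
        show "AE t in D. m * (rho t * indicator {..m} t) \<le> psi t m"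
          using D_range
        proof eventually_elim
          case (elim t)
          then show ?case using slack[of t m] m s[of t] by (auto simp: psi_def indicator_def)
        qed
      qed
      finally show "m * P m \<le> Psi m" .
    qed (use b0 in \<open>auto intro!: integral_nonneg_AE\<close>)
    finally show ?thesis by simp
  next
    case False
    then have mup: "mu > 0" using mu0 by simp
    have m1: "m < 1"
    proof (rule ccontr)
      assume "\<not> m < 1"
      have "mu \<le> ?E (\<lambda>p. 0)" unfolding mu_def
      proof (rule integral_mono_AE[OF i(2)])
        show "AE p in J. b p * (indicator {m<..} (fst p) * (fst p - m)) \<le> 0"
          using ability_range by eventually_elim (use \<open>\<not> m < 1\<close> in \<open>auto simp: indicator_def\<close>)
      qed simp
      then show False using mup by simp
    qed
    have m0: "0 < m"
    proof (rule ccontr)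
      assume "\<not> 0 < m"
      have "mu \<le> ?E (\<lambda>p. b p * (fst p - m))" unfolding mu_def
      proof (rule integral_mono_AE[OF i(2,3)])
        show "AE p in J. b p * (indicator {m<..} (fst p) * (fst p - m)) \<le> b p * (fst p - m)"
          using ability_range by eventually_elim (use \<open>\<not> 0 < m\<close> b0 in \<open>auto simp: indicator_def\<close>)
      qed
      then show False using mup bal by simp
    qed
    define gam where "gam = (\<lambda>j. ?E (\<lambda>p. b p * (indicator {m<..} (fst p) * (fst p * (min (fst p) (k m j) - m)))) / mu)"
    \<comment> \<open>The integrand of \<open>layer_ineq\<close>, with conditionals in place of
      indicators of sets that depend on \<open>t\<close>, which makes joint measurability in
      \<open>p\<close> and \<open>t\<close> evident.\<close>
    define f where "f = (\<lambda>p t. b p * psi t m - rho t * (b p * (if t \<le> fst p then fst p else 0))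
     + (\<Sum>j\<in>I. c m j * (if m < t then (if t \<le> k m j then b p * (if t \<le> fst p then fst p else 0) else 0)
          else - (gam j * (b p * (if fst p < t then 1 else 0))))))"
    have fm: "case_prod f \<in> borel_measurable (borel \<Otimes>\<^sub>M borel)"
      unfolding f_def psi_def by measurable
    define L1 where "L1 = (\<lambda>j. ?E (\<lambda>p. b p * (indicator {m<..} (fst p) * (fst p * (Q (min (fst p) (k m j)) - Q m)))))"
    define L2 where "L2 = ?E (\<lambda>p. b p * (indicator {..<m} (fst p) * (Q m - Q (fst p))))"
    define K where "K = \<bar>C\<bar> + 3 + (\<Sum>j\<in>I. c m j * (1 + \<bar>gam j\<bar>))"
    have fb: "AE p in J. \<forall>t. 0 \<le> t \<longrightarrow> t \<le> 1 \<longrightarrow> \<bar>f p t\<bar> \<le> K"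
      using ability_range
    proof eventually_elim
      case (elim p)
      show ?case
      proof (intro allI impI)
        fix t :: real assume t: "0 \<le> t" "t \<le> 1"
        have 1: "\<bar>b p * psi t m\<bar> \<le> 1 * (\<bar>C\<bar> + 2)" unfolding abs_mult
          using b0[of p] psi_bound[OF t m] by (intro mult_mono) auto
        have ba: "0 \<le> b p * (if t \<le> fst p then fst p else 0)" "b p * (if t \<le> fst p then fst p else 0) \<le> 1"
          using b0[of p] elim by (auto intro: mult_le_one)
        have 2: "\<bar>rho t * (b p * (if t \<le> fst p then fst p else 0))\<bar> \<le> 1"
          using mult_nonneg_nonneg[OF rho(1)[of t] ba(1)] mult_le_one[OF rho(2)[of t] ba] by linarith
        have 3: "\<bar>c m j * (if m < t then (if t \<le> k m j then b p * (if t \<le> fst p then fst p else 0) else 0)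
          else - (gam j * (b p * (if fst p < t then 1 else 0))))\<bar> \<le> c m j * (1 + \<bar>gam j\<bar>)" if "j \<in> I" for j
        proof -
          have "\<bar>gam j * (b p * (if fst p < t then 1 else 0))\<bar> \<le> \<bar>gam j\<bar> * 1"
            unfolding abs_mult using b0[of p] by (intro mult_left_mono) auto
          then have "\<bar>if m < t then (if t \<le> k m j then b p * (if t \<le> fst p then fst p else 0) else 0)
             else - (gam j * (b p * (if fst p < t then 1 else 0)))\<bar> \<le> 1 + \<bar>gam j\<bar>"
            using ba by (auto split: if_splits)
          then show ?thesis using c[OF that] by (auto simp: abs_mult intro!: mult_left_mono)
        qed
        have 4: "\<bar>\<Sum>j\<in>I. c m j * (if m < t then (if t \<le> k m j then b p * (if t \<le> fst p then fst p else 0) else 0)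
          else - (gam j * (b p * (if fst p < t then 1 else 0))))\<bar> \<le> (\<Sum>j\<in>I. c m j * (1 + \<bar>gam j\<bar>))"
          by (rule order_trans[OF sum_abs sum_mono[OF 3]])
        have tri: "\<bar>x - y + z\<bar> \<le> a + b + c" if "\<bar>x\<bar> \<le> a" "\<bar>y\<bar> \<le> b" "\<bar>z\<bar> \<le> c" for x y z a b c :: real
          using that by linarith
        show "\<bar>f p t\<bar> \<le> K" unfolding f_def K_def
          by (rule order_trans[OF tri[OF 1 2 4]]) simp
      qed
    qed
    have fm': "case_prod f \<in> borel_measurable (J \<Otimes>\<^sub>M D)"
      using fm by (simp add: measurable_cong_sets[OF sets_pair_measure_cong[OF sets_J sets_D] refl])
    have fb': "AE p in J. p \<in> {p. \<forall>t. 0 \<le> t \<longrightarrow> t \<le> 1 \<longrightarrow> \<bar>f p t\<bar> \<le> K}" using fb by simp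
    note fub = bounded_fubini[OF prob_space_axioms D_prob fm' fb' D_range, of K, simplified]
    have "0 \<le> (\<integral>t. \<integral>p. f p t \<partial>J \<partial>D)"
    proof (rule integral_nonneg_AE)
      show "AE t in D. 0 \<le> (\<integral>p. f p t \<partial>J)"
        using D_range
      proof eventually_elim
        case (elim t)
        have "0 \<le> t" "t \<le> 1" using elim by auto
        note ineq = layer_ineq[OF B m0 m1 bal[unfolded b_def] mup[unfolded mu_def b_def] this]
        show ?case
          by (rule order_trans[OF ineq], rule eq_refl, rule Bochner_Integration.integral_cong)
             (auto simp: f_def gam_def mu_def b_def indicator_def intro!: sum.cong)
      qed
    qed
    also have "\<dots> = (\<integral>p. \<integral>t. f p t \<partial>D \<partial>J)" by (rule fub)
    also have "\<dots> = (\<integral>p. Psi m * b p - b p * (fst p * P (fst p))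
       + (\<Sum>j\<in>I. c m j * (b p * (indicator {m<..} (fst p) * (fst p * (Q (min (fst p) (k m j)) - Q m)))
           - gam j * (b p * (indicator {..<m} (fst p) * (Q m - Q (fst p)))))) \<partial>J)"
    proof (rule integral_cong_AE)
      show "AE p in J. (\<integral>t. f p t \<partial>D) = Psi m * b p - b p * (fst p * P (fst p))
       + (\<Sum>j\<in>I. c m j * (b p * (indicator {m<..} (fst p) * (fst p * (Q (min (fst p) (k m j)) - Q m)))
           - gam j * (b p * (indicator {..<m} (fst p) * (Q m - Q (fst p))))))"
        using ability_range
      proof eventually_elim
        case (elim p)
        have eq: "f p t = b p * psi t m - (b p * fst p) * (rho t * indicator {..fst p} t)
           + (\<Sum>j\<in>I. c m j * ((b p * fst p) * indicator {m<..min (fst p) (k m j)} t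
                - (gam j * b p) * indicator {fst p<..m} t))" for t
          unfolding f_def by (auto simp: indicator_def intro!: sum.cong sum.neutral)
        have ii: "integrable D (\<lambda>t. psi t m)" "integrable D (\<lambda>t. rho t * indicator {..fst p} t)"
          "integrable D (\<lambda>t. indicator {m<..min (fst p) (k m j)} t :: real)" "integrable D (\<lambda>t. indicator {fst p<..m} t :: real)" for j
          using psi_integrable m P_integrable by (auto simp: sets_D D.emeasure_eq_measure intro!: integrable_real_indicator)
        have 1: "(\<integral>t. (b p * fst p) * indicator {m<..min (fst p) (k m j)} t - (gam j * b p) * indicator {fst p<..m} t \<partial>D)
            = (b p * fst p) * measure D {m<..min (fst p) (k m j)} - (gam j * b p) * measure D {fst p<..m}" for j
          using ii by simp
        have 2: "c m j * ((b p * fst p) * measure D {m<..min (fst p) (k m j)} - (gam j * b p) * measure D {fst p<..m})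
           = c m j * (b p * (indicator {m<..} (fst p) * (fst p * (Q (min (fst p) (k m j)) - Q m)))
           - gam j * (b p * (indicator {..<m} (fst p) * (Q m - Q (fst p)))))" if "j \<in> I" for j
        proof (cases "c m j = 0")
          case False
          note kk = k[OF that m0 m1 False]
          have e1: "measure D {fst p<..m} = indicator {..<m} (fst p) * (Q m - Q (fst p))"
            using elim m by (cases "fst p < m") (auto simp: measure_D_interval)
          have e2: "measure D {m<..min (fst p) (k m j)} = indicator {m<..} (fst p) * (Q (min (fst p) (k m j)) - Q m)"
            using elim m kk by (cases "m < fst p") (auto simp: measure_D_interval)
          show ?thesis unfolding e1 e2 by (simp add: algebra_simps)
        qed simp
        have "(\<integral>t. f p t \<partial>D) = b p * Psi m - (b p * fst p) * P (fst p)
           + (\<Sum>j\<in>I. c m j * ((b p * fst p) * measure D {m<..min (fst p) (k m j)} - (gam j * b p) * measure D {fst p<..m}))"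
          unfolding eq using ii fin
          by (simp add: Psi_def P_def 1 del: integral_indicator Bochner_Integration.integral_indicator)
        then show ?case using 2 by (simp cong: sum.cong)
      qed
      show "(\<lambda>p. \<integral>t. f p t \<partial>D) \<in> borel_measurable J" by (rule borel_measurable_integrable[OF fub(3)])
    qed measurable
    also have "\<dots> = Psi m * ?E b - ?E (\<lambda>p. b p * (fst p * P (fst p))) + (\<Sum>j\<in>I. c m j * (L1 j - gam j * L2))"
    proof -
      have ii: "integrable J (\<lambda>p. b p * (fst p * P (fst p)))"
        "integrable J (\<lambda>p. b p * (indicator {m<..} (fst p) * (fst p * (Q (min (fst p) (k m j)) - Q m))))"
        "integrable J (\<lambda>p. b p * (indicator {..<m} (fst p) * (Q m - Q (fst p))))" for j
        by (auto intro!: I bi)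
      show ?thesis unfolding L1_def L2_def using ii i(1) fin
        by (simp only: Bochner_Integration.integral_add Bochner_Integration.integral_diff integral_mult_right_zero
             Bochner_Integration.integral_sum Bochner_Integration.integrable_sum
             Bochner_Integration.integrable_add Bochner_Integration.integrable_diff integrable_mult_right ii i(1))
    qed
    finally have A: "?E (\<lambda>p. b p * (fst p * P (fst p))) \<le> ?E b * Psi m + (\<Sum>j\<in>I. c m j * (L1 j - gam j * L2))"
      by (simp add: mult.commute)
    define err where "err = \<bar>?E (\<lambda>p. b p * (Q (snd p) - Q m))\<bar>"
    have "(\<Sum>j\<in>I. c m j * (L1 j - gam j * L2)) \<le> (\<Sum>j\<in>I. c m j * err)"
    proof (rule sum_mono)
      fix j assume j: "j \<in> I"
      show "c m j * (L1 j - gam j * L2) \<le> c m j * err"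
      proof (cases "c m j = 0")
        case False
        note kk = k[OF j m0 m1 False]
        have "L1 j - gam j * L2 \<le> ?E (\<lambda>p. b p * (Q (snd p) - Q m))"
          unfolding L1_def L2_def gam_def mu_def b_def
          by (rule lift_deviation[OF B m(1) kk[THEN conjunct1] kk[THEN conjunct2] bal[unfolded b_def] mup[unfolded mu_def b_def]])
        then show ?thesis using c[OF j] by (intro mult_left_mono) (auto simp: err_def)
      qed simp
    qed
    also have "\<dots> = (\<Sum>j\<in>I. c m j) * err" by (simp add: sum_distrib_right)
    also have "\<dots> \<le> 1 * err" using c_sum[OF m0 m1 order_refl] rho[of m] by (intro mult_right_mono) (auto simp: err_def)
    finally show ?thesis using A by (simp add: err_def)
  qed
qed

lemma Psi_range: assumes "0 \<le> l" "l \<le> 1" shows "\<bar>Psi l\<bar> \<le> \<bar>C\<bar> + 2"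
proof -
  have "\<bar>Psi l\<bar> \<le> (\<integral>t. \<bar>psi t l\<bar> \<partial>D)" unfolding Psi_def by (rule integral_abs_bound)
  also have "\<dots> \<le> (\<integral>t. \<bar>C\<bar> + 2 \<partial>D)"
    using assms by (intro integral_mono_AE integrable_abs psi_integrable D.integrable_const)
      (auto intro!: eventually_mono[OF D_range] psi_bound)
  finally show ?thesis by (simp add: D.prob_space)
qed

lemma Psi_label_integrable: "bdd (\<lambda>p. Psi (snd p))"
  unfolding bdd_def using Psi_range
  by (intro conjI exI[of _ "\<bar>C\<bar> + 2"] eventually_mono[OF label_range]
      measurable_compose[OF borel_measurable_snd_real Psi_measurable]) auto

text \<open>In a cell of width \<open>w\<close> all labels are within \<open>w\<close> of the mean
  \<open>m\<close>. Replacing \<open>m\<close> by the label therefore costs at most \<open>e\<close>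
  in \<open>Q\<close> and, by \<open>Psi_diff\<close>, at most
  \<open>(\<bar>C\<bar> + 2) * (w + e)\<close> in \<open>Psi\<close>, per unit of mass.\<close>

lemma cell_label_ineq:
  fixes B :: "real set" and e w :: real
  defines "b \<equiv> \<lambda>p :: real \<times> real. indicator B (snd p) :: real"
  assumes B: "B \<in> sets borel" and sub: "B \<inter> {0..1} \<subseteq> {lo..lo + w}" and w: "0 \<le> w"
    and e: "\<And>x y. 0 \<le> x \<Longrightarrow> x \<le> 1 \<Longrightarrow> 0 \<le> y \<Longrightarrow> y \<le> 1 \<Longrightarrow> \<bar>x - y\<bar> \<le> w \<Longrightarrow> \<bar>Q x - Q y\<bar> \<le> e"
  shows "(\<integral>p. b p * (fst p * P (fst p)) \<partial>J)
    \<le> (\<integral>p. b p * Psi (snd p) \<partial>J) + (e + (\<bar>C\<bar> + 2) * (w + e)) * (\<integral>p. b p \<partial>J)"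
proof -
  note [measurable] = B
  have bb: "bdd b" unfolding b_def by (rule bdd_indicator_snd[OF B])
  have b01: "b p = 0 \<or> b p = 1" for p by (auto simp: b_def indicator_def)
  note I = bdd_integrable and bi = bdd_intros bb bdd_P Psi_label_integrable
  let ?E = "\<lambda>f. \<integral>p. f p \<partial>J"
  have i: "integrable J b" "integrable J (\<lambda>p. b p * snd p)" "integrable J (\<lambda>p. b p * (fst p - snd p))"
    "integrable J (\<lambda>p. b p * Psi (snd p))" "integrable J (\<lambda>p. b p * (Q (snd p) - Q m))" for m
    by (auto intro!: I bi)
  have p0: "0 \<le> ?E b" by (intro integral_nonneg_AE) (auto simp: b_def)
  show ?thesis
  proof (cases "?E b = 0")
    case True
    then have "AE p in J. b p = 0"
      using i(1) by (subst (asm) integral_nonneg_eq_0_iff_AE) (auto simp: b_def)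
    then have "?E (\<lambda>p. b p * (fst p * P (fst p))) = 0" "?E (\<lambda>p. b p * Psi (snd p)) = 0"
      by (auto intro!: integral_eq_zero_AE elim: eventually_mono)
    then show ?thesis using True by simp
  next
    case False
    then have pp: "?E b > 0" using p0 by simp
    define m where "m = ?E (\<lambda>p. b p * snd p) / ?E b"
    have mp: "?E (\<lambda>p. b p * snd p) = m * ?E b" using False by (simp add: m_def)
    have inB: "b p = 1 \<Longrightarrow> snd p \<in> B" for p by (auto simp: b_def indicator_def split: if_splits)
    have lower: "x \<le> m" if "AE p in J. b p = 1 \<longrightarrow> x \<le> snd p" for x
    proof -
      have "x * ?E b = ?E (\<lambda>p. x * b p)" by simp
      also have "\<dots> \<le> ?E (\<lambda>p. b p * snd p)"
        using that b01 by (intro integral_mono_AE i integrable_mult_right)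
          (auto elim!: eventually_mono; metis mult_zero_left mult_zero_right order_refl mult_1 mult.commute)
      finally show ?thesis using pp mp by simp
    qed
    have upper: "m \<le> x" if "AE p in J. b p = 1 \<longrightarrow> snd p \<le> x" for x
    proof -
      have "?E (\<lambda>p. b p * snd p) \<le> ?E (\<lambda>p. x * b p)"
        using that b01 by (intro integral_mono_AE i integrable_mult_right)
          (auto elim!: eventually_mono; metis mult_zero_left mult_zero_right order_refl mult_1 mult.commute)
      also have "\<dots> = x * ?E b" by simp
      finally show ?thesis using pp mp by simp
    qed
    have m01: "0 \<le> m" "m \<le> 1"
      by (rule lower upper, rule eventually_mono[OF label_range], simp)+
    have mlo: "lo \<le> m" by (rule lower, rule eventually_mono[OF label_range]) (use sub inB in force)
    have mhi: "m \<le> lo + w" by (rule upper, rule eventually_mono[OF label_range]) (use sub inB in force)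
    have near: "AE p in J. b p = 1 \<longrightarrow> snd p \<in> {0..1} \<and> \<bar>snd p - m\<bar> \<le> w"
      using label_range
    proof eventually_elim
      case (elim p)
      show ?case
      proof
        assume "b p = 1"
        then have "snd p \<in> {lo..lo + w}" using inB elim sub by blast
        then show "snd p \<in> {0..1} \<and> \<bar>snd p - m\<bar> \<le> w" using elim mlo mhi by auto
      qed
    qed
    have "?E (\<lambda>p. b p * (fst p - m)) = ?E (\<lambda>p. b p * (fst p - snd p) + (b p * snd p - m * b p))"
      by (intro Bochner_Integration.integral_cong) (auto simp: algebra_simps)
    also have "\<dots> = 0" using i mp calibrated[OF B] by (simp add: b_def)
    finally have bal: "?E (\<lambda>p. b p * (fst p - m)) = 0" .
    have "\<bar>?E (\<lambda>p. b p * (Q (snd p) - Q m))\<bar> \<le> ?E (\<lambda>p. \<bar>b p * (Q (snd p) - Q m)\<bar>)" by (rule integral_abs_bound)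
    also have "\<dots> \<le> ?E (\<lambda>p. e * b p)"
    proof (intro integral_mono_AE integrable_abs i integrable_mult_right)
      show "AE p in J. \<bar>b p * (Q (snd p) - Q m)\<bar> \<le> e * b p" using near
      proof eventually_elim
        case (elim p) then show ?case using b01[of p] e[of "snd p" m] m01 by auto
      qed
    qed
    finally have 1: "\<bar>?E (\<lambda>p. b p * (Q (snd p) - Q m))\<bar> \<le> e * ?E b" by simp
    have "Psi m * ?E b - (\<bar>C\<bar> + 2) * (w + e) * ?E b = ?E (\<lambda>p. (Psi m - (\<bar>C\<bar> + 2) * (w + e)) * b p)"
      unfolding integral_mult_right_zero by (simp add: left_diff_distrib)
    also have "\<dots> \<le> ?E (\<lambda>p. b p * Psi (snd p))"
    proof (intro integral_mono_AE i integrable_mult_right)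
      show "AE p in J. (Psi m - (\<bar>C\<bar> + 2) * (w + e)) * b p \<le> b p * Psi (snd p)" using near
      proof eventually_elim
        case (elim p)
        show ?case
        proof (cases "b p = 1")
          case True
          then have s: "0 \<le> snd p" "snd p \<le> 1" "\<bar>snd p - m\<bar> \<le> w" using elim by auto
          have "\<bar>Psi (snd p) - Psi m\<bar> \<le> (\<bar>C\<bar> + 2) * \<bar>snd p - m\<bar> + (\<bar>C\<bar> + 2) * \<bar>Q (snd p) - Q m\<bar>"
          proof (cases "m \<le> snd p")
            case True
            have "(\<bar>C\<bar> + 2) * (Q (snd p) - Q m) \<le> (\<bar>C\<bar> + 2) * \<bar>Q (snd p) - Q m\<bar>" by (intro mult_left_mono) auto
            then show ?thesis using Psi_diff[of m "snd p"] True s m01 by simp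
          next
            case False
            have "(\<bar>C\<bar> + 2) * (Q m - Q (snd p)) \<le> (\<bar>C\<bar> + 2) * \<bar>Q (snd p) - Q m\<bar>" by (intro mult_left_mono) auto
            then show ?thesis using Psi_diff[of "snd p" m] False s m01 by (simp add: abs_minus_commute)
          qed
          also have "\<dots> \<le> (\<bar>C\<bar> + 2) * w + (\<bar>C\<bar> + 2) * e"
            using s e[of "snd p" m] m01 by (intro add_mono mult_left_mono) auto
          finally show ?thesis using True by (simp add: algebra_simps abs_le_iff)
        qed (use b01[of p] in auto)
      qed
    qed
    finally have 2: "?E b * Psi m \<le> ?E (\<lambda>p. b p * Psi (snd p)) + (\<bar>C\<bar> + 2) * (w + e) * ?E b"
      by (simp add: algebra_simps)
    have "?E (\<lambda>p. b p * (fst p * P (fst p))) \<le> ?E b * Psi m + \<bar>?E (\<lambda>p. b p * (Q (snd p) - Q m))\<bar>"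
      unfolding b_def by (rule cell_ineq[OF B m01 bal[unfolded b_def]])
    then show ?thesis using 1 2 by (simp add: algebra_simps)
  qed
qed

text \<open>The errors of the cells are proportional to their masses, so they sum to the error per
  unit of mass, and uniform continuity of \<open>Q\<close> makes that arbitrarily small.\<close>

lemma ability_label_ineq:
  assumes Q: "continuous_on {0..1} Q"
  shows "(\<integral>p. fst p * P (fst p) \<partial>J) \<le> (\<integral>p. Psi (snd p) \<partial>J)"
proof (rule field_le_epsilon)
  fix eps :: real assume eps: "0 < eps"
  define C' where "C' = \<bar>C\<bar> + 2"
  \<comment> \<open>Chosen so that the error per unit of mass, \<open>e + C' * (w + e)\<close>, is
    at most \<open>eps\<close> once \<open>w \<le> e\<close>.\<close>
  define e where "e = eps / (1 + 2 * C')"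
  have C': "C' > 0" by (simp add: C'_def)
  have "e + C' * (e + e) = e * (1 + 2 * C')" by (simp add: algebra_simps)
  then have e: "e > 0" "e + C' * (e + e) = eps" using eps C' by (auto simp: e_def)
  have "uniformly_continuous_on {0..1} Q" using Q by (intro compact_uniformly_continuous) auto
  then obtain d where d: "d > 0" "\<And>x y. x \<in> {0..1} \<Longrightarrow> y \<in> {0..1} \<Longrightarrow> dist y x < d \<Longrightarrow> dist (Q y) (Q x) < e"
    using e(1) unfolding uniformly_continuous_on_def by metis
  obtain N :: nat where N: "1 / min e (d / 2) < real N" using reals_Archimedean2 by blast
  have mn: "min e (d/2) > 0" using e d by simp
  have N0: "0 < real N" using N mn by (smt (verit) divide_pos_pos)
  define w where "w = 1 / real N"
  have w: "0 < w" "w \<le> e" "w < d"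
  proof -
    have "1 / real N < x" if "0 < x" "1 / x < real N" for x using that N0 by (simp add: field_simps)
    from this[OF mn N] have "w < min e (d / 2)" by (simp add: w_def)
    then show "w \<le> e" "w < d" using d by auto
  qed (use N0 in \<open>simp add: w_def\<close>)
  define B where "B = (\<lambda>j. {real j * w..<real (Suc j) * w})"
  define b where "b = (\<lambda>j (p :: real \<times> real). indicator (B j) (snd p) :: real)"
  have bj: "bdd (b j)" for j unfolding b_def by (rule bdd_indicator_snd) (simp add: B_def)
  \<comment> \<open>The cells are half-open and \<open>real N * w = 1\<close>, so the extra cell
    with index \<open>N\<close> is there for the label 1.\<close>
  have one: "(\<Sum>j\<le>N. b j p) = 1" if "snd p \<in> {0..1}" for p
  proof -
    define j where "j = nat \<lfloor>snd p / w\<rfloor>"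
    have fl: "of_int \<lfloor>snd p / w\<rfloor> \<le> snd p / w" "snd p / w < of_int \<lfloor>snd p / w\<rfloor> + 1" by linarith+
    have jr: "real j = of_int \<lfloor>snd p / w\<rfloor>" using that w by (simp add: j_def)
    have jp: "real j * w \<le> snd p" "snd p < real (Suc j) * w" 
      using fl unfolding jr[symmetric] pos_le_divide_eq[OF w(1)] pos_divide_less_eq[OF w(1)] by (auto simp: add.commute)
    have "real j \<le> snd p / w" using fl jr by simp
    also have "\<dots> \<le> real N" using that N0 by (simp add: w_def field_simps mult_left_le)
    finally have jN: "j \<le> N" by simp
    have in_j: "snd p \<in> B j" unfolding B_def atLeastLessThan_iff using jp by blast
    have uniq: "i = j" if "snd p \<in> B i" for i
    proof -
      have "real i * w \<le> snd p" "snd p < real (Suc i) * w" using that unfolding B_def atLeastLessThan_iff by blast+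
      then have "real i * w < real (Suc j) * w" "real j * w < real (Suc i) * w" using jp by linarith+
      then have "i < Suc j" "j < Suc i" using w(1) by (simp_all only: mult_less_cancel_right_pos of_nat_less_iff)
      then show ?thesis by simp
    qed
    have "b i p = (if i = j then 1 else 0)" for i
    proof (cases "i = j")
      case True
      show ?thesis unfolding b_def True using in_j by simp
    next
      case False
      then have "snd p \<notin> B i" using uniq by blast
      then show ?thesis unfolding b_def using False by simp
    qed
    then show ?thesis using jN by simp
  qed
  note I = bdd_integrable and bi = bdd_intros bj bdd_P Psi_label_integrable
  let ?E = "\<lambda>f. \<integral>p. f p \<partial>J"
  have cell: "?E (\<lambda>p. b j p * (fst p * P (fst p))) \<le> ?E (\<lambda>p. b j p * Psi (snd p)) + eps * ?E (b j)" for j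
  proof -
    have "?E (\<lambda>p. b j p * (fst p * P (fst p))) \<le> ?E (\<lambda>p. b j p * Psi (snd p)) + (e + (\<bar>C\<bar> + 2) * (w + e)) * ?E (b j)"
      unfolding b_def
    proof (rule cell_label_ineq[where lo="real j * w"])
      show "\<bar>Q x - Q y\<bar> \<le> e" if "0 \<le> x" "x \<le> 1" "0 \<le> y" "y \<le> 1" "\<bar>x - y\<bar> \<le> w" for x y
        using d(2)[of y x] that w by (simp add: dist_real_def)
    qed (use w in \<open>auto simp: B_def algebra_simps\<close>)
    also have "(e + (\<bar>C\<bar> + 2) * (w + e)) * ?E (b j) \<le> eps * ?E (b j)"
    proof (rule mult_right_mono)
      have "C' * (w + e) \<le> C' * (e + e)" using w C' by (intro mult_left_mono) auto
      then show "e + (\<bar>C\<bar> + 2) * (w + e) \<le> eps" using e(2) by (simp add: C'_def)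
    qed (auto simp: b_def intro!: integral_nonneg_AE)
    finally show ?thesis by simp
  qed
  have sumE: "(\<Sum>j\<le>N. ?E (\<lambda>p. b j p * g p)) = ?E g" if "bdd g" for g
  proof -
    have "(\<Sum>j\<le>N. ?E (\<lambda>p. b j p * g p)) = ?E (\<lambda>p. \<Sum>j\<le>N. b j p * g p)"
      using that by (subst Bochner_Integration.integral_sum) (auto intro!: I bi)
    also have "\<dots> = ?E g"
    proof (rule integral_cong_AE)
      show "AE p in J. (\<Sum>j\<le>N. b j p * g p) = g p"
        using label_range by eventually_elim (simp add: sum_distrib_right[symmetric] one)
    qed (auto intro!: borel_measurable_integrable I bi Bochner_Integration.integrable_sum that)
    finally show ?thesis .
  qed
  have "?E (\<lambda>p. fst p * P (fst p)) = (\<Sum>j\<le>N. ?E (\<lambda>p. b j p * (fst p * P (fst p))))"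
    by (rule sumE[symmetric]) (auto intro!: bi)
  also have "\<dots> \<le> (\<Sum>j\<le>N. ?E (\<lambda>p. b j p * Psi (snd p)) + eps * ?E (b j))" by (rule sum_mono[OF cell])
  also have "\<dots> = ?E (\<lambda>p. Psi (snd p)) + eps * (\<Sum>j\<le>N. ?E (\<lambda>p. b j p * 1))"
    using sumE[OF Psi_label_integrable] by (simp add: sum.distrib sum_distrib_left)
  also have "(\<Sum>j\<le>N. ?E (\<lambda>p. b j p * 1)) = 1" using sumE[OF bdd_const, of 1] by (simp add: prob_space)
  finally show "?E (\<lambda>p. fst p * P (fst p)) \<le> ?E (\<lambda>p. Psi (snd p)) + eps" by simp
qed

end

section \<open>The certificate\<close>

text \<open>
  A rounded numerical solution, for the constant \<open>34/25\<close>, of the linear program dual to maximizing the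
  ratio under the deviation inequalities.\<close>

definition cert_rho :: "real \<Rightarrow> real" where
  "cert_rho t = (if t < 538/1000 then 569/1000 else if t < 572/1000 then 265/1000
     else if t < 612/1000 then 161/1000 else if t < 662/1000 then 83/1000
     else if t < 736/1000 then 28/1000 else 0)"

text \<open>\<open>791/1000\<close> is \<open>34/25 - 569/1000\<close>: with this value the terms in
  \<open>m\<close> on the right of \<open>lift_cost_le\<close> cancel, while a larger one would make
  that side decrease in \<open>m\<close>. From \<open>1/2\<close> on the term
  \<open>s * (1/2 - t)\<close> of \<open>cert_budget\<close> is no longer a help, so
  \<open>s\<close> is lowered towards what \<open>lift_weight_cover\<close> requires for
  \<open>m < 335/1000\<close>, about \<open>0.617\<close>.\<close>

definition cert_s :: "real \<Rightarrow> real" where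
  "cert_s t = (if t < 1/2 then 791/1000 else if t < 538/1000 then 634/1000 else 0)"

text \<open>From \<open>335/1000\<close> to \<open>736/1000\<close> the number subtracted is the sum
  of weight times knot over the knots above \<open>t\<close>, which makes
  \<open>lift_cost_le\<close> tight at \<open>m = t\<close>. Below \<open>335/1000\<close> the
  condition has to hold both at \<open>m = t\<close> and at \<open>m = 335/1000\<close>, where the
  last knot jumps; the affine function dominates both requirements. The value 1 is affordable as
  soon as \<open>34/25 * t \<ge> 1\<close>, and \<open>736/1000\<close> is \<open>25/34\<close>
  rounded up.\<close>

definition cert_v :: "real \<Rightarrow> real" where
  "cert_v t = (if t < 335/1000 then 34/25 * t - (165/1000 + 488/1000 * t)
     else if t < 538/1000 then 34/25 * t - 163897/500000
     else if t < 572/1000 then 34/25 * t - 82121/500000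
     else if t < 612/1000 then 34/25 * t - 52377/500000
     else if t < 662/1000 then 34/25 * t - 28509/500000
     else if t < 736/1000 then 34/25 * t - 322/15625 else 1)"

text \<open>The factor \<open>1095/791\<close> is \<open>(791 + 304) / 791\<close>: at
  \<open>t = m * (1095/791)\<close> the weight \<open>304/1000\<close> times \<open>m\<close> equals
  \<open>791/1000 * (t - m)\<close>. Beyond this point \<open>cert_s\<close> can pay for the missing
  lift, so a small \<open>m\<close> is lifted no further.\<close>

definition lift_knot :: "real \<Rightarrow> nat \<Rightarrow> real" where
  "lift_knot m i = (if i = 0 then 736/1000 else if i = 1 then 662/1000 else if i = 2 then 612/1000
     else if i = 3 then 572/1000 else if m < 335/1000 then m * (1095/791) else 538/1000)"

text \<open>A lift is switched off once its knot no longer exceeds \<open>m\<close>. For positive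
  \<open>t\<close> the active weights at \<open>t\<close> sum exactly to \<open>cert_rho t\<close>;
  its values 28, 83, 161, 265, 569 (in thousandths) are the partial sums.\<close>

definition lift_weight :: "real \<Rightarrow> nat \<Rightarrow> real" where
  "lift_weight m i = (if m < lift_knot m i
     then (if i = 0 then 28/1000 else if i = 1 then 55/1000 else if i = 2 then 78/1000
           else if i = 3 then 104/1000 else 304/1000) else 0)"

lemma cert_rho_range: "0 \<le> cert_rho t" "cert_rho t \<le> 1"
  by (auto simp: cert_rho_def)

lemma cert_s_range: "0 \<le> cert_s t" "cert_s t \<le> 1"
  by (auto simp: cert_s_def)

lemma cert_v_range: assumes "0 \<le> t" "t \<le> 1" shows "-1 \<le> cert_v t" "cert_v t \<le> 1"
  using assms by (auto simp: cert_v_def)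

lemma lift_weight_nonneg: "0 \<le> lift_weight m i"
  by (auto simp: lift_weight_def)

lemma lift_knot_range:
  assumes "0 < m" "m < 1" "lift_weight m i \<noteq> 0" shows "m < lift_knot m i" "lift_knot m i \<le> 1"
  using assms by (auto simp: lift_weight_def lift_knot_def split: if_splits)

lemma lift_sum5: "(\<Sum>i<5. f i) = f 0 + f 1 + f 2 + f 3 + f (4::nat)" for f :: "nat \<Rightarrow> real"
  by (simp add: eval_nat_numeral)

text \<open>All fixed breakpoints of the certificate. Once \<open>m\<close> and \<open>t\<close> are
  confined to pieces, the conditions on the lifts are affine in both, which leaves linear
  arithmetic.\<close>

lemma cert_cases:
  fixes t :: real
  obtains (1) "t < 335/1000" | (2) "335/1000 \<le> t" "t < 1/2" | (3) "1/2 \<le> t" "t < 538/1000"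
    | (4) "538/1000 \<le> t" "t < 572/1000" | (5) "572/1000 \<le> t" "t < 612/1000" | (6) "612/1000 \<le> t" "t < 662/1000"
    | (7) "662/1000 \<le> t" "t < 736/1000" | (8) "736/1000 \<le> t"
  by linarith

lemmas cert_defs = lift_weight_def lift_knot_def cert_rho_def cert_s_def cert_v_def

lemma lift_weight_sum_le:
  assumes "0 < m" "m < 1" "t \<le> m"
  shows "(\<Sum>i<5. lift_weight m i) \<le> cert_rho t"
  using assms unfolding lift_sum5
  by (cases m rule: cert_cases; cases t rule: cert_cases; simp add: cert_defs)

lemma lift_weight_cover:
  assumes "0 < m" "m < t" "t \<le> 1"
  shows "(cert_rho t - (\<Sum>i<5. if t \<le> lift_knot m i then lift_weight m i else 0)) * m \<le> cert_s t * (t - m)"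
  using assms unfolding lift_sum5
  by (cases m rule: cert_cases; cases t rule: cert_cases; simp add: cert_defs)

lemma lift_cost_le:
  assumes "0 < m" "m < 1" "0 \<le> t" "t \<le> m"
  shows "(\<Sum>i<5. lift_weight m i * (lift_knot m i - m))
    \<le> 34/25 * m - cert_v t - cert_s t * (m - t) - m * cert_rho t"
  using assms unfolding lift_sum5
  by (cases m rule: cert_cases; cases t rule: cert_cases; simp add: cert_defs field_simps)

text \<open>A concave quadratic exceeds its chord, here by
  \<open>a * ((t - lo) * (hi - t))\<close>.\<close>

lemma concave_quadratic_nonneg:
  fixes a b c lo hi t :: real
  assumes "lo \<le> t" "t \<le> hi" "a \<ge> 0" "c + b * lo - a * lo\<^sup>2 \<ge> 0" "c + b * hi - a * hi\<^sup>2 \<ge> 0"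
  shows "c + b * t - a * t\<^sup>2 \<ge> 0"
proof (cases "lo = hi")
  case False
  then have d: "hi - lo > 0" using assms by simp
  have "(hi - lo) * (c + b * t - a * t\<^sup>2) = (hi - t) * (c + b * lo - a * lo\<^sup>2)
     + (t - lo) * (c + b * hi - a * hi\<^sup>2) + a * ((hi - lo) * ((t - lo) * (hi - t)))"
    by (simp add: power2_eq_square algebra_simps)
  also have "\<dots> \<ge> 0" using assms d by (intro add_nonneg_nonneg mult_nonneg_nonneg) auto
  finally show ?thesis using d by (simp add: zero_le_mult_iff)
qed (use assms in auto)

text \<open>On each piece \<open>cert_rho\<close> and \<open>cert_s\<close> are constant and
  \<open>cert_v\<close> is \<open>34/25 * t - (A + B * t)\<close>, so the right side minus the left
  is a concave quadratic in \<open>t\<close>, and its two values at the ends of the piece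
  decide.\<close>

lemma cert_budget:
  assumes "0 \<le> t" "t \<le> 1"
  shows "(1 - cert_v t)\<^sup>2 / 2 \<le> cert_rho t * (1 - t\<^sup>2) / 2 + cert_s t * (1/2 - t)"
proof -
  have *: "(1 - (34/25 * t - (A + B * t)))\<^sup>2 / 2 \<le> r * (1 - t\<^sup>2) / 2 + s * (1/2 - t)"
    if "lo \<le> t" "t \<le> hi" "r \<ge> 0"
      "(r/2 + s/2 - (1 + A)\<^sup>2/2) + (- s - (1 + A) * (B - 34/25)) * lo - (r/2 + (B - 34/25)\<^sup>2/2) * lo\<^sup>2 \<ge> 0"
      "(r/2 + s/2 - (1 + A)\<^sup>2/2) + (- s - (1 + A) * (B - 34/25)) * hi - (r/2 + (B - 34/25)\<^sup>2/2) * hi\<^sup>2 \<ge> 0"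
    for A B r s lo hi :: real
  proof -
    have "0 \<le> r/2 + (B - 34/25)\<^sup>2/2" using that(3) by simp
    from concave_quadratic_nonneg[OF that(1,2) this that(4,5)] show ?thesis
      by (simp add: power2_eq_square field_simps)
  qed
  show ?thesis
  proof (cases t rule: cert_cases)
    case 1 then show ?thesis using assms *[of 0 "335/1000" "569/1000" "791/1000" "165/1000" "488/1000"]
      by (simp add: cert_v_def cert_rho_def cert_s_def power2_eq_square)
  next
    case 2 then show ?thesis using assms *[of "335/1000" "1/2" "569/1000" "791/1000" "163897/500000" 0]
      by (simp add: cert_v_def cert_rho_def cert_s_def power2_eq_square)
  next
    case 3 then show ?thesis using assms *[of "1/2" "538/1000" "569/1000" "634/1000" "163897/500000" 0]
      by (simp add: cert_v_def cert_rho_def cert_s_def power2_eq_square)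
  next
    case 4 then show ?thesis using assms *[of "538/1000" "572/1000" "265/1000" 0 "82121/500000" 0]
      by (simp add: cert_v_def cert_rho_def cert_s_def power2_eq_square)
  next
    case 5 then show ?thesis using assms *[of "572/1000" "612/1000" "161/1000" 0 "52377/500000" 0]
      by (simp add: cert_v_def cert_rho_def cert_s_def power2_eq_square)
  next
    case 6 then show ?thesis using assms *[of "612/1000" "662/1000" "83/1000" 0 "28509/500000" 0]
      by (simp add: cert_v_def cert_rho_def cert_s_def power2_eq_square)
  next
    case 7 then show ?thesis using assms *[of "662/1000" "736/1000" "28/1000" 0 "322/15625" 0]
      by (simp add: cert_v_def cert_rho_def cert_s_def power2_eq_square)
  next
    case 8 then show ?thesis by (simp add: cert_v_def cert_rho_def cert_s_def)
  qed
qed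

lemma cert_slack:
  assumes "0 \<le> t" "t \<le> m" "m \<le> 1"
  shows "0 \<le> 34/25 * m - cert_v t - cert_s t * (m - t) - m * cert_rho t"
  using assms by (cases t rule: cert_cases; simp add: cert_defs field_simps)

section \<open>The job market\<close>

locale job_market =
  fixes mu mu' :: "real \<Rightarrow> real"
  assumes dens_int: "mu' integrable_on {0..1}"
    and dens_pos: "\<And>x. x \<in> {0..1} \<Longrightarrow> mu' x > 0"
    and mu_cdf: "\<And>x. x \<in> {0..1} \<Longrightarrow> mu x = integral {0..x} mu'"
    and mu_one: "mu 1 = 1"
begin

lemma mu_zero: "mu 0 = 0" using mu_cdf[of 0] by simp

lemma density_abs_int: "mu' absolutely_integrable_on {0..1}"
  using dens_int dens_pos by (intro nonnegative_absolutely_integrable_1) (auto intro: less_imp_le)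

lemma mu_diff: assumes "0 \<le> x" "x \<le> y" "y \<le> 1" shows "mu y - mu x = integral {x..y} mu'"
proof -
  have "mu' integrable_on {0..y}" by (rule integrable_on_subinterval[OF dens_int]) (use assms in auto)
  then have "integral {0..x} mu' + integral {x..y} mu' = integral {0..y} mu'"
    using assms by (intro Henstock_Kurzweil_Integration.integral_combine) auto
  then show ?thesis using assms by (simp add: mu_cdf)
qed

lemma mu_strict_mono: assumes "0 \<le> x" "x < y" "y \<le> 1" shows "mu x < mu y"
proof -
  have s: "{x..y} \<subseteq> {0..1}" using assms by auto
  have ai: "mu' absolutely_integrable_on {x..y}"
    by (rule set_integrable_subset[OF density_abs_int]) (use s in auto)
  have nn: "0 \<le> integral {x..y} mu'"
    by (rule Henstock_Kurzweil_Integration.integral_nonneg)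
       (use ai s dens_pos in \<open>auto simp: set_lebesgue_integral_eq_integral(1) intro: less_imp_le\<close>)
  have "integral {x..y} mu' \<noteq> 0"
  proof
    assume "integral {x..y} mu' = 0"
    then have "(\<integral>t. indicator {x..y} t *\<^sub>R mu' t \<partial>lebesgue) = 0"
      using set_lebesgue_integral_eq_integral(2)[OF ai] by (simp add: set_lebesgue_integral_def)
    moreover have "AE t in lebesgue. 0 \<le> indicator {x..y} t *\<^sub>R mu' t"
      by (rule AE_I2) (use s dens_pos in \<open>auto simp: indicator_def less_imp_le subset_eq\<close>)
    ultimately have "AE t in lebesgue. indicator {x..y} t *\<^sub>R mu' t = 0"
      using ai by (subst (asm) integral_nonneg_eq_0_iff_AE) (auto simp: set_integrable_def)
    then have "AE t in lebesgue. t \<notin> {x..y}"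
      by eventually_elim (use s dens_pos in \<open>force simp: indicator_def subset_eq split: if_splits\<close>)
    then have "{x..y} \<in> null_sets lebesgue" by (subst AE_iff_null_sets) auto
    then have "emeasure lebesgue {x..y} = 0" by auto
    then show False using assms by simp
  qed
  then show ?thesis using nn mu_diff[of x y] assms by simp
qed

lemma mu_continuous: "continuous_on {0..1} mu"
proof -
  have "continuous_on {0..1} (\<lambda>x. integral {0..x} mu')" by (rule indefinite_integral_continuous_1[OF dens_int])
  then show ?thesis by (rule continuous_on_eq) (simp add: mu_cdf)
qed

lemma mu_range: assumes "q \<in> {0..1}" shows "mu q \<in> {0..1}"
proof -
  have "mu 0 \<le> mu q" using mu_strict_mono[of 0 q] assms by (cases "q = 0") auto
  moreover have "mu q \<le> mu 1" using mu_strict_mono[of q 1] assms by (cases "q = 1") auto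
  ultimately show ?thesis by (simp add: mu_zero mu_one)
qed

lemma QT_props: assumes "a \<in> {0..1}" shows "QT mu a \<in> {0..1}" "mu (QT mu a) = a"
proof -
  have "\<exists>q. 0 \<le> q \<and> q \<le> 1 \<and> mu q = a"
    by (rule IVT'[of mu 0 a 1]) (use assms mu_continuous in \<open>auto simp: mu_zero mu_one\<close>)
  then obtain q where q: "q \<in> {0..1} \<and> mu q = a" by auto
  have "\<exists>!q. q \<in> {0..1} \<and> mu q = a"
  proof (rule ex1I[of _ q])
    show "q \<in> {0..1} \<and> mu q = a" by (rule q)
    fix r assume r: "r \<in> {0..1} \<and> mu r = a"
    then show "r = q" using q mu_strict_mono[of r q] mu_strict_mono[of q r] by (cases r q rule: linorder_cases) auto
  qed
  from theI'[OF this] show "QT mu a \<in> {0..1}" "mu (QT mu a) = a" unfolding QT_def by auto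
qed

lemma QT_mu: assumes "q \<in> {0..1}" shows "QT mu (mu q) = q"
proof -
  have "QT mu (mu q) \<in> {0..1}" "mu (QT mu (mu q)) = mu q" using QT_props[OF mu_range[OF assms]] by auto
  then show ?thesis using assms mu_strict_mono[of q "QT mu (mu q)"] mu_strict_mono[of "QT mu (mu q)" q]
    by (cases q "QT mu (mu q)" rule: linorder_cases) auto
qed

lemma QT_zero: "QT mu 0 = 0" and QT_one: "QT mu 1 = 1"
  using QT_mu[of 0] QT_mu[of 1] by (auto simp: mu_zero mu_one)

lemma QT_strict_mono: assumes "0 \<le> x" "x < y" "y \<le> 1" shows "QT mu x < QT mu y"
proof (rule ccontr)
  assume "\<not> ?thesis"
  then have "QT mu y \<le> QT mu x" by simp
  then have "mu (QT mu y) \<le> mu (QT mu x)"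
    using mu_strict_mono[of "QT mu y" "QT mu x"] QT_props(1)[of x] QT_props(1)[of y] assms
    by (cases "QT mu y = QT mu x") auto
  then show False using QT_props(2)[of x] QT_props(2)[of y] assms by auto
qed

lemma QT_mono: "0 \<le> x \<Longrightarrow> x \<le> y \<Longrightarrow> y \<le> 1 \<Longrightarrow> QT mu x \<le> QT mu y"
  using QT_strict_mono[of x y] by (cases "x = y") auto

lemma QT_continuous: "continuous_on {0..1} (QT mu)"
proof -
  have "mu ` {0..1} = {0..1}"
    using mu_range QT_props by (auto simp: image_iff) (metis atLeastAtMost_iff)
  moreover have "continuous_on (mu ` {0..1}) (QT mu)"
    by (rule continuous_on_inv[OF mu_continuous]) (auto simp: QT_mu)
  ultimately show ?thesis by simp
qed

text \<open>No quality has such a rank, so the description has the same unsatisfiable condition for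
  all these arguments; being constant there, \<open>QT mu\<close> is Borel on the whole
  line.\<close>

lemma QT_outside: "a \<notin> {0..1} \<Longrightarrow> QT mu a = (THE q. False)"
  unfolding QT_def using mu_range by (intro arg_cong[where f=The]) (auto simp: fun_eq_iff)

lemma QT_measurable [measurable]: "QT mu \<in> borel_measurable borel"
proof -
  have [measurable]: "(\<lambda>u. indicator {0..1} u * QT mu u) \<in> borel_measurable borel"
    using borel_measurable_continuous_on_indicator[OF _ QT_continuous] by simp
  have "QT mu = (\<lambda>u. indicator {0..1} u * QT mu u + indicator (- {0..1}) u * (THE q. False))"
    using QT_outside by (auto simp: fun_eq_iff indicator_def)
  then show ?thesis by (rule ssubst) measurable
qed

text \<open>The law with density \<open>mu'\<close> is carried to the uniform law by its own
  distribution function \<open>mu\<close>, and \<open>QT mu\<close> recovers the quality from the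
  rank.\<close>

lemma change_of_variable:
  assumes f[measurable]: "f \<in> borel_measurable borel" and fb: "\<And>u. \<bar>f u\<bar> \<le> B"
  shows "integral {0..1} (\<lambda>q. q * f (mu q) * mu' q) = (\<integral>u. QT mu u * f u \<partial>unif01)"
proof -
  define d where "d = (\<lambda>q. indicator {0..1} q * mu' q)"
  have d: "integrable lebesgue d" using density_abs_int by (simp add: d_def set_integrable_def)
  have dm[measurable]: "d \<in> borel_measurable lebesgue" using d by simp
  have d0: "0 \<le> d q" for q using dens_pos[of q] by (auto simp: d_def indicator_def)
  \<comment> \<open>Over \<open>lebesgue\<close>, because integrability of \<open>mu'\<close> in the
    gauge sense yields Lebesgue but not Borel measurability.\<close>
  define nu where "nu = density lebesgue d"
  define mb where "mb = (\<lambda>q. indicator {0..1} q * mu q)"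
  have "mb \<in> borel_measurable borel"
    using borel_measurable_continuous_on_indicator[OF _ mu_continuous] by (simp add: mb_def)
  then have "mb \<in> borel_measurable lborel" by simp
  then have mb: "mb \<in> borel_measurable lebesgue" by (rule measurable_completion)
  have dme: "(\<lambda>q. ennreal (d q)) \<in> borel_measurable lebesgue" by measurable
  then have mbm[measurable]: "mb \<in> borel_measurable nu" using mb by (simp add: nu_def)
  have meas: "measure nu {0..x} = mu x" "emeasure nu {0..x} = ennreal (mu x)" if "x \<in> {0..1}" for x
  proof -
    have s: "{0..x} \<subseteq> {0..1}" using that by auto
    have ai: "mu' absolutely_integrable_on {0..x}" by (rule set_integrable_subset[OF density_abs_int]) (use s in auto)
    have "emeasure nu {0..x} = (\<integral>\<^sup>+q. ennreal (indicator {0..x} q *\<^sub>R mu' q) \<partial>lebesgue)"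
      unfolding nu_def by (simp add: emeasure_density[OF dme])
        (use s in \<open>auto simp: d_def indicator_def intro!: nn_integral_cong\<close>)
    also have "\<dots> = ennreal (\<integral>q. indicator {0..x} q *\<^sub>R mu' q \<partial>lebesgue)"
      by (rule nn_integral_eq_integral) (use ai s dens_pos in \<open>auto simp: set_integrable_def indicator_def less_imp_le subset_eq\<close>)
    also have "(\<integral>q. indicator {0..x} q *\<^sub>R mu' q \<partial>lebesgue) = mu x"
      using set_lebesgue_integral_eq_integral(2)[OF ai] that by (simp add: set_lebesgue_integral_def mu_cdf)
    finally show "emeasure nu {0..x} = ennreal (mu x)" .
    then show "measure nu {0..x} = mu x" using mu_range[OF that] by (simp add: measure_def)
  qed
  have AEnu: "AE q in nu. q \<in> {0..1}"
    unfolding nu_def AE_density[OF dme] by (auto simp: d_def indicator_def)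
  have snu: "sets nu = sets lebesgue" "space nu = UNIV" by (auto simp: nu_def)
  have pn: "prob_space nu"
  proof
    have "emeasure nu (space nu) = emeasure nu {0..1}"
      by (rule emeasure_eq_AE) (use AEnu in \<open>auto simp: snu elim!: eventually_mono\<close>)
    then show "emeasure nu (space nu) = 1" using meas(2)[of 1] by (simp add: mu_one)
  qed
  interpret nu: prob_space nu by (rule pn)
  have du: "distr nu borel mb = unif01"
  proof (rule real_distribution_eq_unif01)
    show "real_distribution (distr nu borel mb)"
      by (intro real_distribution.intro real_distribution_axioms.intro nu.prob_space_distr) auto
    show "AE x in distr nu borel mb. x \<in> {0..1}"
    proof (subst AE_distr_iff[OF mbm])
      show "AE q in nu. mb q \<in> {0..1}"
        using AEnu by eventually_elim (use mu_range in \<open>auto simp: mb_def\<close>)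
    qed simp
    fix x :: real assume x: "x \<in> {0..1}"
    have "measure (distr nu borel mb) {..x} = measure nu {q. mb q \<le> x}"
      by (subst measure_distr) (auto simp: snu vimage_def)
    also have "\<dots> = measure nu {0..QT mu x}"
    proof (rule nu.finite_measure_eq_AE)
      show "AE q in nu. (q \<in> {q. mb q \<le> x}) = (q \<in> {0..QT mu x})"
        using AEnu
      proof eventually_elim
        case (elim q)
        have "mu q \<le> x \<longleftrightarrow> q \<le> QT mu x"
          using elim QT_props[OF x] mu_strict_mono[of q "QT mu x"] mu_strict_mono[of "QT mu x" q]
          by (cases q "QT mu x" rule: linorder_cases) auto
        then show ?case using elim by (simp add: mb_def)
      qed
      show "{q. mb q \<le> x} \<in> sets nu" using measurable_sets[OF mbm, of "{..x}"] by (simp add: vimage_def snu)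
    qed (simp add: snu)
    also have "\<dots> = x" using meas(1)[OF QT_props(1)[OF x]] QT_props(2)[OF x] by simp
    finally show "measure (distr nu borel mb) {..x} = x" .
  qed
  have "(\<integral>u. QT mu u * f u \<partial>unif01) = (\<integral>q. QT mu (mb q) * f (mb q) \<partial>nu)"
    unfolding du[symmetric] by (subst integral_distr) auto
  also have "\<dots> = (\<integral>q. d q * (QT mu (mb q) * f (mb q)) \<partial>lebesgue)"
    unfolding nu_def using d0 mb by (subst integral_real_density) auto
  also have "\<dots> = (LINT q:{0..1}|lebesgue. q * f (mu q) * mu' q)"
    unfolding set_lebesgue_integral_def
    by (rule Bochner_Integration.integral_cong) (auto simp: d_def mb_def indicator_def QT_mu mu_range[simplified])
  also have "\<dots> = integral {0..1} (\<lambda>q. q * f (mu q) * mu' q)"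
  proof (rule set_lebesgue_integral_eq_integral(2))
    have "integrable nu (\<lambda>q. QT mu (mb q) * f (mb q))"
    proof (rule nu.integrable_const_bound[where B=B])
      show "AE q in nu. norm (QT mu (mb q) * f (mb q)) \<le> B"
        using AEnu
      proof eventually_elim
        case (elim q)
        have "\<bar>QT mu (mb q) * f (mb q)\<bar> \<le> 1 * B"
          unfolding abs_mult using fb elim by (intro mult_mono) (auto simp: mb_def QT_mu)
        then show ?case by simp
      qed
    qed measurable
    then have "integrable lebesgue (\<lambda>q. d q * (QT mu (mb q) * f (mb q)))"
      unfolding nu_def using d0 mb by (subst (asm) integrable_real_density) auto
    then show "set_integrable lebesgue {0..1} (\<lambda>q. q * f (mu q) * mu' q)"
      unfolding set_integrable_def
      by (rule Bochner_Integration.integrable_cong[THEN iffD1, rotated -1])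
         (auto simp: d_def mb_def indicator_def QT_mu mu_range[simplified])
  qed
  finally show ?thesis by simp
qed

lemma QT_integrable: "0 \<le> a \<Longrightarrow> b \<le> 1 \<Longrightarrow> QT mu integrable_on {a..b}"
  by (rule integrable_continuous_real, rule continuous_on_subset[OF QT_continuous]) auto

text \<open>The strict upper bound is what turns an atom of labels into a genuine jump of the
  desirability; it comes from the left half of the interval, where \<open>QT mu\<close> stays below
  its value at the midpoint.\<close>

lemma QT_average:
  assumes "0 \<le> a" "a < b" "b \<le> 1"
  shows "QT mu a \<le> integral {a..b} (QT mu) / (b - a)" "integral {a..b} (QT mu) / (b - a) < QT mu b"
proof -
  have upper: "integral {x..y} (QT mu) \<le> (y - x) * QT mu y" if "0 \<le> x" "x \<le> y" "y \<le> 1" for x y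
  proof -
    have "integral {x..y} (QT mu) \<le> integral {x..y} (\<lambda>_. QT mu y)"
      using that by (intro integral_le QT_integrable) (auto intro: QT_mono)
    then show ?thesis using that by simp
  qed
  have "integral {a..b} (\<lambda>_. QT mu a) \<le> integral {a..b} (QT mu)"
    using assms by (intro integral_le QT_integrable) (auto intro: QT_mono)
  then show "QT mu a \<le> integral {a..b} (QT mu) / (b - a)" using assms by (simp add: field_simps)
  define c where "c = (a + b) / 2"
  have c: "a < c" "c < b" using assms by (auto simp: c_def)
  have "integral {a..c} (QT mu) + integral {c..b} (QT mu) = integral {a..b} (QT mu)"
    using assms c by (intro Henstock_Kurzweil_Integration.integral_combine QT_integrable) auto
  moreover have "integral {a..c} (QT mu) \<le> (c - a) * QT mu c" "integral {c..b} (QT mu) \<le> (b - c) * QT mu b"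
    using assms c by (auto intro: upper)
  moreover have "(c - a) * QT mu c < (c - a) * QT mu b"
    using assms c by (intro mult_strict_left_mono QT_strict_mono) auto
  ultimately have "integral {a..b} (QT mu) < (c - a) * QT mu b + (b - c) * QT mu b" by linarith
  also have "\<dots> = (b - a) * QT mu b" by (simp add: algebra_simps)
  finally show "integral {a..b} (QT mu) / (b - a) < QT mu b" using assms by (simp add: field_simps)
qed

end

section \<open>Labels without atoms: ranks, quantiles and the law of the thresholds\<close>

locale label_market = job_market mu mu' for mu mu' +
  fixes L :: "real measure"
  assumes L_dist: "real_distribution L" and L_range: "AE l in L. l \<in> {0..1}"
    and L_atomless: "\<And>l. measure L {l} = 0"
begin

sublocale L: real_distribution L by (rule L_dist)

definition "G = cdf L"
definition "Q l = QT mu (G l)"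
definition "D = interval_measure Q"
definition "lam u = Inf {x \<in> {0..1}. u \<le> G x}"

lemma G_continuous: "continuous_on A G"
  unfolding G_def using L.isCont_cdf L_atomless by (intro continuous_at_imp_continuous_on) auto

lemma G_mono: "x \<le> y \<Longrightarrow> G x \<le> G y"
  unfolding G_def by (rule L.cdf_nondecreasing)

lemma G_range: "G x \<in> {0..1}"
  unfolding G_def using L.cdf_nonneg L.cdf_bounded_prob by auto

lemma G_one: assumes "1 \<le> x" shows "G x = 1"
proof -
  have "AE l in L. l \<in> {..x}" using L_range by eventually_elim (use assms in auto)
  then show ?thesis unfolding G_def cdf_def by (subst L.prob_eq_1) auto
qed

lemma G_zero: assumes "x \<le> 0" shows "G x = 0"
proof -
  have "measure L {..0} = measure L {0}"
    by (rule real_distribution_measure_eq[OF L_dist]) (use L_range in \<open>auto elim!: eventually_mono\<close>)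
  then have "G 0 = 0" by (simp add: G_def cdf_def L_atomless)
  then show ?thesis using G_mono[OF assms] G_range[of x] by auto
qed

lemma G_measurable [measurable]: "G \<in> borel_measurable borel"
  by (rule borel_measurable_continuous_onI[OF G_continuous])

lemma Q_continuous: "continuous_on A Q"
  unfolding Q_def by (rule continuous_on_compose2[OF QT_continuous G_continuous]) (use G_range in auto)

lemma Q_measurable [measurable]: "Q \<in> borel_measurable borel"
  by (rule borel_measurable_continuous_onI[OF Q_continuous])

lemma Q_mono: "x \<le> y \<Longrightarrow> Q x \<le> Q y"
  unfolding Q_def using G_mono[of x y] G_range[of x] G_range[of y] by (intro QT_mono) auto

lemma Q_range: "0 \<le> Q x" "Q x \<le> 1"
  using QT_props(1)[OF G_range[of x]] by (auto simp: Q_def)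

lemma Q_limits: "(Q \<longlongrightarrow> 0) at_bot" "(Q \<longlongrightarrow> 1) at_top"
proof -
  have "eventually (\<lambda>x. Q x = 0) at_bot" "eventually (\<lambda>x. Q x = 1) at_top"
    by (rule eventually_mono[OF eventually_le_at_bot[of 0]], simp add: Q_def G_zero QT_zero)
       (rule eventually_mono[OF eventually_ge_at_top[of 1]], simp add: Q_def G_one QT_one)
  then show "(Q \<longlongrightarrow> 0) at_bot" "(Q \<longlongrightarrow> 1) at_top" by (auto intro: tendsto_eventually)
qed

lemma Q_right_continuous: "continuous (at_right a) Q"
  by (rule continuous_at_imp_continuous_at_within) (use Q_continuous[of UNIV] in \<open>simp add: continuous_on_eq_continuous_at\<close>)

lemma D_dist: "real_distribution D"
  unfolding D_def by (rule real_distribution_interval_measure[OF Q_mono Q_right_continuous Q_limits])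

sublocale D: real_distribution D by (rule D_dist)

lemma measure_D: "measure D {..x} = Q x"
  unfolding D_def by (rule measure_interval_measure_Iic[OF Q_mono Q_right_continuous Q_limits(1)])

lemma D_range: "AE t in D. t \<in> {0..1}"
proof -
  have 0: "measure D {..0} = 0" and 1: "measure D {..1} = 1"
    by (auto simp: measure_D Q_def G_zero G_one QT_zero QT_one)
  have "AE t in D. t \<notin> {..0}" using D.prob_eq_0[of "{..0}"] 0 by simp
  moreover have "AE t in D. t \<in> {..1}" using D.prob_eq_1[of "{..1}"] 1 by simp
  ultimately show ?thesis by eventually_elim auto
qed

lemma lam_mem: assumes "u \<in> {0..1}" shows "lam u \<in> {0..1}" "u \<le> G (lam u)"
proof -
  let ?S = "{x \<in> {0..1}. u \<le> G x}"
  have ne: "1 \<in> ?S" using assms G_one by auto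
  have "closed ({0..1} \<inter> {x. u \<le> G x})"
    by (intro closed_Int closed_Collect_le G_continuous continuous_intros)
  moreover have "{0..1} \<inter> {x. u \<le> G x} = ?S" by auto
  ultimately have cl: "closed ?S" by simp
  have bb: "bdd_below ?S" by (rule bdd_belowI[of _ 0]) auto
  have "lam u \<in> ?S" unfolding lam_def by (rule closed_contains_Inf[OF _ bb cl]) (use ne in blast)
  then show "lam u \<in> {0..1}" "u \<le> G (lam u)" by auto
qed

lemma lam_le_iff: assumes "u \<in> {0..1}" "x \<in> {0..1}" shows "lam u \<le> x \<longleftrightarrow> u \<le> G x"
proof
  assume "lam u \<le> x" then show "u \<le> G x" using lam_mem[OF assms(1)] G_mono[of "lam u" x] by linarith
next
  assume "u \<le> G x" then show "lam u \<le> x" unfolding lam_def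
    using assms by (intro cInf_lower bdd_belowI[of _ 0]) auto
qed

lemma G_lam: assumes "u \<in> {0..1}" shows "G (lam u) = u"
proof -
  have "\<exists>x. 0 \<le> x \<and> x \<le> 1 \<and> G x = u"
    by (rule IVT'[of G 0 u 1]) (use assms G_continuous in \<open>auto simp: G_zero G_one\<close>)
  then obtain x where x: "x \<in> {0..1}" "G x = u" by auto
  then have "lam u \<le> x" using lam_le_iff[OF assms x(1)] by simp
  then show ?thesis using G_mono[of "lam u" x] lam_mem(2)[OF assms] x by simp
qed

text \<open>With a clamped argument the quantile function is monotone on the whole line, hence
  Borel.\<close>

definition "lam01 u = lam (max 0 (min 1 u))"

lemma lam01: "u \<in> {0..1} \<Longrightarrow> lam01 u = lam u" "lam01 u \<in> {0..1}"
  using lam_mem(1)[of "max 0 (min 1 u)"] by (auto simp: lam01_def)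

lemma lam01_measurable [measurable]: "lam01 \<in> borel_measurable borel"
proof (rule borel_measurable_mono, rule monoI)
  fix x y :: real assume "x \<le> y"
  let ?x = "max 0 (min 1 x)" and ?y = "max 0 (min 1 y)"
  have c: "?x \<in> {0..1}" "?y \<in> {0..1}" "?x \<le> ?y" using \<open>x \<le> y\<close> by auto
  then have "?x \<le> G (lam ?y)" using lam_mem(2)[OF c(2)] c(3) by linarith
  then show "lam01 x \<le> lam01 y"
    unfolding lam01_def using lam_le_iff[OF c(1) lam_mem(1)[OF c(2)]] by simp
qed

lemma distr_lam01: "distr unif01 borel lam01 = L"
proof (rule cdf_unique[OF _ L_dist], rule U.real_distribution_distr)
  show "lam01 \<in> borel_measurable unif01" by simp
  show "cdf (distr unif01 borel lam01) = cdf L"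
  proof
    fix x
    have "cdf (distr unif01 borel lam01) x = measure unif01 {u. lam01 u \<le> x}"
      unfolding cdf_def by (subst measure_distr) (auto simp: vimage_def)
    also have "\<dots> = measure unif01 {..G x}"
    proof (rule real_distribution_measure_eq[OF real_distribution_unif01])
      \<comment> \<open>At \<open>u = 0\<close> the equivalence fails for negative \<open>x\<close>:
        \<open>lam01 0\<close> exceeds \<open>x\<close> although \<open>0 \<le> G x\<close>.\<close>
      have "AE u in unif01. u \<noteq> 0"
      proof -
        have "measure unif01 {0} = 0" by (simp add: unif01_def measure_def emeasure_uniform_measure)
        then have "AE u in unif01. u \<notin> {0}" by (subst U.prob_eq_0[symmetric]) auto
        then show ?thesis by simp
      qed
      then show "AE u in unif01. (u \<in> {u. lam01 u \<le> x}) = (u \<in> {..G x})"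
        using unif01_range
      proof eventually_elim
        case (elim u)
        consider "x < 0" | "x \<in> {0..1}" | "1 < x" by fastforce
        then show ?case
        proof cases
          case 1 then show ?thesis using lam01(2)[of u] G_zero[of x] elim by auto
        next
          case 2 then show ?thesis using lam_le_iff[OF elim(2) 2] elim by (simp add: lam01(1))
        next
          case 3 then show ?thesis using lam01(2)[of u] G_one[of x] elim by auto
        qed
      qed
    qed measurable
    also have "\<dots> = cdf L x"
      using cdf_unif01[of "G x"] G_range[of x] by (auto simp: cdf_def G_def)
    finally show "cdf (distr unif01 borel lam01) x = cdf L x" .
  qed
qed

lemma integral_L:
  fixes f :: "real \<Rightarrow> real"
  assumes [measurable]: "f \<in> borel_measurable borel"
  shows "(\<integral>l. f l \<partial>L) = (\<integral>u. f (lam01 u) \<partial>unif01)"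
proof -
  have "(\<integral>l. f l \<partial>distr unif01 borel lam01) = (\<integral>u. f (lam01 u) \<partial>unif01)" by (subst integral_distr) auto
  then show ?thesis by (simp only: distr_lam01)
qed

lemma integral_cdf_jobs: "integral {0..1} (\<lambda>q. q * mu q * mu' q) = (\<integral>l. Q l * G l \<partial>L)"
proof -
  define f where "f u = max 0 (min 1 u)" for u :: real
  have [measurable]: "f \<in> borel_measurable borel" unfolding f_def by measurable
  have "integral {0..1} (\<lambda>q. q * mu q * mu' q) = integral {0..1} (\<lambda>q. q * f (mu q) * mu' q)"
    by (rule integral_cong) (use mu_range in \<open>auto simp: f_def\<close>)
  also have "\<dots> = (\<integral>u. QT mu u * f u \<partial>unif01)" by (rule change_of_variable[where B=1]) (auto simp: f_def)
  also have "\<dots> = (\<integral>u. Q (lam01 u) * G (lam01 u) \<partial>unif01)"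
  proof (rule integral_cong_AE)
    show "AE u in unif01. QT mu u * f u = Q (lam01 u) * G (lam01 u)"
      using unif01_range by eventually_elim (simp add: lam01(1) G_lam Q_def f_def)
  qed measurable
  finally show ?thesis by (simp add: integral_L)
qed

lemma integral_label_jobs: "integral {0..1} (\<lambda>q. q * lam (mu q) * mu' q) = (\<integral>l. Q l * l \<partial>L)"
proof -
  have "integral {0..1} (\<lambda>q. q * lam (mu q) * mu' q) = integral {0..1} (\<lambda>q. q * lam01 (mu q) * mu' q)"
    by (rule integral_cong) (simp add: lam01(1)[OF mu_range])
  also have "\<dots> = (\<integral>u. QT mu u * lam01 u \<partial>unif01)"
    by (rule change_of_variable[where B=1]) (use lam01(2) in \<open>auto simp: abs_le_iff intro: order_trans[of _ 0]\<close>)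
  also have "\<dots> = (\<integral>u. Q (lam01 u) * lam01 u \<partial>unif01)"
  proof (rule integral_cong_AE)
    show "AE u in unif01. QT mu u * lam01 u = Q (lam01 u) * lam01 u"
      using unif01_range by eventually_elim (simp add: lam01(1) G_lam Q_def)
  qed measurable
  finally show ?thesis by (simp add: integral_L)
qed

text \<open>For \<open>l \<ge> t\<close> the rank is at most \<open>v\<close> plus its excess over
  \<open>v\<close>, and the mean excess of a uniform rank over all labels is known. The cut
  \<open>v\<close> is free and may depend on \<open>t\<close>.\<close>

lemma rank_tail_le:
  assumes "v \<le> 1"
  shows "(\<integral>l. (if t \<le> l then G l else 0) \<partial>L) \<le> (1 - v)\<^sup>2 / 2 + (\<integral>l. (if t \<le> l then v else 0) \<partial>L)"
proof -
  have i1: "integrable L (\<lambda>l. max 0 (G l - v))"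
  proof (rule L.integrable_const_bound[where B="1 + \<bar>v\<bar>"], rule AE_I2)
    show "norm (max 0 (G l - v)) \<le> 1 + \<bar>v\<bar>" for l using G_range[of l] by auto
  qed measurable
  have i2: "integrable L (\<lambda>l. if t \<le> l then v else 0)"
    by (rule L.integrable_const_bound[where B="\<bar>v\<bar>"]) auto
  have "(\<integral>l. (if t \<le> l then G l else 0) \<partial>L) \<le> (\<integral>l. max 0 (G l - v) + (if t \<le> l then v else 0) \<partial>L)"
  proof (rule integral_mono)
    show "integrable L (\<lambda>l. if t \<le> l then G l else 0)"
      by (rule L.integrable_const_bound[where B=1]) (use G_range in \<open>auto intro!: AE_I2\<close>)
  qed (use i1 i2 in auto)
  also have "\<dots> = (\<integral>l. max 0 (G l - v) \<partial>L) + (\<integral>l. (if t \<le> l then v else 0) \<partial>L)"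
    using i1 i2 by (rule Bochner_Integration.integral_add)
  also have "(\<integral>l. max 0 (G l - v) \<partial>L) = (\<integral>u. max 0 (G (lam01 u) - v) \<partial>unif01)" by (rule integral_L) measurable
  also have "\<dots> = (\<integral>u. max 0 (u - v) \<partial>unif01)"
  proof (rule integral_cong_AE)
    show "AE u in unif01. max 0 (G (lam01 u) - v) = max 0 (u - v)"
      using unif01_range by eventually_elim (simp add: lam01(1) G_lam)
  qed measurable
  also have "\<dots> \<le> (1 - v)\<^sup>2 / 2" by (rule unif01_excess_le[OF assms])
  finally show ?thesis by simp
qed


lemma certificate_bound:
  assumes P: "(\<integral>u. u * (\<integral>t. cert_rho t * indicator {..u} t \<partial>D) \<partial>unif01)
      \<le> (\<integral>l. (\<integral>t. (if t \<le> l then 34/25 * l - cert_v t - cert_s t * (l - t) else cert_s t * (t - l)) \<partial>D) \<partial>L)"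
    and mean: "(\<integral>l. l \<partial>L) = 1/2"
  shows "(\<integral>l. Q l * G l \<partial>L) \<le> 34/25 * (\<integral>l. Q l * l \<partial>L)"
proof -
  have [measurable]: "cert_rho \<in> borel_measurable borel" "cert_s \<in> borel_measurable borel" "cert_v \<in> borel_measurable borel"
    unfolding cert_rho_def cert_s_def cert_v_def by measurable
  have Q_eq: "Q l = (\<integral>t. (if t \<le> l then 1 else 0) \<partial>D)" for l
  proof -
    have "(\<integral>t. (if t \<le> l then 1 else 0 :: real) \<partial>D) = (\<integral>t. indicator {..l} t \<partial>D)"
      by (rule Bochner_Integration.integral_cong) (auto simp: indicator_def)
    then show ?thesis by (simp add: measure_D)
  qed
  define A where "A = (\<lambda>t. \<integral>l. (if t \<le> l then G l else 0) \<partial>L)"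
  define R where "R = (\<lambda>t. \<integral>u. cert_rho t * (if t \<le> u then u else 0) \<partial>unif01)"
  \<comment> \<open>The terms that ranks and means leave over for a label.
    \<open>psi t l + h t l\<close> is \<open>34/25 * l\<close> for \<open>t \<le> l\<close> and 0
    otherwise, so its \<open>D\<close>-integral is \<open>34/25 * (Q l * l)\<close>.\<close>
  define h where "h t l = cert_s t * (l - t) + (if t \<le> l then cert_v t else 0)" for t l :: real
  define psi where "psi t l = (if t \<le> l then 34/25 * l - cert_v t - cert_s t * (l - t) else cert_s t * (t - l))" for t l :: real
  have s: "\<bar>cert_s t * (l - t)\<bar> \<le> 1" if "t \<in> {0..1}" "l \<in> {0..1}" for t l
  proof -
    have "\<bar>cert_s t\<bar> * \<bar>l - t\<bar> \<le> 1 * 1" using cert_s_range[of t] that by (intro mult_mono) auto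
    then show ?thesis by (simp add: abs_mult)
  qed
  have v: "\<bar>cert_v t\<bar> \<le> 1" if "t \<in> {0..1}" for t using cert_v_range[of t] that by auto
  have hb: "\<bar>h t l\<bar> \<le> 2" if "t \<in> {0..1}" "l \<in> {0..1}" for t l
    using s[OF that] v[OF that(1)] by (auto simp: h_def)
  have pb: "\<bar>psi t l\<bar> \<le> 4" if "t \<in> {0..1}" "l \<in> {0..1}" for t l
  proof -
    have "cert_s t * (t - l) = - (cert_s t * (l - t))" by (simp add: algebra_simps)
    then show ?thesis using s[OF that] v[OF that(1)] that by (auto simp: psi_def)
  qed
  have fA: "(\<integral>t. A t \<partial>D) = (\<integral>l. (\<integral>t. (if t \<le> l then G l else 0) \<partial>D) \<partial>L)" "integrable D A"
    unfolding A_def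
    by (rule bounded_fubini[OF L.prob_space_axioms D.prob_space_axioms _ L_range D_range, where K=1]; 
        use G_range in \<open>auto simp: split_beta'\<close>)+
  have fR: "(\<integral>t. R t \<partial>D) = (\<integral>u. (\<integral>t. cert_rho t * (if t \<le> u then u else 0) \<partial>D) \<partial>unif01)" "integrable D R"
    unfolding R_def
    by (rule bounded_fubini[OF U.prob_space_axioms D.prob_space_axioms _ unif01_range D_range, where K=1]; 
        use cert_rho_range in \<open>auto simp: split_beta' intro: mult_le_one\<close>)+
  have fh: "(\<integral>t. (\<integral>l. h t l \<partial>L) \<partial>D) = (\<integral>l. (\<integral>t. h t l \<partial>D) \<partial>L)" "integrable D (\<lambda>t. \<integral>l. h t l \<partial>L)"
      "integrable L (\<lambda>l. \<integral>t. h t l \<partial>D)"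
    by (rule bounded_fubini[OF L.prob_space_axioms D.prob_space_axioms _ L_range D_range, where K=2]; 
        (rule hb; assumption)?; simp add: h_def)+
  have fp: "integrable L (\<lambda>l. \<integral>t. psi t l \<partial>D)"
    by (rule bounded_fubini(3)[OF L.prob_space_axioms D.prob_space_axioms _ L_range D_range, where K=4]; 
        (rule pb; assumption)?; simp add: psi_def)+
  have ih: "integrable D (\<lambda>t. h t l)" if "l \<in> {0..1}" for l
    by (rule D.integrable_const_bound[where B=2]) (use eventually_mono[OF D_range] hb that in \<open>auto simp: h_def\<close>)
  have ip: "integrable D (\<lambda>t. psi t l)" if "l \<in> {0..1}" for l
    by (rule D.integrable_const_bound[where B=4]) (use eventually_mono[OF D_range] pb that in \<open>auto simp: psi_def\<close>)
  have "(\<integral>l. Q l * G l \<partial>L) = (\<integral>l. (\<integral>t. (if t \<le> l then G l else 0) \<partial>D) \<partial>L)"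
  proof (rule Bochner_Integration.integral_cong)
    fix l
    have "(\<integral>t. (if t \<le> l then 1 else 0) * G l \<partial>D) = (\<integral>t. (if t \<le> l then G l else 0) \<partial>D)"
      by (rule Bochner_Integration.integral_cong) auto
    then show "Q l * G l = (\<integral>t. (if t \<le> l then G l else 0) \<partial>D)" by (simp add: Q_eq)
  qed simp
  also have "\<dots> = (\<integral>t. A t \<partial>D)" by (rule fA(1)[symmetric])
  also have "\<dots> \<le> (\<integral>t. R t + (\<integral>l. h t l \<partial>L) \<partial>D)"
  proof (rule integral_mono_AE)
    show "AE t in D. A t \<le> R t + (\<integral>l. h t l \<partial>L)"
      using D_range
    proof eventually_elim
      case (elim t)
      then have t: "0 \<le> t" "t \<le> 1" by auto
      have i: "integrable L (\<lambda>l. if t \<le> l then cert_v t else 0)"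
        by (rule L.integrable_const_bound[where B="\<bar>cert_v t\<bar>"]) auto
      have i': "integrable L (\<lambda>l. l)"
        by (rule L.integrable_const_bound[where B=1, OF eventually_mono[OF L_range]]) auto
      have "A t \<le> (1 - cert_v t)\<^sup>2 / 2 + (\<integral>l. (if t \<le> l then cert_v t else 0) \<partial>L)"
        unfolding A_def using cert_v_range(2)[OF t] by (rule rank_tail_le)
      also have "(1 - cert_v t)\<^sup>2 / 2 \<le> cert_rho t * (1 - t\<^sup>2) / 2 + cert_s t * (1/2 - t)" by (rule cert_budget[OF t])
      also have "cert_rho t * (1 - t\<^sup>2) / 2 = R t"
        unfolding R_def using unif01_tail_mean[OF t] by simp
      \<comment> \<open>As the mean label is 1/2, \<open>cert_s t * (1/2 - t)\<close> is the mean
        over the labels of \<open>cert_s t * (l - t)\<close>, which the same term in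
        \<open>psi\<close> cancels pointwise.\<close>
      also have "R t + cert_s t * (1/2 - t) + (\<integral>l. (if t \<le> l then cert_v t else 0) \<partial>L) = R t + (\<integral>l. h t l \<partial>L)"
        unfolding h_def using i i' by (simp add: mean L.prob_space[simplified])
      finally show ?case by simp
    qed
  qed (use fA fR fh in auto)
  also have "\<dots> = (\<integral>t. R t \<partial>D) + (\<integral>l. (\<integral>t. h t l \<partial>D) \<partial>L)"
    using fR(2) fh(1,2) by simp
  also have "(\<integral>t. R t \<partial>D) = (\<integral>u. u * (\<integral>t. cert_rho t * indicator {..u} t \<partial>D) \<partial>unif01)"
    unfolding fR(1)
  proof (rule Bochner_Integration.integral_cong)
    fix u
    have "(\<integral>t. cert_rho t * (if t \<le> u then u else 0) \<partial>D) = (\<integral>t. u * (cert_rho t * indicator {..u} t) \<partial>D)"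
      by (rule Bochner_Integration.integral_cong) (auto simp: indicator_def)
    then show "(\<integral>t. cert_rho t * (if t \<le> u then u else 0) \<partial>D) = u * (\<integral>t. cert_rho t * indicator {..u} t \<partial>D)" by simp
  qed simp
  also have "\<dots> + (\<integral>l. (\<integral>t. h t l \<partial>D) \<partial>L) \<le> (\<integral>l. (\<integral>t. psi t l \<partial>D) \<partial>L) + (\<integral>l. (\<integral>t. h t l \<partial>D) \<partial>L)"
    using P by (simp add: psi_def)
  also have "\<dots> = (\<integral>l. (\<integral>t. psi t l \<partial>D) + (\<integral>t. h t l \<partial>D) \<partial>L)" using fp fh(3) by simp
  also have "\<dots> = (\<integral>l. 34/25 * (Q l * l) \<partial>L)"
  proof (rule integral_cong_AE)
    show "AE l in L. (\<integral>t. psi t l \<partial>D) + (\<integral>t. h t l \<partial>D) = 34/25 * (Q l * l)"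
      using L_range
    proof eventually_elim
      case (elim l)
      have "(\<integral>t. psi t l \<partial>D) + (\<integral>t. h t l \<partial>D) = (\<integral>t. psi t l + h t l \<partial>D)"
        using ih[OF elim] ip[OF elim] by simp
      also have "\<dots> = (\<integral>t. (if t \<le> l then 1 else 0) * (34/25 * l) \<partial>D)"
        by (rule Bochner_Integration.integral_cong) (auto simp: psi_def h_def algebra_simps)
      also have "\<dots> = Q l * (34/25 * l)" unfolding Q_eq by (rule Bochner_Integration.integral_mult_left_zero)
      finally show ?case by simp
    qed
  qed (use fp fh(3) in auto)
  finally show ?thesis by simp
qed

end

section \<open>Equilibria\<close>

locale grading_equilibrium = job_market mu mu' for mu mu' +
  fixes n :: nat and w :: "nat \<Rightarrow> real" and F :: "nat \<Rightarrow> real measure" and J :: "nat \<Rightarrow> (real \<times> real) measure"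
  assumes w_pos: "\<And>i. i < n \<Longrightarrow> 0 < w i" and w_sum: "(\<Sum>i<n. w i) = 1"
    and F_prob: "\<And>i. i < n \<Longrightarrow> prob_space (F i) \<and> sets (F i) = sets borel \<and> (AE x in F i. x \<in> {0..1})"
    and F_unif: "\<And>x. x \<in> {0..1} \<Longrightarrow> (\<Sum>i<n. w i * measure (F i) {..x}) = x"
    and equilibrium: "is_equilibrium mu n w F J"
begin

abbreviation "Gle \<equiv> agg_cdf n w J"
abbreviation "Glt \<equiv> agg_cdf_lt n w J"
abbreviation "Qd \<equiv> desirability mu n w J"

lemma transcript: "i < n \<Longrightarrow> is_transcript (F i) (J i)"
  using equilibrium by (simp add: is_equilibrium_def)

lemma J_prob: "i < n \<Longrightarrow> prob_space (J i) \<and> sets (J i) = sets borel"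
  and label_range: "i < n \<Longrightarrow> AE p in J i. snd p \<in> {0..1}"
  using transcript[of i] by (auto simp: is_transcript_def)

lemma measurable_J: "i < n \<Longrightarrow> f \<in> borel_measurable borel \<Longrightarrow> f \<in> borel_measurable (J i)"
  using J_prob[of i] by (simp add: measurable_cong_sets[of "J i" borel])

lemma ability_range: assumes "i < n" shows "AE p in J i. fst p \<in> {0..1}"
proof (rule AE_distrD[where P="\<lambda>x. x \<in> {0..1}"])
  show "fst \<in> borel_measurable (J i)" using assms by (intro measurable_J) auto
  show "AE x in distr (J i) borel fst. x \<in> {0..1}"
  proof -
    have "distr (J i) borel fst = F i" using transcript[OF assms] by (simp add: is_transcript_def)
    then show ?thesis using F_prob[OF assms] by (simp only:)
  qed
qed

text \<open>The joint law of ability and label of a student drawn from the whole population. It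
  links the per-school inequalities to the uniform abilities and to the aggregate labels.\<close>

lemma aggregate_law:
  obtains N where "prob_space N" "sets N = sets borel"
    "\<And>f B. f \<in> borel_measurable borel \<Longrightarrow> (\<And>p. \<bar>f p\<bar> \<le> B) \<Longrightarrow> (\<integral>p. f p \<partial>N) = (\<Sum>i<n. w i * (\<integral>p. f p \<partial>J i))"
    "AE p in N. fst p \<in> {0..1}" "AE p in N. snd p \<in> {0..1}"
    "\<And>A. A \<in> sets borel \<Longrightarrow> measure N A = (\<Sum>i<n. w i * measure (J i) A)"
    "distr N borel fst = unif01"
proof -
  obtain N where N: "prob_space N" "sets N = sets borel"
    and int: "\<And>f B. f \<in> borel_measurable borel \<Longrightarrow> (\<And>p. \<bar>f p\<bar> \<le> B) \<Longrightarrow> (\<integral>p. f p \<partial>N) = (\<Sum>i<n. w i * (\<integral>p. f p \<partial>J i))"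
    and AEN: "\<And>P. (\<And>i. i < n \<Longrightarrow> AE p in J i. P p) \<Longrightarrow> {p. P p} \<in> sets borel \<Longrightarrow> AE p in N. P p"
    by (rule finite_mixture[of n w J]) (use w_pos w_sum J_prob in \<open>auto intro: less_imp_le\<close>)
  interpret N: prob_space N by (rule N(1))
  have fstm: "fst \<in> borel_measurable N" using N(2) by (simp add: measurable_cong_sets[of N borel])
  have spN: "space N = UNIV" using sets_eq_imp_space_eq[OF N(2)] by simp
  have m: "measure N A = (\<Sum>i<n. w i * measure (J i) A)" if A: "A \<in> sets borel" for A
  proof -
    have "measure N A = (\<integral>p. indicator A p \<partial>N)" using A N spN by simp
    also have "\<dots> = (\<Sum>i<n. w i * (\<integral>p. indicator A p \<partial>J i))"
      by (rule int[where B=1]) (use A in \<open>auto simp: indicator_def\<close>)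
    also have "\<dots> = (\<Sum>i<n. w i * measure (J i) A)"
      using J_prob A by (intro sum.cong) (auto simp: sets_eq_imp_space_eq[of _ borel])
    finally show ?thesis .
  qed
  have a: "AE p in N. fst p \<in> {0..1}"
    by (rule AEN[OF ability_range]) (use measurable_sets[OF borel_measurable_fst_real, of "{0..1}"] in \<open>auto simp: vimage_def\<close>)
  have b: "AE p in N. snd p \<in> {0..1}"
    by (rule AEN[OF label_range]) (use measurable_sets[OF borel_measurable_snd_real, of "{0..1}"] in \<open>auto simp: vimage_def\<close>)
  have fst_le: "{p :: real \<times> real. fst p \<le> x} \<in> sets borel" for x
    using measurable_sets[OF borel_measurable_fst_real, of "{..x}"] by (auto simp: vimage_def)
  have c: "distr N borel fst = unif01"
  proof (rule real_distribution_eq_unif01)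
    show "real_distribution (distr N borel fst)" using fstm by (rule N.real_distribution_distr)
    show "AE x in distr N borel fst. x \<in> {0..1}" using a by (subst AE_distr_iff[OF fstm]) auto
    fix x :: real assume x: "x \<in> {0..1}"
    have "measure (distr N borel fst) {..x} = measure N {p. fst p \<le> x}"
      using fstm by (subst measure_distr) (auto simp: spN vimage_def)
    also have "\<dots> = (\<Sum>i<n. w i * measure (J i) {p. fst p \<le> x})" by (rule m[OF fst_le])
    also have "\<dots> = (\<Sum>i<n. w i * measure (F i) {..x})"
    proof (rule sum.cong)
      fix i assume "i \<in> {..<n}"
      then have i: "i < n" by simp
      have "measure (F i) {..x} = measure (distr (J i) borel fst) {..x}"
        using transcript[OF i] by (simp add: is_transcript_def)
      also have "\<dots> = measure (J i) {p. fst p \<le> x}"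
        using measurable_J[OF i borel_measurable_fst_real] J_prob[OF i]
        by (subst measure_distr) (auto simp: vimage_def sets_eq_imp_space_eq[of _ borel])
      finally show "w i * measure (J i) {p. fst p \<le> x} = w i * measure (F i) {..x}" by simp
    qed simp
    also have "\<dots> = x" by (rule F_unif[OF x])
    finally show "measure (distr N borel fst) {..x} = x" .
  qed
  show thesis by (rule that[OF N int a b m c])
qed

lemma label_sets: "{p :: real \<times> real. snd p \<le> x} \<in> sets borel" "{p :: real \<times> real. snd p < x} \<in> sets borel"
    "{p :: real \<times> real. snd p = x} \<in> sets borel"
  using measurable_sets[OF borel_measurable_snd_real, of "{..x}"] measurable_sets[OF borel_measurable_snd_real, of "{..<x}"]
    measurable_sets[OF borel_measurable_snd_real, of "{x}"] by (auto simp: vimage_def)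

lemma agg_cdf_jump: "Gle l - Glt l = (\<Sum>i<n. w i * measure (J i) {p. snd p = l})"
proof -
  have "measure (J i) {p. snd p \<le> l} - measure (J i) {p. snd p < l} = measure (J i) {p. snd p = l}" if "i < n" for i
  proof -
    interpret prob_space "J i" using J_prob that by simp
    have *: "{p. snd p = l} = {p. snd p \<le> l} - {p. snd p < l}" by auto
    show ?thesis unfolding * using J_prob[OF that] label_sets
      by (subst finite_measure_Diff) auto
  qed
  then show ?thesis
    unfolding agg_cdf_def agg_cdf_lt_def sum_subtractf[symmetric] right_diff_distrib[symmetric] by simp
qed

lemma agg_cdf_mono: "x \<le> y \<Longrightarrow> Gle x \<le> Gle y" "x \<le> y \<Longrightarrow> Glt x \<le> Glt y" "Glt x \<le> Gle x" "x < y \<Longrightarrow> Gle x \<le> Glt y"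
proof -
  have m: "(\<Sum>i<n. w i * measure (J i) A) \<le> (\<Sum>i<n. w i * measure (J i) B)" if "A \<subseteq> B" "A \<in> sets borel" "B \<in> sets borel" for A B
    using that J_prob w_pos
    by (intro sum_mono mult_left_mono finite_measure.finite_measure_mono prob_space.finite_measure) (auto intro: less_imp_le)
  show "x \<le> y \<Longrightarrow> Gle x \<le> Gle y" "x \<le> y \<Longrightarrow> Glt x \<le> Glt y" "Glt x \<le> Gle x" "x < y \<Longrightarrow> Gle x \<le> Glt y"
    unfolding agg_cdf_def agg_cdf_lt_def by (auto intro!: m label_sets)
qed

lemma agg_cdf_range: "Gle x \<in> {0..1}" "Glt x \<in> {0..1}"
proof -
  have "(\<Sum>i<n. w i * measure (J i) A) \<le> (\<Sum>i<n. w i * 1)" for A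
    using J_prob w_pos by (intro sum_mono mult_left_mono prob_space.prob_le_1) (auto intro: less_imp_le)
  moreover have "0 \<le> (\<Sum>i<n. w i * measure (J i) A)" for A
    using w_pos by (intro sum_nonneg mult_nonneg_nonneg) (auto intro: less_imp_le)
  ultimately show "Gle x \<in> {0..1}" "Glt x \<in> {0..1}" unfolding agg_cdf_def agg_cdf_lt_def by (auto simp: w_sum)
qed

lemma desirability_bounds:
  "QT mu (Glt l) \<le> Qd l" "Qd l \<le> QT mu (Gle l)" "Glt l < Gle l \<Longrightarrow> Qd l < QT mu (Gle l)"
  using QT_average[of "Glt l" "Gle l"] agg_cdf_range[of l] agg_cdf_mono(3)[of l] QT_mono[of "Glt l" "Gle l"]
  by (auto simp: desirability_def Let_def)

lemma desirability_range: "0 \<le> Qd l" "Qd l \<le> 1"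
  using desirability_bounds[of l] QT_props(1)[OF agg_cdf_range(1)[of l]] QT_props(1)[OF agg_cdf_range(2)[of l]] by auto

lemma desirability_measurable [measurable]: "Qd \<in> borel_measurable borel"
proof -
  \<comment> \<open>A continuous primitive of \<open>QT mu\<close>; it turns the integral with
    limits depending on \<open>l\<close> into a difference of Borel functions of
    \<open>l\<close>.\<close>
  define R where "R x = integral {0..max 0 (min 1 x)} (QT mu)" for x
  have "continuous_on UNIV R" unfolding R_def
    by (rule continuous_on_compose2[OF indefinite_integral_continuous_1[OF QT_integrable[of 0 1]]])
       (auto intro!: continuous_intros)
  then have [measurable]: "R \<in> borel_measurable borel" by (rule borel_measurable_continuous_onI)
  have [measurable]: "Gle \<in> borel_measurable borel" "Glt \<in> borel_measurable borel"
    using agg_cdf_mono by (auto intro!: borel_measurable_mono monoI)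
  have "integral {Glt l..Gle l} (QT mu) = R (Gle l) - R (Glt l)" for l
  proof -
    have "integral {0..Glt l} (QT mu) + integral {Glt l..Gle l} (QT mu) = integral {0..Gle l} (QT mu)"
      using agg_cdf_range[of l] agg_cdf_mono(3)[of l]
      by (intro Henstock_Kurzweil_Integration.integral_combine QT_integrable) auto
    then show ?thesis using agg_cdf_range[of l] by (simp add: R_def max_absorb2 min_absorb2)
  qed
  then have "Qd = (\<lambda>l. if Glt l < Gle l then (R (Gle l) - R (Glt l)) / (Gle l - Glt l) else QT mu (Gle l))"
    by (simp add: desirability_def Let_def fun_eq_iff)
  then show ?thesis by (rule ssubst) measurable
qed

lemma school: assumes "i < n" shows "school (F i) (J i) Qd"
  by (rule school.intro)
     (use assms transcript ability_range desirability_range equilibrium in \<open>auto simp: is_equilibrium_def\<close>)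

text \<open>An atom of one school, having positive weight, would be an atom of the uniform
  aggregate.\<close>

lemma no_ability_atom: assumes "i < n" shows "measure (F i) {l} = 0"
proof -
  have "(\<Sum>i<n. w i * measure (F i) {l}) = 0"
  proof -
    obtain N where N: "prob_space N" "sets N = sets borel"
      and m: "\<And>A. A \<in> sets borel \<Longrightarrow> measure N A = (\<Sum>i<n. w i * measure (J i) A)"
      and f: "distr N borel fst = unif01" by (rule aggregate_law) blast
    have s: "{p :: real \<times> real. fst p = l} \<in> sets borel"
      using measurable_sets[OF borel_measurable_fst_real, of "{l}"] by (auto simp: vimage_def)
    have "measure (F j) {l} = measure (J j) {p. fst p = l}" if j: "j < n" for j
    proof -
      have "measure (F j) {l} = measure (distr (J j) borel fst) {l}"
        using transcript[OF j] by (simp add: is_transcript_def)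
      also have "\<dots> = measure (J j) {p. fst p = l}"
        using measurable_J[OF j borel_measurable_fst_real] J_prob[OF j]
        by (subst measure_distr) (auto simp: vimage_def sets_eq_imp_space_eq[of _ borel])
      finally show ?thesis .
    qed
    then have "(\<Sum>i<n. w i * measure (F i) {l}) = measure N {p. fst p = l}" by (simp add: m[OF s])
    also have "\<dots> = measure (distr N borel fst) {l}"
      by (subst measure_distr)
         (auto simp: vimage_def sets_eq_imp_space_eq[OF N(2)] measurable_cong_sets[OF N(2) refl])
    also have "\<dots> = 0" unfolding f unif01_def by (simp add: measure_def emeasure_uniform_measure)
       (cases "l \<in> {0..1}"; simp)
    finally show ?thesis .
  qed
  then have "\<forall>i\<in>{..<n}. w i * measure (F i) {l} = 0"
    using w_pos by (subst (asm) sum_nonneg_eq_0_iff) (auto intro!: mult_nonneg_nonneg intro: less_imp_le)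
  then show ?thesis using assms w_pos[OF assms] by (metis lessThan_iff less_irrefl mult_eq_0_iff)
qed

lemma agg_cdf_continuous: "Glt l = Gle l"
proof (rule ccontr)
  assume "Glt l \<noteq> Gle l"
  then have lt: "Glt l < Gle l" using agg_cdf_mono(3)[of l] by simp
  have "measure (J i) {p. snd p = l} = 0" if "i < n" for i
  proof (rule school.no_label_atom[OF school[OF that] no_ability_atom[OF that]])
    \<comment> \<open>Students tied at \<open>l\<close> get the average job of their rank interval,
      strictly worse than the job at its upper end, while every label above \<open>l\<close> gets at
      least the latter.\<close>
    show "0 < QT mu (Gle l) - Qd l" using desirability_bounds(3)[OF lt] by simp
    fix x assume "l < x"
    then have "QT mu (Gle l) \<le> QT mu (Glt x)"
      using agg_cdf_mono(4)[of l x] agg_cdf_range by (intro QT_mono) auto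
    also have "\<dots> \<le> Qd x" by (rule desirability_bounds(1))
    finally show "Qd l + (QT mu (Gle l) - Qd l) \<le> Qd x" by simp
  qed
  then show False using agg_cdf_jump[of l] lt by simp
qed

lemma anarchy_bound:
  shows "integral {0..1} (\<lambda>q. q * mu q * mu' q) \<le> 34/25 * integral {0..1} (\<lambda>q. q * eq_label_of_job mu n w J q * mu' q)"
  and "0 \<le> integral {0..1} (\<lambda>q. q * eq_label_of_job mu n w J q * mu' q)"
proof -
  obtain N where N: "prob_space N" "sets N = sets borel"
    and int: "\<And>f B. f \<in> borel_measurable borel \<Longrightarrow> (\<And>p. \<bar>f p\<bar> \<le> B) \<Longrightarrow> (\<integral>p. f p \<partial>N) = (\<Sum>i<n. w i * (\<integral>p. f p \<partial>J i))"
    and a: "AE p in N. fst p \<in> {0..1}" and b: "AE p in N. snd p \<in> {0..1}"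
    and m: "\<And>A. A \<in> sets borel \<Longrightarrow> measure N A = (\<Sum>i<n. w i * measure (J i) A)"
    and f: "distr N borel fst = unif01" by (rule aggregate_law) blast
  interpret N: prob_space N by (rule N(1))
  have mN: "g \<in> borel_measurable N" if "g \<in> borel_measurable borel" for g :: "real \<times> real \<Rightarrow> real"
    using that by (simp add: measurable_cong_sets[OF N(2) refl])
  have spN: "space N = UNIV" using sets_eq_imp_space_eq[OF N(2)] by simp
  define L where "L = distr N borel snd"
  have cdfL: "cdf L x = Gle x" for x
    unfolding cdf_def L_def agg_cdf_def using m[OF label_sets(1)[of x]]
    by (subst measure_distr) (auto simp: mN vimage_def spN)
  interpret label_market mu mu' L
  proof (intro label_market.intro label_market_axioms.intro job_market_axioms)
    show "real_distribution L" unfolding L_def by (rule N.real_distribution_distr) (simp add: mN)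
    show "AE l in L. l \<in> {0..1}" unfolding L_def using b by (subst AE_distr_iff) (auto simp: mN)
    show "measure L {l} = 0" for l
      unfolding L_def using m[OF label_sets(3)[of l]] agg_cdf_jump[of l] agg_cdf_continuous[of l]
      by (subst measure_distr) (auto simp: mN vimage_def spN)
  qed
  have G_eq: "G = Gle" by (simp add: G_def cdfL fun_eq_iff)
  have Q_eq: "Q = Qd" by (simp add: Q_def G_eq desirability_def agg_cdf_continuous fun_eq_iff)
  \<comment> \<open>\<open>int\<close> asks for a bound at every point, whereas abilities and labels
    are bounded only almost surely; clamping changes none of the integrals.\<close>
  define cl where "cl u = max 0 (min 1 u)" for u :: real
  have [measurable]: "cl \<in> borel_measurable borel" unfolding cl_def by measurable
  have cl01: "cl u \<in> {0..1}" and cl_id: "u \<in> {0..1} \<Longrightarrow> cl u = u" for u by (auto simp: cl_def)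
  have clb: "\<bar>cl u\<bar> \<le> 1" for u using cl01[of u] by auto
  have U_cl: "AE u in unif01. cl u = u" by (rule eventually_mono[OF unif01_range cl_id])
  have L_cl: "AE l in L. cl l = l" by (rule eventually_mono[OF L_range cl_id])
  have J_cl: "AE p in J i. cl (fst p) = fst p" "AE p in J i. cl (snd p) = snd p" if "i < n" for i
    using eventually_mono[OF ability_range[OF that] cl_id] eventually_mono[OF label_range[OF that] cl_id] by auto
  have U_N: "(\<integral>u. h u \<partial>unif01) = (\<integral>p. h (fst p) \<partial>N)" if "h \<in> borel_measurable borel" for h :: "real \<Rightarrow> real"
    unfolding f[symmetric] using that by (subst integral_distr) (auto simp: mN)
  have L_N: "(\<integral>l. h l \<partial>L) = (\<integral>p. h (snd p) \<partial>N)" if "h \<in> borel_measurable borel" for h :: "real \<Rightarrow> real"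
    unfolding L_def using that by (subst integral_distr) (auto simp: mN)
  have mean: "(\<integral>l. l \<partial>L) = 1/2"
  proof -
    have "(\<integral>l. l \<partial>L) = (\<integral>l. cl l \<partial>L)"
      using L_cl by (intro integral_cong_AE) (auto elim!: eventually_mono)
    also have "\<dots> = (\<Sum>i<n. w i * (\<integral>p. cl (snd p) \<partial>J i))"
      by (subst L_N) (auto intro!: int[where B=1] clb)
    also have "\<dots> = (\<Sum>i<n. w i * (\<integral>p. cl (fst p) \<partial>J i))"
    proof (intro sum.cong refl arg_cong2[where f="(*)"])
      fix i assume "i \<in> {..<n}"
      then have i: "i < n" by simp
      have "(\<integral>p. cl (snd p) \<partial>J i) = (\<integral>p. snd p \<partial>J i)"
        using J_cl(2)[OF i] by (intro integral_cong_AE measurable_J[OF i]) (auto elim!: eventually_mono)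
      also have "\<dots> = (\<integral>p. fst p \<partial>J i)"
        using transcript[OF i] by (auto simp: is_transcript_def dest: bspec[of _ _ UNIV])
      also have "\<dots> = (\<integral>p. cl (fst p) \<partial>J i)"
        using J_cl(1)[OF i] by (intro integral_cong_AE measurable_J[OF i]) (auto elim!: eventually_mono)
      finally show "(\<integral>p. cl (snd p) \<partial>J i) = (\<integral>p. cl (fst p) \<partial>J i)" .
    qed
    also have "\<dots> = (\<integral>u. cl u \<partial>unif01)"
      by (subst U_N) (auto intro!: int[where B=1, symmetric] clb)
    also have "\<dots> = (\<integral>u. u \<partial>unif01)"
      using U_cl by (intro integral_cong_AE) (auto elim!: eventually_mono)
    finally show ?thesis by (simp add: unif01_mean)
  qed
  have [measurable]: "cert_rho \<in> borel_measurable borel" "cert_s \<in> borel_measurable borel" "cert_v \<in> borel_measurable borel"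
    unfolding cert_rho_def cert_s_def cert_v_def by measurable
  have cs: "certified_school (F i) (J i) Qd D (34/25) cert_rho cert_s cert_v {..<5} lift_weight lift_knot" if "i < n" for i
  proof (intro certified_school.intro certified_school_axioms.intro school[OF that])
    show "\<bar>cert_v t\<bar> \<le> 1" if "0 \<le> t" "t \<le> 1" for t using cert_v_range[OF that] by auto
    show "measure D {..x} = Qd x" for x using measure_D[of x] by (simp add: Q_eq)
  qed (use D.prob_space_axioms D_range cert_rho_range cert_s_range lift_weight_nonneg lift_knot_range
         lift_weight_sum_le lift_weight_cover lift_cost_le cert_slack in auto)
  have n0: "0 < n" using w_sum by (cases n) auto
  \<comment> \<open>\<open>P\<close> and \<open>Psi\<close> depend only on \<open>D\<close> and the
    certificate, so the constants obtained from school type 0 are those of every type and the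
    inequalities can be summed.\<close>
  interpret S0: certified_school "F 0" "J 0" Qd D "34/25" cert_rho cert_s cert_v "{..<5}" lift_weight lift_knot
    by (rule cs[OF n0])
  note [measurable] = S0.P_measurable S0.Psi_measurable
  have Pb: "\<bar>cl u * S0.P u'\<bar> \<le> 1" for u u'
    using mult_mono[of "cl u" 1 "S0.P u'" 1] cl01[of u] S0.P_range[of u'] by auto
  have Psib: "\<bar>S0.Psi (cl u)\<bar> \<le> \<bar>34/25\<bar> + 2" for u using S0.Psi_range[of "cl u"] cl01[of u] by auto
  have "(\<integral>u. u * S0.P u \<partial>unif01) = (\<integral>u. cl u * S0.P u \<partial>unif01)"
    using U_cl by (intro integral_cong_AE) (auto elim!: eventually_mono)
  also have "\<dots> = (\<Sum>i<n. w i * (\<integral>p. cl (fst p) * S0.P (fst p) \<partial>J i))"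
    by (subst U_N) (auto intro!: int[where B=1] Pb)
  also have "\<dots> \<le> (\<Sum>i<n. w i * (\<integral>p. S0.Psi (cl (snd p)) \<partial>J i))"
  proof (intro sum_mono mult_left_mono)
    fix i assume "i \<in> {..<n}"
    then have i: "i < n" by simp
    show "0 \<le> w i" using w_pos[OF i] by simp
    have "(\<integral>p. cl (fst p) * S0.P (fst p) \<partial>J i) = (\<integral>p. fst p * S0.P (fst p) \<partial>J i)"
      using J_cl(1)[OF i] by (intro integral_cong_AE measurable_J[OF i]) (auto elim!: eventually_mono)
    also have "\<dots> \<le> (\<integral>p. S0.Psi (snd p) \<partial>J i)"
      by (rule certified_school.ability_label_ineq[OF cs[OF i]]) (use Q_continuous in \<open>simp add: Q_eq\<close>)
    also have "\<dots> = (\<integral>p. S0.Psi (cl (snd p)) \<partial>J i)"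
      using J_cl(2)[OF i] by (intro integral_cong_AE measurable_J[OF i]) (auto elim!: eventually_mono)
    finally show "(\<integral>p. cl (fst p) * S0.P (fst p) \<partial>J i) \<le> (\<integral>p. S0.Psi (cl (snd p)) \<partial>J i)" .
  qed
  also have "\<dots> = (\<integral>l. S0.Psi (cl l) \<partial>L)"
    by (subst L_N) (auto intro!: int[symmetric, OF _ Psib])
  also have "\<dots> = (\<integral>l. S0.Psi l \<partial>L)"
    using L_cl by (intro integral_cong_AE) (auto elim!: eventually_mono)
  finally have "(\<integral>l. Q l * G l \<partial>L) \<le> 34/25 * (\<integral>l. Q l * l \<partial>L)"
    by (intro certificate_bound mean) (simp add: S0.P_def S0.Psi_def S0.psi_def)
  moreover have "eq_label_of_job mu n w J q = lam (mu q)" for q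
    by (simp add: eq_label_of_job_def lam_def G_eq)
  moreover have "0 \<le> (\<integral>l. Q l * l \<partial>L)"
    using L_range Q_range by (intro integral_nonneg_AE) (auto elim!: eventually_mono)
  ultimately show "integral {0..1} (\<lambda>q. q * mu q * mu' q) \<le> 34/25 * integral {0..1} (\<lambda>q. q * eq_label_of_job mu n w J q * mu' q)"
    and "0 \<le> integral {0..1} (\<lambda>q. q * eq_label_of_job mu n w J q * mu' q)"
    by (simp_all add: integral_cdf_jobs integral_label_jobs)
qed

end

theorem mainTheorem6:
  fixes mu mu' :: "real \<Rightarrow> real"
    and n :: nat and w :: "nat \<Rightarrow> real"
    and F :: "nat \<Rightarrow> real measure"
    and J :: "nat \<Rightarrow> (real \<times> real) measure"
  assumes dens_int: "mu' integrable_on {0..1}"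
    and dens_pos: "\<forall>x\<in>{0..1}. mu' x > 0"
    and mu_cdf: "\<forall>x\<in>{0..1}. mu x = integral {0..x} mu'"
    and mu_one: "mu 1 = 1"
    and QT_switch: "finitely_many_switches (QT mu)"
    and w_pos: "\<forall>i<n. w i > 0"
    and w_sum: "(\<Sum>i<n. w i) = 1"
    and F_prob: "\<forall>i<n. prob_space (F i) \<and> sets (F i) = sets borel \<and> (AE x in F i. x \<in> {0..1})"
    and F_unif: "\<forall>x\<in>{0..1}. (\<Sum>i<n. w i * measure (F i) {..x}) = x"
    and conn_eq: "is_connected_equilibrium mu n w F J"
  shows "integral {0..1} (\<lambda>q. q * mu q * mu' q)
           / integral {0..1} (\<lambda>q. q * eq_label_of_job mu n w J q * mu' q) \<le> (1.36::real)"
proof -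
  interpret grading_equilibrium mu mu' n w F J
    by unfold_locales (use assms in \<open>auto simp: is_connected_equilibrium_def\<close>)
  let ?den = "integral {0..1} (\<lambda>q. q * eq_label_of_job mu n w J q * mu' q)"
  show ?thesis
  \<comment> \<open>If the denominator vanishes, the quotient is 0 by the convention for
    division.\<close>
  proof (cases "?den = 0")
    case False
    then have "0 < ?den" using anarchy_bound(2) by linarith
    then show ?thesis using anarchy_bound(1) by (simp add: pos_divide_le_eq)
  qed simp
qed

end
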